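(* Let $M\in\mathbb{R}^{p\times v}[s]$ be a $p\times v$ polynomial matrix, let $E$ be the number of nonzero entries of $M$, and let $\mathfrak{B}$ be the behavior described by $M(\frac{\mathrm{d}}{\mathrm{d}t})w=0$. Then there exists an algorithm taking $O(E^2\sqrt{p+v})$ time to check whether $\mathfrak{B}$ is structurally controllable.
   Context: $\mathbb{R}^{p\times v}[s]$ denotes the $p\times v$ matrices with entries in $\mathbb{R}[s]$. The behavior of $M$ is $\mathfrak{B}=\{w\in C^\infty(\mathbb{R},\mathbb{R}^v) : M(\frac{\mathrm{d}}{\mathrm{d}t})w=0\}$. It is controllable if and only if $M(\lambda)$ has constant rank for all $\lambda\in\mathbb{C}$, equivalently $\mathrm{zeros}(M)=\{\lambda\in\mathbb{C}:\mathrm{rank}\,M(\lambda)<\mathrm{rank}\,M(s)\}$ is empty. Structural controllability: $\mathfrak{B}$ is structurally controllable if controllability holds generically, in the following sense. Let $S$ be the set of positions $(i,j)$ of nonzero entries of $M$ and $d_{ij}$ the degree of the entry at $(i,j)\in S$. Consider all matrices whose $(i,j)$ entry is $0$ if $(i,j)\notin S$ and is $\sum_{k=0}^{d_{ij}}a_{ij,k}s^k$ if $(i,j)\in S$, with all coefficients $a_{ij,k}$ regarded as independent real parameters ($N$ of them in total). A property holds generically if the set of parameter values in $\mathbb{R}^N$ for which it fails is contained in the solution set of $f=0$ for some nonzero polynomial $f$ in the $N$ parameters. Input convention: the matrix is assumed to have been already mapped to a weighted bipartite graph with vertex sets the $p$ rows and $v$ columns, one edge for each nonzero entry, and edge weight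 equal to the degree of that entry; running time is counted in elementary operations on this graph. *)

theory Defs
  imports
    "HOL-Library.Poly_Mapping"
    "HOL-Library.FuncSet"
    "Jordan_Normal_Form.DL_Rank"
    Complex_Main
begin

section \<open>Structural controllability of polynomial matrices\<close>

definition eval_mat :: "real poly mat \<Rightarrow> complex \<Rightarrow> complex mat" where
  "eval_mat M z = map_mat (\<lambda>q. poly (map_poly complex_of_real q) z) M"

text \<open>Controllability of the behavior of \<open>M\<close>, i.e. of the set of smooth \<open>w\<close> with
  \<open>M(d/dt) w = 0\<close>, by the rank condition on the representing matrix. The first argument of
  \<^term>\<open>vec_space.rank\<close> is the number of rows.\<close>

definition controllable :: "real poly mat \<Rightarrow> bool" where
  "controllable M \<longleftrightarrow>
     (\<exists>r. \<forall>z. vec_space.rank (dim_row M) (eval_mat M z) = r)"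

definition nonzero_positions :: "'a::zero mat \<Rightarrow> (nat \<times> nat) set" where
  "nonzero_positions M = {(i, j). i < dim_row M \<and> j < dim_col M \<and> M $$ (i, j) \<noteq> 0}"

text \<open>The parameter \<open>a (i, j, k)\<close> is the coefficient of \<open>s ^ k\<close> in entry \<open>(i, j)\<close>.\<close>

definition parameters :: "real poly mat \<Rightarrow> (nat \<times> nat \<times> nat) set" where
  "parameters M = {(i, j, k). (i, j) \<in> nonzero_positions M \<and> k \<le> degree (M $$ (i, j))}"

definition structured_mat :: "real poly mat \<Rightarrow> (nat \<times> nat \<times> nat \<Rightarrow> real) \<Rightarrow> real poly mat" where
  "structured_mat M a = mat (dim_row M) (dim_col M)
     (\<lambda>(i, j). if (i, j) \<in> nonzero_positions M
               then \<Sum>k\<le>degree (M $$ (i, j)). monom (a (i, j, k)) k else 0)"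

text \<open>Real polynomials in indeterminates of type \<open>'x\<close>: finitely supported maps from monomials
  (finitely supported exponent functions) to coefficients.\<close>

type_synonym 'x mpoly = "('x \<Rightarrow>\<^sub>0 nat) \<Rightarrow>\<^sub>0 real"

definition indeterminates :: "'x mpoly \<Rightarrow> 'x set" where
  "indeterminates f = (\<Union>m\<in>Poly_Mapping.keys f. Poly_Mapping.keys m)"

definition eval_mpoly :: "'x mpoly \<Rightarrow> ('x \<Rightarrow> real) \<Rightarrow> real" where
  "eval_mpoly f a = (\<Sum>m\<in>Poly_Mapping.keys f. Poly_Mapping.lookup f m *
     (\<Prod>x\<in>Poly_Mapping.keys m. a x ^ Poly_Mapping.lookup m x))"

text \<open>For finite \<open>X\<close> with \<open>N\<close> elements, \<^term>\<open>X \<rightarrow>\<^sub>E (UNIV :: real set)\<close> is the parameter space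
  \<open>N\<close>-dimensional real space.\<close>

definition holds_generically :: "'x set \<Rightarrow> (('x \<Rightarrow> real) \<Rightarrow> bool) \<Rightarrow> bool" where
  "holds_generically X P \<longleftrightarrow>
     (\<exists>f :: 'x mpoly. f \<noteq> 0 \<and> indeterminates f \<subseteq> X \<and>
        {a \<in> X \<rightarrow>\<^sub>E UNIV. \<not> P a} \<subseteq> {a. eval_mpoly f a = 0})"

definition structurally_controllable :: "real poly mat \<Rightarrow> bool" where
  "structurally_controllable M \<longleftrightarrow>
     holds_generically (parameters M) (\<lambda>a. controllable (structured_mat M a))"


section \<open>The machine model\<close>

text \<open>
  A random access machine with a uniform cost measure. A state assigns to each name an array of
  natural numbers that is indexed by all natural numbers; an array used only at index \<open>0\<close> serves
  as a scalar variable. A program mentions only finitely many names. There is no multiplication,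
  since unit-cost multiplication of unbounded numbers would make the measure unrealistic.
\<close>

type_synonym name = string
type_synonym state = "name \<Rightarrow> nat \<Rightarrow> nat"

datatype aexp =
    Const nat
  | Read name aexp
  | Plus aexp aexp
  | Minus aexp aexp

datatype bexp =
    Less aexp aexp
  | Not bexp
  | And bexp bexp

datatype com =
    Skip
  | Write name aexp aexp
  | Seq com com
  | If bexp com com
  | While bexp com

fun aval :: "aexp \<Rightarrow> state \<Rightarrow> nat" where
  "aval (Const n) s = n"
| "aval (Read x e) s = s x (aval e s)"
| "aval (Plus e1 e2) s = aval e1 s + aval e2 s"
| "aval (Minus e1 e2) s = aval e1 s - aval e2 s"

fun acost :: "aexp \<Rightarrow> nat" where
  "acost (Const n) = 1"
| "acost (Read x e) = 1 + acost e"
| "acost (Plus e1 e2) = 1 + acost e1 + acost e2"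
| "acost (Minus e1 e2) = 1 + acost e1 + acost e2"

fun bval :: "bexp \<Rightarrow> state \<Rightarrow> bool" where
  "bval (Less e1 e2) s \<longleftrightarrow> aval e1 s < aval e2 s"
| "bval (Not b) s \<longleftrightarrow> \<not> bval b s"
| "bval (And b1 b2) s \<longleftrightarrow> bval b1 s \<and> bval b2 s"

fun bcost :: "bexp \<Rightarrow> nat" where
  "bcost (Less e1 e2) = 1 + acost e1 + acost e2"
| "bcost (Not b) = 1 + bcost b"
| "bcost (And b1 b2) = 1 + bcost b1 + bcost b2"

text \<open>\<open>exec c s t s'\<close>: started in \<open>s\<close>, the program \<open>c\<close> halts in \<open>s'\<close> after \<open>t\<close> elementary
  operations.\<close>

inductive exec :: "com \<Rightarrow> state \<Rightarrow> nat \<Rightarrow> state \<Rightarrow> bool" where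
  Skip: "exec Skip s 1 s"
| Write: "exec (Write x e1 e2) s (1 + acost e1 + acost e2)
    (s(x := (s x)(aval e1 s := aval e2 s)))"
| Seq: "exec c1 s t1 s' \<Longrightarrow> exec c2 s' t2 s'' \<Longrightarrow> exec (Seq c1 c2) s (t1 + t2) s''"
| IfTrue: "bval b s \<Longrightarrow> exec c1 s t s' \<Longrightarrow> exec (If b c1 c2) s (1 + bcost b + t) s'"
| IfFalse: "\<not> bval b s \<Longrightarrow> exec c2 s t s' \<Longrightarrow> exec (If b c1 c2) s (1 + bcost b + t) s'"
| WhileFalse: "\<not> bval b s \<Longrightarrow> exec (While b c) s (1 + bcost b) s"
| WhileTrue: "bval b s \<Longrightarrow> exec c s t1 s' \<Longrightarrow> exec (While b c) s' t2 s'' \<Longrightarrow>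
    exec (While b c) s (1 + bcost b + t1 + t2) s''"


section \<open>The weighted bipartite graph as input\<close>

text \<open>An edge \<open>(i, j, d)\<close> joins row \<open>i\<close> and column \<open>j\<close> and has weight \<open>d\<close>. The edges may be
  listed in any order.\<close>

definition edge_list_of :: "real poly mat \<Rightarrow> (nat \<times> nat \<times> nat) list \<Rightarrow> bool" where
  "edge_list_of M es \<longleftrightarrow> distinct es \<and>
     set es = (\<lambda>(i, j). (i, j, degree (M $$ (i, j)))) ` nonzero_positions M"

definition scalar :: "nat \<Rightarrow> nat \<Rightarrow> nat" where
  "scalar n = (\<lambda>_. 0)(0 := n)"

definition array :: "nat list \<Rightarrow> nat \<Rightarrow> nat" where
  "array xs = (\<lambda>k. if k < length xs then xs ! k else 0)"

text \<open>All memory outside the input is initially \<open>0\<close>.\<close>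

definition input_state :: "nat \<Rightarrow> nat \<Rightarrow> (nat \<times> nat \<times> nat) list \<Rightarrow> state" where
  "input_state p v es = (\<lambda>_ _. 0)
     (''rows'' := scalar p,
      ''columns'' := scalar v,
      ''edges'' := scalar (length es),
      ''row'' := array (map (\<lambda>(i, j, d). i) es),
      ''column'' := array (map (\<lambda>(i, j, d). j) es),
      ''weight'' := array (map (\<lambda>(i, j, d). d) es))"

end

theory Submission
  imports
    Defs
    "Subresultants.Subresultant_Gcd"
    "HOL-Computational_Algebra.Fundamental_Theorem_Algebra"
    "HOL-Computational_Algebra.Field_as_Ring"
begin

text \<open>
  Let \<open>G\<close> be the bipartite graph of the nonzero entries and \<open>k\<close> the size of a maximum matching. Generically
  the rank is \<open>k\<close>, so controllability fails exactly at common zeros \<open>z\<close> of all \<open>k\<close>-minors.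

  An entry of positive degree is harmless if some maximum matching misses its row or its column, or if it
  lies in no maximum matching. If all of them are harmless, then \<open>k\<close>-minors without a common zero exist:
  regard the entries of positive degree as free variables and specialise them one at a time. Some nonzero
  minor does not involve the entry at hand, so only finitely many \<open>z\<close> are critical, and at each of them
  almost every value of the constant coefficient of the entry avoids a common zero. A resultant then turns
  this single controllable parameter value, at which a leading coefficient does not vanish, into a
  polynomial condition. If an entry of positive degree is not harmless, then a square block with a
  determinant that generically depends on \<open>s\<close> can be split off, and at a zero of this determinant the
  rank is smaller than \<open>k\<close>.

  The program computes a maximum matching by augmenting paths, each found by one breadth-first search in
  linear time. The last search marks the rows missed by some maximum matching. For every
  remaining entry \<open>(i, j)\<close> of positive degree, a search from the mate of column \<open>j\<close> finds out whether a free
  column or the row \<open>i\<close> can be reached. This takes \<open>O(E)\<close> searches, hence \<open>O(E\<^sup>2)\<close> steps.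
\<close>

section \<open>Minors and rank\<close>

text \<open>Genericity asks for one nonzero polynomial in the real parameters, whereas the absence
  of a common complex zero of many minors is not visibly a polynomial condition. The specialisation
  argument therefore only has to produce a single good real parameter point. To spread it, the
  minors are condensed into two polynomials in \<open>s\<close>: the minor of one maximum matching
  and a weighted sum of all minors, with weights that leave the two without a common zero at this
  point. Their resultant is polynomial in the parameters once both degrees are fixed. On the
  combinatorial side no theorem about maximum matchings is invoked: a failed search yields a vertex
  cover as large as the matching. This cover bounds the rank, and since it meets every edge of a
  maximum matching exactly once, it also excludes entries from all maximum matchings. The running
  time depends on \<open>E\<close> alone because no loop runs over all rows or columns, and because
  a growing stamp replaces the clearing of the array of visited rows.\<close>

definition rk :: "nat \<Rightarrow> nat \<Rightarrow> (nat \<Rightarrow> nat \<Rightarrow> 'a::field) \<Rightarrow> nat" where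
  "rk p v N = vec_space.rank p (mat p v (\<lambda>(i, j). N i j))"

text \<open>The index maps \<open>r\<close> and \<open>c\<close> need not be increasing or
  injective: repetitions give the value 0, so nothing has to be sorted and any enumeration of a
  matching can be plugged in.\<close>

definition minor :: "nat \<Rightarrow> (nat \<Rightarrow> nat) \<Rightarrow> (nat \<Rightarrow> nat) \<Rightarrow> (nat \<Rightarrow> nat \<Rightarrow> 'a::comm_ring_1) \<Rightarrow> 'a" where
  "minor k r c N = det (mat k k (\<lambda>(x, y). N (r x) (c y)))"

lemma minor_eq_sum:
  "minor k r c N = (\<Sum>\<pi> | \<pi> permutes {0..<k}. signof \<pi> * (\<Prod>x = 0..<k. N (r x) (c (\<pi> x))))"
proof -
  have "(\<Prod>x = 0..<k. mat k k (\<lambda>(x, y). N (r x) (c y)) $$ (x, \<pi> x)) = (\<Prod>x = 0..<k. N (r x) (c (\<pi> x)))"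
    if "\<pi> permutes {0..<k}" for \<pi>
    using permutes_in_image[OF that] by (intro prod.cong) auto
  then show ?thesis
    unfolding minor_def det_def by simp
qed

section \<open>Upper and lower bounds for the rank\<close>

lemma rk_add: "rk p v (\<lambda>i j. N i j + N' i j) \<le> rk p v N + rk p v N'"
proof -
  have "mat p v (\<lambda>(i, j). N i j + N' i j) = mat p v (\<lambda>(i, j). N i j) + mat p v (\<lambda>(i, j). N' i j)"
    by (rule eq_matI) auto
  then show ?thesis
    unfolding rk_def
    using vec_space.rank_subadditive[of "mat p v (\<lambda>(i, j). N i j)" p v "mat p v (\<lambda>(i, j). N' i j)"]
    by simp
qed

lemma rk_cong:
  assumes "\<And>i j. i < p \<Longrightarrow> j < v \<Longrightarrow> N i j = N' i j"
  shows "rk p v N = rk p v N'"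
proof -
  have "mat p v (\<lambda>(i, j). N i j) = mat p v (\<lambda>(i, j). N' i j)"
    using assms by (intro eq_matI) auto
  then show ?thesis by (simp add: rk_def)
qed

lemma rk_zero: "rk p v (\<lambda>i j. 0 :: 'a::field) = 0"
proof -
  have "mat p v (\<lambda>(i, j). 0) = (0\<^sub>m p v :: 'a mat)" by (intro eq_matI) auto
  then show ?thesis by (simp add: rk_def vec_space.rank_0I)
qed

lemma rk_sum_outer_le:
  assumes "finite T"
  shows "rk p v (\<lambda>i j. \<Sum>t\<in>T. F t i * G t j) \<le> card T"
  using assms
proof induction
  case empty
  then show ?case by (simp add: rk_zero)
next
  case (insert t T)
  have "rk p v (\<lambda>i j. F t i * G t j) \<le> 1"
    unfolding rk_def
    by (rule vec_space.rank_le_1_product_entries[of _ _ _ "F t" "G t"]) auto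
  then show ?case
    using insert rk_add[of p v "\<lambda>i j. F t i * G t j" "\<lambda>i j. \<Sum>t\<in>T. F t i * G t j"] by simp
qed

text \<open>A vector annihilated by the selected columns is annihilated by the square submatrix too.
  A nonzero determinant hence makes the selected columns independent, and also distinct, since equal
  columns would reappear inside the submatrix.\<close>

lemma rk_ge_minor:
  assumes r: "\<And>x. x < k \<Longrightarrow> r x < p" and c: "\<And>x. x < k \<Longrightarrow> c x < v"
    and nz: "minor k r c N \<noteq> 0"
  shows "k \<le> rk p v N"
proof -
  interpret vec_space "TYPE('a)" p .
  define B where "B = mat p k (\<lambda>(i, x). N i (c x))"
  define A where "A = mat k k (\<lambda>(x, y). N (r x) (c y))"
  have B: "B \<in> carrier_mat p k" and A: "A \<in> carrier_mat k k" by (auto simp: A_def B_def)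
  have detA: "det A \<noteq> 0" using nz by (simp add: A_def minor_def)
  have row: "A $$ (x, y) = B $$ (r x, y)" if "x < k" "y < k" for x y
    using that r by (simp add: A_def B_def)
  have dist: "distinct (cols B)"
  proof -
    have "col B y \<noteq> col B y'" if "y < k" "y' < k" "y \<noteq> y'" for y y'
    proof
      assume eq: "col B y = col B y'"
      have "col A y = col A y'"
      proof (rule eq_vecI)
        fix x assume "x < dim_vec (col A y')"
        then have x: "x < k" using A by simp
        then have "col B y $ r x = col B y' $ r x" using eq by simp
        then show "col A y $ x = col A y' $ x"
          using x that r A B by (simp add: row)
      qed (use A in simp)
      then show False using det_identical_cols[OF A that(3,1,2)] detA by simp
    qed
    then show ?thesis
      using B by (auto simp: distinct_conv_nth)
  qed
  have "lin_indpt (set (cols B))"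
  proof
    assume "lin_dep (set (cols B))"
    then obtain w where w: "w \<in> carrier_vec k" "w \<noteq> 0\<^sub>v k" "B *\<^sub>v w = 0\<^sub>v p"
      using lin_depE[OF B _ dist] by metis
    have "A *\<^sub>v w = 0\<^sub>v k"
    proof (rule eq_vecI)
      fix x assume "x < dim_vec (0\<^sub>v k :: 'a vec)"
      then have x: "x < k" by simp
      have "row A x = row B (r x)"
        using x r A B by (intro eq_vecI) (auto simp: row)
      then have "(A *\<^sub>v w) $ x = (B *\<^sub>v w) $ r x"
        using x r A B by simp
      then show "(A *\<^sub>v w) $ x = 0\<^sub>v k $ x" using w x r by simp
    qed (use A in simp)
    then show False using det_0_iff_vec_prod_zero_field[OF A] w detA by blast
  qed
  moreover have "set (cols B) \<subseteq> set (cols (mat p v (\<lambda>(i, j). N i j)))"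
  proof
    fix u assume "u \<in> set (cols B)"
    then obtain x where x: "x < k" "u = col B x"
      using B by (auto simp: cols_def)
    then have "u = col (mat p v (\<lambda>(i, j). N i j)) (c x)"
      using c by (intro eq_vecI) (auto simp: B_def)
    then show "u \<in> set (cols (mat p v (\<lambda>(i, j). N i j)))"
      using x c by (auto simp: cols_def)
  qed
  moreover have "card (set (cols B)) = k"
    using dist B by (simp add: distinct_card)
  ultimately show ?thesis
    unfolding rk_def using rank_ge_card_indpt[of "mat p v (\<lambda>(i, j). N i j)" v "set (cols B)"] by simp
qed

text \<open>Each row in \<open>R\<close> and each column in \<open>C\<close> contributes one outer
  product, and a cover leaves nothing over. An entry lying in both is assigned to its row.\<close>

lemma rk_le_cover:
  assumes "finite R" "finite C"
    and cov: "\<And>i j. i < p \<Longrightarrow> j < v \<Longrightarrow> N i j \<noteq> 0 \<Longrightarrow> i \<in> R \<or> j \<in> C"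
  shows "rk p v N \<le> card R + card C"
proof -
  let ?N1 = "\<lambda>i j. \<Sum>t\<in>R. (if i = t then 1 else 0) * N t j"
  let ?N2 = "\<lambda>i j. \<Sum>t\<in>C. (if i \<in> R then 0 else N i t) * (if j = t then 1 else 0)"
  have "N i j = ?N1 i j + ?N2 i j" if "i < p" "j < v" for i j
  proof -
    have 1: "?N1 i j = (if i \<in> R then N i j else 0)"
      using assms(1) by (simp add: if_distrib[of "\<lambda>x. x * _"] sum.delta' cong: if_cong)
    have 2: "?N2 i j = (if j \<in> C then (if i \<in> R then 0 else N i j) else 0)"
      using assms(2) by (simp add: if_distrib[of "\<lambda>x. _ * x"] sum.delta' cong: if_cong)
    show ?thesis using cov[OF that] unfolding 1 2 by auto
  qed
  then have "rk p v N = rk p v (\<lambda>i j. ?N1 i j + ?N2 i j)" by (intro rk_cong)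
  also have "\<dots> \<le> rk p v ?N1 + rk p v ?N2" by (rule rk_add)
  also have "\<dots> \<le> card R + card C"
    using assms(1,2) by (intro add_mono rk_sum_outer_le)
  finally show ?thesis .
qed

text \<open>One row of a singular block is a combination of the others, so the block is a sum of
  \<open>k - 1\<close> outer products. Once these are subtracted, the rest is covered by
  \<open>R\<close> and \<open>C\<close>.\<close>

lemma rk_less_singular_block:
  assumes "finite R" "finite C"
    and cov: "\<And>i j. i < p \<Longrightarrow> j < v \<Longrightarrow> N i j \<noteq> 0 \<Longrightarrow> i \<in> R \<or> j \<in> C \<or> (i \<in> r ` {..<k} \<and> j \<in> c ` {..<k})"
    and r: "inj_on r {..<k}"
    and sing: "minor k r c N = 0"
  shows "rk p v N < card R + card C + k"
proof -
  \<comment> \<open>The transposed block: its kernel vectors are linear dependencies between the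
    rows of the block.\<close>
  define A where "A = mat k k (\<lambda>(y, x). N (r x) (c y))"
  have A: "A \<in> carrier_mat k k" by (simp add: A_def)
  have "A = transpose_mat (mat k k (\<lambda>(x, y). N (r x) (c y)))"
    unfolding A_def by (intro eq_matI) auto
  then have "det A = 0"
    using sing det_transpose[of "mat k k (\<lambda>(x, y). N (r x) (c y))" k] by (simp add: minor_def)
  then obtain w where w: "w \<in> carrier_vec k" "w \<noteq> 0\<^sub>v k" "A *\<^sub>v w = 0\<^sub>v k"
    using det_0_iff_vec_prod_zero_field[OF A] by blast
  then obtain z where z: "z < k" "w $ z \<noteq> 0"
    by (metis carrier_vecD eq_vecI index_zero_vec(1,2))
  have dep: "(\<Sum>x<k. w $ x * N (r x) (c y)) = 0" if "y < k" for y
  proof -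
    have "(A *\<^sub>v w) $ y = (\<Sum>x<k. N (r x) (c y) * w $ x)"
      using that w(1) by (simp add: A_def scalar_prod_def lessThan_atLeast0)
    then show ?thesis using w(3) that by (simp add: mult.commute)
  qed
  define Z where "Z = {..<k} - {z}"
  have Zk: "card Z = k - 1" "finite Z" using z by (auto simp: Z_def)
  \<comment> \<open>Coordinates of block row \<open>i\<close> with respect to the rows
    \<open>r x\<close>, \<open>x \<noteq> z\<close>: a unit vector, except for row
    \<open>r z\<close>, which is solved from the dependency \<open>w\<close>. The factor
    \<open>\<psi>\<close> is row \<open>r x\<close> cut down to the block columns outside
    \<open>C\<close>.\<close>
  define \<phi> where "\<phi> x i = (if i = r z then - w $ x / w $ z else if i = r x then 1 else 0)" for x i
  define \<psi> where "\<psi> x j = (if j \<in> C \<or> j \<notin> c ` {..<k} then 0 else N (r x) j)" for x j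
  let ?N1 = "\<lambda>i j. \<Sum>x\<in>Z. (if i \<in> R then 0 else \<phi> x i) * \<psi> x j"
  let ?N2 = "\<lambda>i j. N i j - ?N1 i j"
  have "rk p v ?N2 \<le> card R + card C"
  proof (rule rk_le_cover[OF assms(1,2)])
    fix i j assume ij: "i < p" "j < v" and ne: "?N2 i j \<noteq> 0"
    show "i \<in> R \<or> j \<in> C"
    proof (rule ccontr)
      assume n: "\<not> (i \<in> R \<or> j \<in> C)"
      have "N i j = ?N1 i j"
      proof (cases "i \<in> r ` {..<k} \<and> j \<in> c ` {..<k}")
        case False
        then have N0: "N i j = 0" using cov ij n by blast
        have "\<phi> x i * \<psi> x j = 0" if "x \<in> Z" for x
          using False that z n by (auto simp: \<phi>_def \<psi>_def Z_def)
        then show ?thesis using N0 n by simp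
      next
        case True
        then obtain x y where x: "x < k" "i = r x" and y: "y < k" "j = c y" by auto
        have psi: "\<psi> t j = N (r t) j" for t using True n by (simp add: \<psi>_def)
        show ?thesis
        proof (cases "x = z")
          case True
          have "0 = (\<Sum>t<k. w $ t * N (r t) (c y))" using dep y by simp
          also have "\<dots> = w $ z * N (r z) (c y) + (\<Sum>t\<in>Z. w $ t * N (r t) (c y))"
            using z by (simp add: Z_def sum.remove)
          finally have "N (r z) (c y) = - (\<Sum>t\<in>Z. w $ t * N (r t) (c y)) / w $ z"
            using z by (simp add: field_simps eq_neg_iff_add_eq_0)
          also have "\<dots> = (\<Sum>t\<in>Z. (- w $ t / w $ z) * N (r t) (c y))"
            by (simp add: sum_divide_distrib sum_negf)
          finally show ?thesis using True x y n psi by (simp add: \<phi>_def)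
        next
          case False
          have "\<phi> t i = (if t = x then 1 else 0)" if "t \<in> Z" for t
            using that False x z r by (auto simp: \<phi>_def Z_def inj_on_def)
          then have "?N1 i j = (\<Sum>t\<in>Z. (if t = x then 1 else 0) * N (r t) j)"
            using n psi by simp
          also have "\<dots> = N (r x) j"
            using Zk(2) x False by (simp add: if_distrib[of "\<lambda>x. x * _"] Z_def cong: if_cong)
          finally show ?thesis using x by simp
        qed
      qed
      then show False using ne by simp
    qed
  qed
  moreover have "rk p v ?N1 \<le> card Z"
    using Zk(2) by (rule rk_sum_outer_le)
  moreover have "rk p v (\<lambda>i j. ?N1 i j + ?N2 i j) \<le> rk p v ?N1 + rk p v ?N2"
    by (rule rk_add)
  moreover have "rk p v (\<lambda>i j. ?N1 i j + ?N2 i j) = rk p v N"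
    by (rule rk_cong) simp
  ultimately show ?thesis using Zk z by simp
qed

section \<open>Polynomial functions and genericity\<close>

definition mono_val :: "('x \<Rightarrow>\<^sub>0 nat) \<Rightarrow> ('x \<Rightarrow> real) \<Rightarrow> real" where
  "mono_val m a = (\<Prod>x\<in>Poly_Mapping.keys m. a x ^ Poly_Mapping.lookup m x)"

lemma mono_val_superset:
  assumes "finite X" "Poly_Mapping.keys m \<subseteq> X"
  shows "mono_val m a = (\<Prod>x\<in>X. a x ^ Poly_Mapping.lookup m x)"
  unfolding mono_val_def using assms
  by (intro prod.mono_neutral_left) (auto simp: in_keys_iff)

lemma mono_val_add: "mono_val (m + m') a = mono_val m a * mono_val m' a"
proof -
  let ?X = "Poly_Mapping.keys m \<union> Poly_Mapping.keys m'"
  have "Poly_Mapping.keys (m + m') \<subseteq> ?X" by (rule Poly_Mapping.keys_add)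
  then show ?thesis
    by (simp add: mono_val_superset[of ?X] lookup_add power_add prod.distrib)
qed

lemma eval_mpoly_superset:
  assumes "finite K" "Poly_Mapping.keys f \<subseteq> K"
  shows "eval_mpoly f a = (\<Sum>m\<in>K. Poly_Mapping.lookup f m * mono_val m a)"
  unfolding eval_mpoly_def mono_val_def[symmetric] using assms
  by (intro sum.mono_neutral_left) (auto simp: in_keys_iff)

lemma eval_mpoly_zero [simp]: "eval_mpoly 0 a = 0"
  by (simp add: eval_mpoly_def)

lemma eval_mpoly_add: "eval_mpoly (f + g) a = eval_mpoly f a + eval_mpoly g a"
proof -
  let ?K = "Poly_Mapping.keys f \<union> Poly_Mapping.keys g"
  have "Poly_Mapping.keys (f + g) \<subseteq> ?K" by (rule Poly_Mapping.keys_add)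
  then show ?thesis
    by (simp add: eval_mpoly_superset[of ?K] lookup_add algebra_simps sum.distrib)
qed

lemma eval_mpoly_single: "eval_mpoly (Poly_Mapping.single m c) a = c * mono_val m a"
  by (simp add: eval_mpoly_superset[of "{m}"])

lemma eval_mpoly_sum: "eval_mpoly (\<Sum>i\<in>I. f i) a = (\<Sum>i\<in>I. eval_mpoly (f i) a)"
  by (induction I rule: infinite_finite_induct) (auto simp: eval_mpoly_add)

lemma sum_single_lookup:
  "f = (\<Sum>m\<in>Poly_Mapping.keys f. Poly_Mapping.single m (Poly_Mapping.lookup f m))"
proof (rule poly_mapping_eqI)
  fix k
  have "Poly_Mapping.lookup (\<Sum>m\<in>Poly_Mapping.keys f. Poly_Mapping.single m (Poly_Mapping.lookup f m)) k
      = (\<Sum>m\<in>Poly_Mapping.keys f. if m = k then Poly_Mapping.lookup f k else 0)"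
    by (auto simp: lookup_sum lookup_single when_def intro!: sum.cong)
  then show "Poly_Mapping.lookup f k =
      Poly_Mapping.lookup (\<Sum>m\<in>Poly_Mapping.keys f. Poly_Mapping.single m (Poly_Mapping.lookup f m)) k"
    by (simp add: in_keys_iff)
qed

lemma eval_mpoly_mult: "eval_mpoly (f * g) a = eval_mpoly f a * eval_mpoly g a"
proof -
  let ?s = "\<lambda>f m. Poly_Mapping.single m (Poly_Mapping.lookup f m)"
  have "f * g = (\<Sum>m\<in>Poly_Mapping.keys f. ?s f m) * (\<Sum>m\<in>Poly_Mapping.keys g. ?s g m)"
    using sum_single_lookup[of f] sum_single_lookup[of g] by simp
  also have "\<dots> = (\<Sum>m\<in>Poly_Mapping.keys f. \<Sum>m'\<in>Poly_Mapping.keys g.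
      Poly_Mapping.single (m + m') (Poly_Mapping.lookup f m * Poly_Mapping.lookup g m'))"
    by (simp add: sum_product mult_single)
  finally have "eval_mpoly (f * g) a = (\<Sum>m\<in>Poly_Mapping.keys f. \<Sum>m'\<in>Poly_Mapping.keys g.
      (Poly_Mapping.lookup f m * mono_val m a) * (Poly_Mapping.lookup g m' * mono_val m' a))"
    by (simp add: eval_mpoly_sum eval_mpoly_single mono_val_add algebra_simps)
  also have "\<dots> = eval_mpoly f a * eval_mpoly g a"
    unfolding eval_mpoly_def mono_val_def[symmetric] by (simp add: sum_product)
  finally show ?thesis .
qed

section \<open>Polynomial functions of the parameters\<close>

text \<open>Closure under sums and products makes determinants of parametrised matrices polynomial
  without handling coefficients. The passage to and from \<open>mpoly\<close> is confined to the two
  rules for genericity.\<close>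

inductive polyfun :: "'x set \<Rightarrow> (('x \<Rightarrow> real) \<Rightarrow> real) \<Rightarrow> bool" for X where
  const: "polyfun X (\<lambda>a. c)"
| var: "x \<in> X \<Longrightarrow> polyfun X (\<lambda>a. a x)"
| add: "polyfun X f \<Longrightarrow> polyfun X g \<Longrightarrow> polyfun X (\<lambda>a. f a + g a)"
| mult: "polyfun X f \<Longrightarrow> polyfun X g \<Longrightarrow> polyfun X (\<lambda>a. f a * g a)"

lemma polyfun_sum: "(\<And>i. i \<in> I \<Longrightarrow> polyfun X (f i)) \<Longrightarrow> polyfun X (\<lambda>a. \<Sum>i\<in>I. f i a)"
  by (induction I rule: infinite_finite_induct) (simp_all add: polyfun.const polyfun.add polyfun.mult)

lemma polyfun_prod: "(\<And>i. i \<in> I \<Longrightarrow> polyfun X (f i)) \<Longrightarrow> polyfun X (\<lambda>a. \<Prod>i\<in>I. f i a)"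
  by (induction I rule: infinite_finite_induct) (simp_all add: polyfun.const polyfun.add polyfun.mult)

lemma polyfun_power: "polyfun X f \<Longrightarrow> polyfun X (\<lambda>a. f a ^ n)"
  by (induction n) (simp_all add: polyfun.const polyfun.add polyfun.mult)

lemma polyfun_cong:
  assumes "polyfun X g" "\<And>x. x \<in> X \<Longrightarrow> a x = b x"
  shows "g a = g b"
  using assms by induction auto

text \<open>Restriction to a line reduces questions about zeros to the finiteness of the roots of a
  univariate polynomial. A direction with one nonzero coordinate varies a single parameter; the
  direction \<open>b - a\<close> joins two points.\<close>

lemma polyfun_line:
  assumes "polyfun X g"
  shows "\<exists>p. \<forall>t. g (\<lambda>x. a x + t * c x) = poly p t"
  using assms
proof induction
  case (const c)
  show ?case by (rule exI[of _ "[:c:]"]) simp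
next
  case (var x)
  show ?case by (rule exI[of _ "[:a x, c x:]"]) simp
next
  case (add f g)
  then obtain p q where "\<forall>t. f (\<lambda>x. a x + t * c x) = poly p t" "\<forall>t. g (\<lambda>x. a x + t * c x) = poly q t"
    by blast
  then show ?case by (intro exI[of _ "p + q"]) simp
next
  case (mult f g)
  then obtain p q where "\<forall>t. f (\<lambda>x. a x + t * c x) = poly p t" "\<forall>t. g (\<lambda>x. a x + t * c x) = poly q t"
    by blast
  then show ?case by (intro exI[of _ "p * q"]) simp
qed

text \<open>On the line from \<open>a\<close> (at \<open>t = 0\<close>) to \<open>b\<close> (at
  \<open>t = 1\<close>) each function is a nonzero univariate polynomial, so all but finitely many
  points of the line work.\<close>

lemma polyfun_nonzero_mult:
  assumes g: "polyfun X g" "g a \<noteq> 0" and h: "polyfun X h" "h b \<noteq> 0"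
  shows "\<exists>c. g c \<noteq> 0 \<and> h c \<noteq> 0"
proof -
  let ?l = "\<lambda>t x. a x + t * (b x - a x)"
  obtain p q where p: "\<And>t. g (?l t) = poly p t" and q: "\<And>t. h (?l t) = poly q t"
    using polyfun_line[OF g(1), of a "\<lambda>x. b x - a x"] polyfun_line[OF h(1), of a "\<lambda>x. b x - a x"] by blast
  have "p \<noteq> 0" using p[of 0] g(2) by auto
  moreover have "q \<noteq> 0" using q[of 1] h(2) by auto
  ultimately have "finite {t. poly (p * q) t = 0}" by (intro poly_roots_finite) simp
  then obtain t where "poly (p * q) t \<noteq> 0"
    using infinite_UNIV_char_0 ex_new_if_finite[of "{t. poly (p * q) t = 0}"] by blast
  then show ?thesis using p q by (intro exI[of _ "?l t"]) auto
qed

lemma polyfun_upd_finite: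
  assumes g: "polyfun X g" "g a \<noteq> 0"
  shows "finite {t. g (a(x := t)) = 0}"
proof -
  let ?c = "\<lambda>y. if y = x then 1 else 0"
  obtain p where p: "\<And>t. g (\<lambda>y. (a(x := 0)) y + t * ?c y) = poly p t"
    using polyfun_line[OF g(1), of "a(x := 0)" ?c] by blast
  have "(\<lambda>y. (a(x := 0)) y + t * ?c y) = a(x := t)" for t by auto
  then have p': "g (a(x := t)) = poly p t" for t using p by metis
  then have "p \<noteq> 0" using g(2) p'[of "a x"] by auto
  then show ?thesis using poly_roots_finite p' by auto
qed

lemma indeterminates_add: "indeterminates (f + g) \<subseteq> indeterminates f \<union> indeterminates g"
  using Poly_Mapping.keys_add[of f g] by (fastforce simp: indeterminates_def)

lemma indeterminates_mult: "indeterminates (f * g) \<subseteq> indeterminates f \<union> indeterminates g"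
proof
  fix x assume "x \<in> indeterminates (f * g)"
  then obtain m where m: "m \<in> Poly_Mapping.keys (f * g)" "x \<in> Poly_Mapping.keys m"
    by (auto simp: indeterminates_def)
  then obtain a b where "m = a + b" "a \<in> Poly_Mapping.keys f" "b \<in> Poly_Mapping.keys g"
    using keys_mult[of f g] by auto
  then show "x \<in> indeterminates f \<union> indeterminates g"
    using m(2) Poly_Mapping.keys_add[of a b] by (auto simp: indeterminates_def)
qed

lemma polyfun_imp_mpoly:
  assumes "polyfun X g"
  shows "\<exists>f :: 'x mpoly. indeterminates f \<subseteq> X \<and> (\<forall>a. eval_mpoly f a = g a)"
  using assms
proof induction
  case (const c)
  show ?case
    by (rule exI[of _ "Poly_Mapping.single 0 c"])
      (auto simp: eval_mpoly_single mono_val_def indeterminates_def)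
next
  case (var x)
  have "Poly_Mapping.keys (Poly_Mapping.single (Poly_Mapping.single x (1::nat)) (1::real)) = {Poly_Mapping.single x 1}"
    by simp
  with var show ?case
    by (intro exI[of _ "Poly_Mapping.single (Poly_Mapping.single x 1) 1"])
      (auto simp: eval_mpoly_single mono_val_def indeterminates_def)
next
  case (add f g)
  then obtain F G :: "'x mpoly" where "indeterminates F \<subseteq> X" "\<forall>a. eval_mpoly F a = f a"
    "indeterminates G \<subseteq> X" "\<forall>a. eval_mpoly G a = g a" by blast
  then show ?case
    using indeterminates_add[of F G] by (intro exI[of _ "F + G"]) (auto simp: eval_mpoly_add)
next
  case (mult f g)
  then obtain F G :: "'x mpoly" where "indeterminates F \<subseteq> X" "\<forall>a. eval_mpoly F a = f a"
    "indeterminates G \<subseteq> X" "\<forall>a. eval_mpoly G a = g a" by blast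
  then show ?case
    using indeterminates_mult[of F G] by (intro exI[of _ "F * G"]) (auto simp: eval_mpoly_mult)
qed

lemma polyfun_eval_mpoly:
  assumes "indeterminates f \<subseteq> X"
  shows "polyfun X (eval_mpoly f)"
proof -
  have "polyfun X (\<lambda>a. eval_mpoly f a)"
    unfolding eval_mpoly_def using assms
    by (intro polyfun_sum polyfun.mult polyfun.const polyfun_prod polyfun_power polyfun.var)
      (auto simp: indeterminates_def)
  then show ?thesis by simp
qed

text \<open>Induction over the variables: for an exponent \<open>n\<close> of \<open>x\<close> that
  occurs, the induction hypothesis makes the coefficient of \<open>t ^ n\<close> nonzero, and then
  \<open>x\<close> is set to a non-root. The last assumption, that the monomials in \<open>K\<close>
  differ already on \<open>X\<close>, survives the restriction to a fixed exponent of
  \<open>x\<close>.\<close>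

lemma exists_nonzero_value:
  fixes c :: "('x \<Rightarrow>\<^sub>0 nat) \<Rightarrow> real"
  assumes "finite X" "finite K" "K \<noteq> {}" "\<forall>m\<in>K. c m \<noteq> 0"
    and "\<forall>m\<in>K. \<forall>m'\<in>K. (\<forall>x\<in>X. Poly_Mapping.lookup m x = Poly_Mapping.lookup m' x) \<longrightarrow> m = m'"
  shows "\<exists>a. (\<Sum>m\<in>K. c m * (\<Prod>x\<in>X. a x ^ Poly_Mapping.lookup m x)) \<noteq> 0"
  using assms
proof (induction X arbitrary: K rule: finite_induct)
  case empty
  then obtain m where "m \<in> K" by blast
  with empty have "K = {m}" by auto
  then show ?case using empty by simp
next
  case (insert x X)
  obtain m0 where m0: "m0 \<in> K" using insert.prems by blast
  define n where "n = Poly_Mapping.lookup m0 x"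
  define K' where "K' = {m \<in> K. Poly_Mapping.lookup m x = n}"
  have "\<exists>a. (\<Sum>m\<in>K'. c m * (\<Prod>x\<in>X. a x ^ Poly_Mapping.lookup m x)) \<noteq> 0"
  proof (rule insert.IH)
    show "finite K'" "\<forall>m\<in>K'. c m \<noteq> 0" using insert.prems by (auto simp: K'_def)
    show "K' \<noteq> {}" using m0 by (auto simp: K'_def n_def)
    show "\<forall>m\<in>K'. \<forall>m'\<in>K'. (\<forall>x\<in>X. Poly_Mapping.lookup m x = Poly_Mapping.lookup m' x) \<longrightarrow> m = m'"
      using insert.prems(4) by (auto simp: K'_def)
  qed
  then obtain a where a: "(\<Sum>m\<in>K'. c m * (\<Prod>x\<in>X. a x ^ Poly_Mapping.lookup m x)) \<noteq> 0" by blast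
  define p where "p = (\<Sum>m\<in>K. monom (c m * (\<Prod>x\<in>X. a x ^ Poly_Mapping.lookup m x)) (Poly_Mapping.lookup m x))"
  have "coeff p n = (\<Sum>m\<in>K. if Poly_Mapping.lookup m x = n then c m * (\<Prod>x\<in>X. a x ^ Poly_Mapping.lookup m x) else 0)"
    by (auto simp: p_def coeff_sum intro!: sum.cong)
  also have "\<dots> = (\<Sum>m\<in>K'. c m * (\<Prod>x\<in>X. a x ^ Poly_Mapping.lookup m x))"
    unfolding K'_def using insert.prems(1) by (simp add: sum.inter_filter)
  finally have "p \<noteq> 0" using a by auto
  then have "finite {t. poly p t = 0}" by (rule poly_roots_finite)
  then obtain t where t: "poly p t \<noteq> 0"
    using infinite_UNIV_char_0 ex_new_if_finite[of "{t. poly p t = 0}"] by blast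
  have "(\<Prod>y\<in>insert x X. (a(x := t)) y ^ Poly_Mapping.lookup m y)
      = t ^ Poly_Mapping.lookup m x * (\<Prod>x\<in>X. a x ^ Poly_Mapping.lookup m x)" for m
  proof -
    have "(\<Prod>y\<in>X. (a(x := t)) y ^ Poly_Mapping.lookup m y) = (\<Prod>y\<in>X. a y ^ Poly_Mapping.lookup m y)"
      using insert.hyps by (intro prod.cong) auto
    then show ?thesis using insert.hyps by simp
  qed
  then have "(\<Sum>m\<in>K. c m * (\<Prod>y\<in>insert x X. (a(x := t)) y ^ Poly_Mapping.lookup m y)) = poly p t"
    by (auto simp: p_def poly_sum poly_monom intro!: sum.cong)
  then show ?case using t by metis
qed

lemma eval_mpoly_nonzero:
  assumes "f \<noteq> 0"
  shows "\<exists>a. eval_mpoly f a \<noteq> 0"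
proof -
  let ?X = "indeterminates f"
  have fin: "finite ?X" by (simp add: indeterminates_def)
  have sub: "Poly_Mapping.keys m \<subseteq> ?X" if "m \<in> Poly_Mapping.keys f" for m
    using that by (auto simp: indeterminates_def)
  have "\<exists>a. (\<Sum>m\<in>Poly_Mapping.keys f. Poly_Mapping.lookup f m * (\<Prod>x\<in>?X. a x ^ Poly_Mapping.lookup m x)) \<noteq> 0"
  proof (rule exists_nonzero_value[OF fin])
    show "\<forall>m\<in>Poly_Mapping.keys f. \<forall>m'\<in>Poly_Mapping.keys f.
        (\<forall>x\<in>?X. Poly_Mapping.lookup m x = Poly_Mapping.lookup m' x) \<longrightarrow> m = m'"
    proof (intro ballI impI poly_mapping_eqI)
      fix m m' x
      assume *: "m \<in> Poly_Mapping.keys f" "m' \<in> Poly_Mapping.keys f"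
        "\<forall>x\<in>?X. Poly_Mapping.lookup m x = Poly_Mapping.lookup m' x"
      show "Poly_Mapping.lookup m x = Poly_Mapping.lookup m' x"
      proof (cases "x \<in> ?X")
        case False
        then have "x \<notin> Poly_Mapping.keys m" "x \<notin> Poly_Mapping.keys m'" using sub * by auto
        then show ?thesis by (simp add: in_keys_iff)
      qed (use * in simp)
    qed
  qed (use assms in \<open>auto simp: in_keys_iff\<close>)
  then obtain a where a: "(\<Sum>m\<in>Poly_Mapping.keys f. Poly_Mapping.lookup f m * (\<Prod>x\<in>?X. a x ^ Poly_Mapping.lookup m x)) \<noteq> 0"
    by blast
  have "eval_mpoly f a = (\<Sum>m\<in>Poly_Mapping.keys f. Poly_Mapping.lookup f m * (\<Prod>x\<in>?X. a x ^ Poly_Mapping.lookup m x))"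
    unfolding eval_mpoly_def mono_val_def[symmetric]
    by (intro sum.cong) (auto simp: mono_val_superset[OF fin sub])
  then show ?thesis using a by metis
qed

lemma holds_genericallyI:
  assumes "polyfun X g" "g a0 \<noteq> 0" "\<And>a. a \<in> X \<rightarrow>\<^sub>E UNIV \<Longrightarrow> g a \<noteq> 0 \<Longrightarrow> P a"
  shows "holds_generically X P"
proof -
  obtain f where f: "indeterminates f \<subseteq> X" "\<And>a. eval_mpoly f a = g a"
    using polyfun_imp_mpoly[OF assms(1)] by blast
  have "f \<noteq> 0" using f(2)[of a0] assms(2) by auto
  moreover have "{a \<in> X \<rightarrow>\<^sub>E UNIV. \<not> P a} \<subseteq> {a. eval_mpoly f a = 0}"
    using assms(3) unfolding f(2) by blast
  ultimately show ?thesis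
    unfolding holds_generically_def using f(1) by (intro exI[of _ f]) simp
qed

text \<open>A further nonzero polynomial condition \<open>g\<close> can be imposed on a generic
  property, since both polynomials are nonzero at a common point. Restricting this point to
  \<open>X\<close> moves it into the parameter space without changing either value.\<close>

lemma holds_genericallyD:
  assumes "holds_generically X P" "polyfun X g" "g a0 \<noteq> 0"
  shows "\<exists>a \<in> X \<rightarrow>\<^sub>E UNIV. g a \<noteq> 0 \<and> P a"
proof -
  obtain f where f: "f \<noteq> 0" "indeterminates f \<subseteq> X"
    "{a \<in> X \<rightarrow>\<^sub>E UNIV. \<not> P a} \<subseteq> {a. eval_mpoly f a = 0}"
    using assms(1) by (auto simp: holds_generically_def)
  obtain b where "eval_mpoly f b \<noteq> 0" using eval_mpoly_nonzero[OF f(1)] by blast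
  then obtain c where c: "eval_mpoly f c \<noteq> 0" "g c \<noteq> 0"
    using polyfun_nonzero_mult[OF polyfun_eval_mpoly[OF f(2)] _ assms(2,3)] by blast
  let ?a = "restrict c X"
  have "eval_mpoly f ?a \<noteq> 0" "g ?a \<noteq> 0"
    using c polyfun_cong[OF polyfun_eval_mpoly[OF f(2)], of ?a c] polyfun_cong[OF assms(2), of ?a c] by auto
  moreover have "?a \<in> X \<rightarrow>\<^sub>E UNIV" by simp
  ultimately show ?thesis using f(3) by blast
qed

section \<open>Polynomials in \<open>s\<close> that depend polynomially on the parameters\<close>

text \<open>The degree bound is uniform in the parameters, so that a largest degree exists and a
  Sylvester matrix of one size serves all parameter values.\<close>

definition cpolyfun :: "'x set \<Rightarrow> (('x \<Rightarrow> real) \<Rightarrow> real poly) \<Rightarrow> bool" where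
  "cpolyfun X h \<longleftrightarrow> (\<forall>n. polyfun X (\<lambda>a. coeff (h a) n)) \<and> (\<exists>B. \<forall>a. degree (h a) \<le> B)"

lemma cpolyfun_const: "cpolyfun X (\<lambda>a. q)"
  unfolding cpolyfun_def by (blast intro: polyfun.const)

lemma cpolyfun_add:
  assumes "cpolyfun X g" "cpolyfun X h"
  shows "cpolyfun X (\<lambda>a. g a + h a)"
proof -
  obtain B B' where B: "\<And>a. degree (g a) \<le> B" "\<And>a. degree (h a) \<le> B'"
    using assms by (auto simp: cpolyfun_def)
  have "degree (g a + h a) \<le> max B B'" for a
    using B by (intro order.trans[OF degree_add_le_max] max.mono)
  moreover have "polyfun X (\<lambda>a. coeff (g a + h a) n)" for n
    unfolding coeff_add using assms
    by (intro polyfun.add) (simp_all add: cpolyfun_def)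
  ultimately show ?thesis
    unfolding cpolyfun_def by blast
qed

lemma cpolyfun_mult:
  assumes "cpolyfun X g" "cpolyfun X h"
  shows "cpolyfun X (\<lambda>a. g a * h a)"
proof -
  obtain B B' where B: "\<And>a. degree (g a) \<le> B" "\<And>a. degree (h a) \<le> B'"
    using assms by (auto simp: cpolyfun_def)
  have "degree (g a * h a) \<le> B + B'" for a
    using B by (intro order.trans[OF degree_mult_le] add_mono)
  moreover have "polyfun X (\<lambda>a. coeff (g a * h a) n)" for n
    unfolding coeff_mult using assms
    by (intro polyfun_sum polyfun.mult) (simp_all add: cpolyfun_def)
  ultimately show ?thesis
    unfolding cpolyfun_def by blast
qed

lemma cpolyfun_sum: "(\<And>i. i \<in> I \<Longrightarrow> cpolyfun X (f i)) \<Longrightarrow> cpolyfun X (\<lambda>a. \<Sum>i\<in>I. f i a)"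
  by (induction I rule: infinite_finite_induct) (simp_all add: cpolyfun_const cpolyfun_add)

lemma cpolyfun_prod: "(\<And>i. i \<in> I \<Longrightarrow> cpolyfun X (f i)) \<Longrightarrow> cpolyfun X (\<lambda>a. \<Prod>i\<in>I. f i a)"
  by (induction I rule: infinite_finite_induct) (simp_all add: cpolyfun_const cpolyfun_mult)

section \<open>Matchings in bipartite graphs\<close>

definition matching :: "('a \<times> 'b) set \<Rightarrow> ('a \<times> 'b) set \<Rightarrow> bool" where
  "matching G m \<longleftrightarrow> finite m \<and> m \<subseteq> G \<and> inj_on fst m \<and> inj_on snd m"

text \<open>Two consecutive edges of an alternating path are contracted into one step, so that
  reachability concerns rows alone.\<close>

definition alt_step :: "('a \<times> 'b) set \<Rightarrow> ('a \<times> 'b) set \<Rightarrow> ('a \<times> 'a) set" where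
  "alt_step G m = {(i, i'). \<exists>j. (i, j) \<in> G \<and> (i', j) \<in> m}"

lemma matching_subset: "matching G m \<Longrightarrow> m' \<subseteq> m \<Longrightarrow> matching G m'"
  by (auto simp: matching_def intro: finite_subset inj_on_subset)

lemma matching_insert:
  assumes "matching G m" "(i, j) \<in> G" "i \<notin> fst ` m" "j \<notin> snd ` m"
  shows "matching G (insert (i, j) m)"
  using assms by (auto simp: matching_def)

lemma card_fst_matching: "matching G m \<Longrightarrow> card (fst ` m) = card m"
  by (simp add: matching_def card_image)

lemma card_snd_matching: "matching G m \<Longrightarrow> card (snd ` m) = card m"
  by (simp add: matching_def card_image)

lemma fst_matching_remove: "matching G m \<Longrightarrow> (i, j) \<in> m \<Longrightarrow> fst ` (m - {(i, j)}) = fst ` m - {i}"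
  using inj_on_image_set_diff[of fst m m "{(i, j)}"] by (auto simp: matching_def)

lemma snd_matching_remove: "matching G m \<Longrightarrow> (i, j) \<in> m \<Longrightarrow> snd ` (m - {(i, j)}) = snd ` m - {j}"
  using inj_on_image_set_diff[of snd m m "{(i, j)}"] by (auto simp: matching_def)

lemma in_fst_image: "(i, j) \<in> m \<Longrightarrow> i \<in> fst ` m"
  using imageI[of "(i, j)" m fst] by simp

lemma in_snd_image: "(i, j) \<in> m \<Longrightarrow> j \<in> snd ` m"
  using imageI[of "(i, j)" m snd] by simp

text \<open>A path may be cut off before its last visit to \<open>x\<close>. This is needed when the
  matching edge at the starting row is deleted, because all steps into that row disappear with
  it.\<close>

lemma rtrancl_avoid_start:
  assumes "(x, y) \<in> r\<^sup>*"
  shows "(x, y) \<in> {(u, w) \<in> r. w \<noteq> x}\<^sup>*"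
  using assms
proof (induction rule: rtrancl_induct)
  case (step y z)
  then show ?case by (cases "z = x") (auto intro: rtrancl.rtrancl_into_rtrancl)
qed simp

text \<open>Flipping a matching along an alternating path that starts in the uncovered row \<open>i0\<close>. The set
  \<open>W\<close> of rows that the rest of the path may visit shrinks with every step; this replaces a
  simplicity assumption on the path.\<close>

lemma shift_matching:
  assumes "finite W" "matching G m" "i0 \<notin> fst ` m" "i0 \<notin> W"
    and "(i0, i) \<in> {(u, w) \<in> alt_step G m. w \<in> W}\<^sup>*"
  shows "\<exists>m'. matching G m' \<and> card m' = card m \<and> fst ` m' = insert i0 (fst ` m) - {i} \<and> snd ` m' = snd ` m"
  using assms
proof (induction W arbitrary: m i0 rule: finite_psubset_induct)
  case (psubset W)
  let ?r = "{(u, w) \<in> alt_step G m. w \<in> W}"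
  show ?case
  proof (cases "i = i0")
    case True
    then have "fst ` m = insert i0 (fst ` m) - {i}" using psubset.prems(2) by blast
    with psubset.prems(1) show ?thesis by (intro exI[of _ m] conjI refl)
  next
    case False
    obtain i1 where i1: "(i0, i1) \<in> ?r" "(i1, i) \<in> ?r\<^sup>*"
      using psubset.prems(4) by (rule converse_rtranclE) (use False in blast)+
    then obtain j1 where j1: "(i0, j1) \<in> G" "(i1, j1) \<in> m" "i1 \<in> W"
      by (auto simp: alt_step_def)
    have ne: "i1 \<noteq> i0" using j1(3) psubset.prems(3) by blast
    let ?del = "m - {(i1, j1)}"
    let ?new = "insert (i0, j1) ?del"
    have m0: "fst ` ?del = fst ` m - {i1}" "snd ` ?del = snd ` m - {j1}"
      using fst_matching_remove[OF psubset.prems(1) j1(2)] snd_matching_remove[OF psubset.prems(1) j1(2)] by simp_all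
    have m: "matching G ?new"
    proof (rule matching_insert)
      show "matching G ?del" using psubset.prems(1) by (rule matching_subset) blast
      show "i0 \<notin> fst ` ?del" using m0(1) psubset.prems(2) by simp
      show "j1 \<notin> snd ` ?del" using m0(2) by simp
    qed (rule j1)
    have in_m: "i1 \<in> fst ` m" "j1 \<in> snd ` m"
      using j1(2) by (auto intro: in_fst_image in_snd_image)
    have fm: "fst ` ?new = insert i0 (fst ` m - {i1})" and sm: "snd ` ?new = snd ` m"
      unfolding image_insert m0 using in_m(2) by auto
    have "card (snd ` ?new) = card (snd ` m)" using sm by simp
    then have cm: "card ?new = card m"
      using card_snd_matching[OF m] card_snd_matching[OF psubset.prems(1)] by simp
    have "(i1, i) \<in> {(u, w) \<in> ?r. w \<noteq> i1}\<^sup>*"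
      using i1(2) by (rule rtrancl_avoid_start)
    moreover have "{(u, w) \<in> ?r. w \<noteq> i1} \<subseteq> {(u, w) \<in> alt_step G ?new. w \<in> W - {i1}}"
      unfolding alt_step_def by blast
    ultimately have path: "(i1, i) \<in> {(u, w) \<in> alt_step G ?new. w \<in> W - {i1}}\<^sup>*"
      using rtrancl_mono by blast
    have sub: "W - {i1} \<subset> W" using j1(3) by blast
    have n1: "i1 \<notin> fst ` ?new" unfolding fm using ne by blast
    have n2: "i1 \<notin> W - {i1}" by simp
    obtain m' where m': "matching G m'" "card m' = card ?new"
      "fst ` m' = insert i1 (fst ` ?new) - {i}" "snd ` m' = snd ` ?new"
      using psubset.IH[OF sub m n1 n2 path] by (elim exE conjE) (rule that)
    have "insert i1 (fst ` ?new) = insert i0 (fst ` m)"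
      unfolding fm using in_m(1) by blast
    then show ?thesis using m' cm sm by (intro exI[of _ m']) simp
  qed
qed

text \<open>Flipping the path exchanges the uncovered row \<open>i0\<close> for \<open>i\<close>.
  Alternating steps enter matched rows only, which supplies the finite set \<open>W\<close> for the
  flip.\<close>

lemma exists_matching_avoiding:
  assumes "matching G m" "i0 \<notin> fst ` m" "(i0, i) \<in> (alt_step G m)\<^sup>*"
  shows "\<exists>m'. matching G m' \<and> card m' = card m \<and> i \<notin> fst ` m'"
proof -
  have "alt_step G m \<subseteq> {(u, w) \<in> alt_step G m. w \<in> fst ` m}"
    by (auto simp: alt_step_def intro: in_fst_image)
  then have path: "(i0, i) \<in> {(u, w) \<in> alt_step G m. w \<in> fst ` m}\<^sup>*"
    using assms(3) rtrancl_mono by blast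
  have fin: "finite (fst ` m)" using assms(1) by (simp add: matching_def)
  show ?thesis
    using shift_matching[OF fin assms(1,2,2) path] by auto
qed

text \<open>Deleting \<open>(i', j)\<close> uncovers \<open>i'\<close>; flipping the path moves the
  uncovered row to \<open>i\<close>, and \<open>(i, c)\<close> can be added because column
  \<open>c\<close> is unoccupied. With \<open>c = j\<close> this forces \<open>(i, j)\<close> into a
  matching on the same rows; with an uncovered column \<open>c\<close> it releases column
  \<open>j\<close>.\<close>

lemma exists_matching_through:
  assumes m: "matching G m" "(i', j) \<in> m" and path: "(i', i) \<in> (alt_step G m)\<^sup>*"
    and c: "(i, c) \<in> G" "c \<notin> snd ` m - {j}"
  shows "\<exists>m'. matching G m' \<and> (i, c) \<in> m' \<and> card m' = card m \<and> fst ` m' = fst ` m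
      \<and> snd ` m' = insert c (snd ` m - {j})"
proof -
  let ?m = "m - {(i', j)}"
  have fm: "fst ` ?m = fst ` m - {i'}" and sm: "snd ` ?m = snd ` m - {j}"
    using fst_matching_remove[OF m] snd_matching_remove[OF m] by simp_all
  have m1: "matching G ?m" using m(1) by (rule matching_subset) auto
  have "(i', i) \<in> {(u, w) \<in> alt_step G m. w \<noteq> i'}\<^sup>*"
    using path by (rule rtrancl_avoid_start)
  moreover have "{(u, w) \<in> alt_step G m. w \<noteq> i'} \<subseteq> {(u, w) \<in> alt_step G ?m. w \<in> fst ` ?m}"
    by (auto simp: alt_step_def intro: in_fst_image)
  ultimately have path': "(i', i) \<in> {(u, w) \<in> alt_step G ?m. w \<in> fst ` ?m}\<^sup>*"
    using rtrancl_mono by blast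
  have i': "i' \<notin> fst ` ?m" using fm by blast
  have fin: "finite (fst ` ?m)" using m1 by (simp add: matching_def)
  obtain m' where m': "matching G m'" "card m' = card ?m"
    "fst ` m' = insert i' (fst ` ?m) - {i}" "snd ` m' = snd ` ?m"
    using shift_matching[OF fin m1 i' i' path'] by (elim exE conjE) (rule that)
  have f': "fst ` m' = fst ` m - {i}"
    using m'(3) in_fst_image[OF m(2)] unfolding fm by blast
  have "i \<in> fst ` m"
  proof (cases "i = i'")
    case True
    then show ?thesis using in_fst_image[OF m(2)] by simp
  next
    case False
    then obtain u where "(u, i) \<in> alt_step G m" using path by (auto elim: rtranclE)
    then show ?thesis by (auto simp: alt_step_def intro: in_fst_image)
  qed
  then have "fst ` insert (i, c) m' = fst ` m" using f' by auto
  moreover have "snd ` insert (i, c) m' = insert c (snd ` m - {j})" using m'(4) sm by simp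
  moreover have ins: "matching G (insert (i, c) m')"
    using m'(1) c f' m'(4) sm by (intro matching_insert) auto
  moreover have "card (insert (i, c) m') = card m"
    using calculation(1) card_fst_matching[OF ins] card_fst_matching[OF m(1)] by simp
  ultimately show ?thesis by blast
qed

section \<open>Tight covers and the classification of entries\<close>

definition closed_rows :: "('a \<times> 'b) set \<Rightarrow> ('a \<times> 'b) set \<Rightarrow> 'a set \<Rightarrow> bool" where
  "closed_rows G m Z \<longleftrightarrow> (\<forall>i\<in>Z. \<forall>j. (i, j) \<in> G \<longrightarrow> (\<exists>i'\<in>Z. (i', j) \<in> m))"

definition cols_of :: "('a \<times> 'b) set \<Rightarrow> 'a set \<Rightarrow> 'b set" where
  "cols_of m Z = snd ` {e \<in> m. fst e \<in> Z}"

lemma card_cols_of: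
  assumes "matching G m"
  shows "card (cols_of m Z) = card (fst ` m \<inter> Z)"
proof -
  have "matching G {e \<in> m. fst e \<in> Z}" using assms by (rule matching_subset) auto
  then have "card (cols_of m Z) = card (fst ` {e \<in> m. fst e \<in> Z})"
    unfolding cols_of_def by (simp add: card_fst_matching card_snd_matching)
  also have "fst ` {e \<in> m. fst e \<in> Z} = fst ` m \<inter> Z" by auto
  finally show ?thesis .
qed

lemma finite_cols_of: "matching G m \<Longrightarrow> finite (cols_of m Z)"
  by (simp add: cols_of_def matching_def)

lemma closed_rows_cols: "closed_rows G m Z \<Longrightarrow> i \<in> Z \<Longrightarrow> (i, j) \<in> G \<Longrightarrow> j \<in> cols_of m Z"
  by (force simp: closed_rows_def cols_of_def)

definition cover :: "('a \<times> 'b) set \<Rightarrow> 'a set \<Rightarrow> 'b set \<Rightarrow> bool" where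
  "cover G R C \<longleftrightarrow> finite R \<and> finite C \<and> (\<forall>(i, j)\<in>G. i \<in> R \<or> j \<in> C)"

text \<open>The Koenig construction: every matching edge contributes exactly one vertex, its row if
  this lies outside \<open>Z\<close> and its column otherwise. The cover certifies that
  \<open>m\<close> is maximum.\<close>

lemma cover_closed_rows:
  assumes m: "matching G m" and Z: "closed_rows G m Z" and free: "fst ` G - fst ` m \<subseteq> Z"
  shows "cover G (fst ` m - Z) (cols_of m Z)"
    and "card (fst ` m - Z) + card (cols_of m Z) = card m"
proof -
  have fin: "finite (fst ` m)" using m by (simp add: matching_def)
  show "cover G (fst ` m - Z) (cols_of m Z)"
    unfolding cover_def
  proof (intro conjI ballI, goal_cases)
    case (3 e)
    obtain i j where e: "e = (i, j)" "(i, j) \<in> G" using 3 by (cases e) auto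
    then have "i \<in> fst ` m - Z \<or> i \<in> Z" using free in_fst_image[of i j G] by blast
    then show ?case using e closed_rows_cols[OF Z, of i j] by auto
  qed (use fin finite_cols_of[OF m] in auto)
  have "card (fst ` m) = card (fst ` m - Z) + card (fst ` m \<inter> Z)"
    using fin by (metis Int_Diff_Un Int_Diff_disjoint Int_commute add.commute card_Un_disjoint finite_Diff finite_Int)
  then show "card (fst ` m - Z) + card (cols_of m Z) = card m"
    using card_fst_matching[OF m] card_cols_of[OF m] by simp
qed

text \<open>At most \<open>card R\<close> edges of \<open>m\<close> have their row in
  \<open>R\<close>, at most \<open>card C\<close> have their column in \<open>C\<close>, and
  together these edges exhaust \<open>m\<close>. As the sizes add up exactly, no edge is counted
  twice. This applies to every matching as large as the cover, not only to the one that produced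
  it.\<close>

lemma tight_cover_once:
  assumes cov: "cover G R C" "card R + card C = card m" and m: "matching G m" "(i, j) \<in> m"
  shows "\<not> (i \<in> R \<and> j \<in> C)"
proof
  assume ij: "i \<in> R \<and> j \<in> C"
  let ?A = "{e \<in> m. fst e \<in> R}" and ?B = "{e \<in> m. snd e \<in> C}"
  have fin: "finite m" "finite R" "finite C" using assms by (auto simp: matching_def cover_def)
  have "card ?A \<le> card R"
    using m fin by (intro card_inj_on_le[of fst]) (auto simp: matching_def intro: inj_on_subset)
  moreover have "card ?B \<le> card C"
    using m fin by (intro card_inj_on_le[of snd]) (auto simp: matching_def intro: inj_on_subset)
  moreover have "m = ?A \<union> ?B"
    using cov(1) m(1) by (fastforce simp: cover_def matching_def)
  moreover have "card ?A + card ?B = card (?A \<union> ?B) + card (?A \<inter> ?B)"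
    using fin by (intro card_Un_Int) auto
  moreover have "card (?A \<inter> ?B) > 0"
    using ij m(2) fin by (auto simp: card_gt_0_iff)
  ultimately show False using cov(2) by simp
qed

definition harmless :: "('a \<times> 'b) set \<Rightarrow> nat \<Rightarrow> 'a \<times> 'b \<Rightarrow> bool" where
  "harmless G k e \<longleftrightarrow>
     (\<exists>m. matching G m \<and> card m = k \<and> (fst e \<notin> fst ` m \<or> snd e \<notin> snd ` m)) \<or>
     (\<forall>m. matching G m \<longrightarrow> card m = k \<longrightarrow> e \<notin> m)"

text \<open>The obstruction: outside \<open>R\<close> and \<open>C\<close> the graph lies in a
  square block with the perfect matching \<open>m\<close>. By the equation of sizes the rank can
  only reach \<open>k\<close> if the block has full rank, and an entry \<open>e\<close> of positive
  degree on its matching lets the block determinant depend on \<open>s\<close>.\<close>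

definition harmful_block :: "('a \<times> 'b) set \<Rightarrow> nat \<Rightarrow> 'a \<times> 'b \<Rightarrow> bool" where
  "harmful_block G k e \<longleftrightarrow> (\<exists>m R C. matching G m \<and> e \<in> m \<and> finite R \<and> finite C
     \<and> card R + card C + card m = k
     \<and> (\<forall>(i, j)\<in>G. i \<in> R \<or> j \<in> C \<or> (i \<in> fst ` m \<and> j \<in> snd ` m)))"

text \<open>The cover built from \<open>V \<union> A\<close> contains both the row \<open>i\<close>,
  which lies outside this set, and the column \<open>j\<close>, which is matched into
  \<open>A\<close>. An edge covered twice belongs to no matching of the size of
  \<open>m\<close>.\<close>

lemma harmless_separated:
  assumes m: "matching G m" and V: "closed_rows G m V" "fst ` G - fst ` m \<subseteq> V"
    and A: "closed_rows G m A" "(i', j) \<in> m" "i' \<in> A" and i: "(i, j) \<in> G" "i \<notin> A" "i \<notin> V"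
  shows "harmless G (card m) (i, j)"
proof -
  have VA: "closed_rows G m (V \<union> A)" using V(1) A(1) by (fastforce simp: closed_rows_def)
  have "fst ` G - fst ` m \<subseteq> V \<union> A" using V(2) by blast
  note cov = cover_closed_rows[OF m VA this]
  have "i \<in> fst ` m - (V \<union> A)" using V(2) i by force
  moreover have "j \<in> cols_of m (V \<union> A)" using A(2,3) by (force simp: cols_of_def)
  ultimately show ?thesis
    using tight_cover_once[OF cov(1)] cov(2) by (metis harmless_def)
qed

lemma cols_of_Un: "cols_of m (A \<union> B) = cols_of m A \<union> cols_of m B"
  by (auto simp: cols_of_def)

text \<open>The block has the rows \<open>A\<close> and the columns that \<open>m\<close> matches to
  them. Its perfect matching is the part in \<open>A\<close> of a matching \<open>m'\<close> through
  \<open>(i, j)\<close>; the cover built from \<open>V\<close> supplies \<open>C\<close> and,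
  without the rows of \<open>A\<close>, also \<open>R\<close>.\<close>

lemma harmful_blockI:
  assumes m: "matching G m" and V: "closed_rows G m V" "fst ` G - fst ` m \<subseteq> V"
    and A: "closed_rows G m (V \<union> A)" "A \<subseteq> fst ` m" "A \<inter> V = {}" "(i', j) \<in> m" "i \<in> A"
    and path: "(i', i) \<in> (alt_step G m)\<^sup>*" and e: "(i, j) \<in> G"
  shows "harmful_block G (card m) (i, j)"
proof -
  have "j \<notin> snd ` m - {j}" by simp
  then obtain m' where m': "matching G m'" "(i, j) \<in> m'" "card m' = card m" "fst ` m' = fst ` m"
    using exists_matching_through[OF m A(4) path e] by blast
  define \<mu> where "\<mu> = {e \<in> m'. fst e \<in> A}"
  have mu: "matching G \<mu>" using m'(1) by (rule matching_subset) (auto simp: \<mu>_def)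
  have fmu: "fst ` \<mu> = A" using m'(4) A(2) by (force simp: \<mu>_def)
  have fA: "finite A" using fmu mu by (auto simp: matching_def)
  let ?R = "fst ` m - V - A" and ?C = "cols_of m V"
  note cov = cover_closed_rows[OF m V]
  have "b \<in> cols_of m A" if ab: "(a, b) \<in> \<mu>" for a b
  proof -
    have a: "a \<in> A" "(a, b) \<in> m'" "(a, b) \<in> G" using ab mu by (auto simp: \<mu>_def matching_def)
    have "b \<in> cols_of m (V \<union> A)" using closed_rows_cols[OF A(1) _ a(3)] a(1) by simp
    \<comment> \<open>Row \<open>a\<close> already lies in the cover built from \<open>V\<close>,
      and \<open>m'\<close> is as large as this cover, so tightness keeps the column
      \<open>b\<close> out of the cover.\<close>
    moreover have "b \<notin> ?C"
      using tight_cover_once[OF cov(1) _ m'(1) a(2)] cov(2) m'(3) a(1) A(2,3) by auto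
    ultimately show ?thesis by (simp add: cols_of_Un)
  qed
  then have "snd ` \<mu> \<subseteq> cols_of m A" by auto
  moreover have "card (snd ` \<mu>) = card (cols_of m A)"
    using card_snd_matching[OF mu] card_fst_matching[OF mu] fmu card_cols_of[OF m] A(2)
    by (simp add: Int_absorb1)
  ultimately have smu: "snd ` \<mu> = cols_of m A"
    using finite_cols_of[OF m] card_subset_eq by blast
  have fin: "finite (fst ` m)" using m by (simp add: matching_def)
  have "card (fst ` m - V) = card ?R + card A"
  proof -
    have "A \<subseteq> fst ` m - V" using A(2,3) by blast
    then show ?thesis using fA fin by (simp add: card_Diff_subset card_mono)
  qed
  then have "card ?R + card ?C + card \<mu> = card m"
    using cov(2) card_fst_matching[OF mu] fmu by simp
  moreover have "a \<in> ?R \<or> b \<in> ?C \<or> (a \<in> fst ` \<mu> \<and> b \<in> snd ` \<mu>)" if ab: "(a, b) \<in> G" for a b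
  proof (cases "a \<in> A")
    case True
    then have "b \<in> cols_of m (V \<union> A)" using closed_rows_cols[OF A(1) _ ab] by simp
    then show ?thesis using True by (auto simp: fmu smu cols_of_Un)
  next
    case False
    then show ?thesis using cov(1) ab unfolding cover_def by blast
  qed
  moreover have "(i, j) \<in> \<mu>" using m'(2) A(5) by (simp add: \<mu>_def)
  moreover have "finite ?R" "finite ?C" using fin finite_cols_of[OF m] by auto
  ultimately show ?thesis unfolding harmful_block_def using mu by blast
qed

lemma matching_enum:
  assumes "matching G m"
  obtains r c where "m = (\<lambda>x. (r x, c x)) ` {..<card m}" "inj_on r {..<card m}" "inj_on c {..<card m}"
proof -
  have "finite m" using assms by (simp add: matching_def)
  then obtain h where h: "bij_betw h {0..<card m} m" using ex_bij_betw_nat_finite by blast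
  have h': "inj_on h {..<card m}" "h ` {..<card m} = m"
    using h by (auto simp: bij_betw_def lessThan_atLeast0)
  have "inj_on (fst \<circ> h) {..<card m}" "inj_on (snd \<circ> h) {..<card m}"
    using h' assms by (auto intro!: comp_inj_on simp: matching_def)
  then show ?thesis using that[of "fst \<circ> h" "snd \<circ> h"] h'(2) by (simp add: comp_def)
qed

section \<open>Generic zeros of structured matrices\<close>

lemma minor_cong:
  assumes "\<And>x y. x < k \<Longrightarrow> y < k \<Longrightarrow> N (r x) (c y) = N' (r' x) (c' y)"
  shows "minor k r c N = minor k r' c' N'"
proof -
  have "mat k k (\<lambda>(x, y). N (r x) (c y)) = mat k k (\<lambda>(x, y). N' (r' x) (c' y))"
    using assms by (intro eq_matI) auto
  then show ?thesis by (simp add: minor_def)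
qed

lemma minor_hom:
  assumes "comm_ring_hom f"
  shows "minor k r c (\<lambda>i j. f (N i j)) = f (minor k r c N)"
proof -
  have "mat k k (\<lambda>(x, y). f (N (r x) (c y))) = map_mat f (mat k k (\<lambda>(x, y). N (r x) (c y)))"
    by (intro eq_matI) auto
  then show ?thesis
    unfolding minor_def using comm_ring_hom.hom_det[OF assms] by simp
qed

lemma minor_not_inj:
  assumes "\<not> (inj_on r {..<k} \<and> inj_on c {..<k})"
  shows "minor k r c N = 0"
proof -
  let ?A = "mat k k (\<lambda>(x, y). N (r x) (c y))"
  have A: "?A \<in> carrier_mat k k" by simp
  consider x y where "x < k" "y < k" "x \<noteq> y" "r x = r y" | x y where "x < k" "y < k" "x \<noteq> y" "c x = c y"
    using assms by (auto simp: inj_on_def)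
  then show ?thesis
  proof cases
    case 1
    then have "row ?A x = row ?A y" by (intro eq_vecI) auto
    then show ?thesis using det_identical_rows[OF A 1(3,1,2)] by (simp add: minor_def)
  next
    case 2
    then have "col ?A x = col ?A y" by (intro eq_vecI) auto
    then show ?thesis using det_identical_cols[OF A 2(3,1,2)] by (simp add: minor_def)
  qed
qed

lemma minor_diagonal:
  assumes "\<And>x y. x < k \<Longrightarrow> y < k \<Longrightarrow> N (r x) (c y) = (if x = y then f x else 0)"
  shows "minor k r c N = (\<Prod>x = 0..<k. f x)"
proof -
  let ?A = "mat k k (\<lambda>(x, y). N (r x) (c y))"
  have "upper_triangular ?A" using assms by (auto intro!: upper_triangularI)
  then have "det ?A = prod_list (diag_mat ?A)" by (rule det_upper_triangular[of _ k]) simp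
  also have "\<dots> = (\<Prod>x = 0..<k. f x)"
    unfolding prod_list_diag_prod using assms by (intro prod.cong) auto
  finally show ?thesis by (simp add: minor_def)
qed

text \<open>A Leibniz term that uses the position \<open>e\<close> and otherwise only positions of
  \<open>G\<close> would be a matching of size \<open>k\<close> through \<open>e\<close>. Hence
  every term containing \<open>e\<close> also contains a zero off \<open>G\<close>, whatever value
  stands at \<open>e\<close>.\<close>

lemma minor_upd_unmatchable:
  assumes supp: "\<And>i j. N i j \<noteq> 0 \<Longrightarrow> (i, j) \<in> G" and e: "e \<in> G"
    and no: "\<And>m. matching G m \<Longrightarrow> card m = k \<Longrightarrow> e \<notin> m"
  shows "minor k r c (\<lambda>i j. if (i, j) = e then y else N i j) = minor k r c N"
proof (cases "inj_on r {..<k} \<and> inj_on c {..<k}")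
  case False
  then show ?thesis by (simp add: minor_not_inj)
next
  case inj: True
  let ?N = "\<lambda>i j. if (i, j) = e then y else N i j"
  have "(\<Prod>x = 0..<k. ?N (r x) (c (\<pi> x))) = (\<Prod>x = 0..<k. N (r x) (c (\<pi> x)))"
    if \<pi>: "\<pi> permutes {0..<k}" for \<pi>
  proof (cases "\<exists>x<k. (r x, c (\<pi> x)) = e")
    case False
    then show ?thesis by (intro prod.cong) auto
  next
    case True
    then obtain x where x: "x < k" "(r x, c (\<pi> x)) = e" by blast
    let ?m = "(\<lambda>x. (r x, c (\<pi> x))) ` {..<k}"
    have injm: "inj_on (\<lambda>x. (r x, c (\<pi> x))) {..<k}" using inj by (auto simp: inj_on_def)
    have \<pi>k: "\<pi> z < k" if "z < k" for z using permutes_in_image[OF \<pi>, of z] that by simp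
    have "inj_on snd ?m"
    proof -
      have "inj_on \<pi> {..<k}" using permutes_inj[OF \<pi>] by (rule inj_on_subset) simp
      moreover have "\<pi> ` {..<k} \<subseteq> {..<k}" using \<pi>k by auto
      then have "inj_on c (\<pi> ` {..<k})" using inj by (blast intro: inj_on_subset)
      ultimately have "inj_on (\<lambda>x. c (\<pi> x)) {..<k}"
        using comp_inj_on[of \<pi> "{..<k}" c] by (simp add: comp_def)
      then show ?thesis by (auto simp: inj_on_def)
    qed
    moreover have "inj_on fst ?m" using inj by (auto simp: inj_on_def)
    ultimately have "\<not> ?m \<subseteq> G"
      using no[of ?m] x card_image[OF injm] by (auto simp: matching_def)
    then obtain z where z: "z < k" "(r z, c (\<pi> z)) \<notin> G" by auto
    then have "N (r z) (c (\<pi> z)) = 0" "?N (r z) (c (\<pi> z)) = 0" using supp e by auto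
    then have "(\<Prod>x = 0..<k. ?N (r x) (c (\<pi> x))) = 0" "(\<Prod>x = 0..<k. N (r x) (c (\<pi> x))) = 0"
      using z(1) by (auto intro!: prod_zero)
    then show ?thesis by simp
  qed
  then show ?thesis unfolding minor_eq_sum by (intro sum.cong) auto
qed

lemma polyfun_if: "polyfun X f \<Longrightarrow> polyfun X g \<Longrightarrow> polyfun X (\<lambda>a. if b then f a else g a)"
  by (cases b) simp_all

lemma polyfun_minor:
  assumes "\<And>i j. polyfun X (\<lambda>a. N a i j)"
  shows "polyfun X (\<lambda>a. minor k r c (N a))"
  unfolding minor_eq_sum using assms
  by (intro polyfun_sum polyfun.mult polyfun.const polyfun_prod)

lemma cpolyfun_minor:
  assumes "\<And>i j. cpolyfun X (\<lambda>a. N a i j)"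
  shows "cpolyfun X (\<lambda>a. minor k r c (N a))"
  unfolding minor_eq_sum using assms
  by (intro cpolyfun_sum cpolyfun_mult cpolyfun_const cpolyfun_prod)

section \<open>Entries of the structured matrix and their complex values\<close>

text \<open>A function on all index pairs, zero off the support, so that minors need no side
  conditions on index bounds.\<close>

definition entry :: "real poly mat \<Rightarrow> (nat \<times> nat \<times> nat \<Rightarrow> real) \<Rightarrow> nat \<Rightarrow> nat \<Rightarrow> real poly" where
  "entry M a i j = (if (i, j) \<in> nonzero_positions M
     then \<Sum>k\<le>degree (M $$ (i, j)). monom (a (i, j, k)) k else 0)"

definition zeval :: "complex \<Rightarrow> real poly \<Rightarrow> complex" where
  "zeval z q = poly (map_poly complex_of_real q) z"

interpretation of_real_poly_hom: map_poly_inj_idom_hom "of_real :: real \<Rightarrow> complex" ..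

lemma comm_ring_hom_zeval: "comm_ring_hom (zeval z)"
  by unfold_locales
    (simp_all add: zeval_def of_real_poly_hom.hom_add of_real_poly_hom.hom_mult)

lemma zeval_add: "zeval z (p + q) = zeval z p + zeval z q"
  and zeval_mult: "zeval z (p * q) = zeval z p * zeval z q"
  and zeval_0: "zeval z 0 = 0"
  by (simp_all add: zeval_def of_real_poly_hom.hom_add of_real_poly_hom.hom_mult)

lemma zeval_sum: "zeval z (\<Sum>i\<in>I. f i) = (\<Sum>i\<in>I. zeval z (f i))"
  by (induction I rule: infinite_finite_induct) (auto simp: zeval_add zeval_0)

lemma zeval_monom: "zeval z (monom a n) = of_real a * z ^ n"
  by (simp add: zeval_def map_poly_monom poly_monom)

lemma zeval_const: "zeval z [:a:] = of_real a"
  using zeval_monom[of z a 0] by (simp add: monom_0)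

lemma zeval_at_0: "zeval 0 q = of_real (coeff q 0)"
  by (simp add: zeval_def poly_0_coeff_0)

lemma finite_zeval_roots: "q \<noteq> 0 \<Longrightarrow> finite {z. zeval z q = 0}"
  unfolding zeval_def by (rule poly_roots_finite) simp

lemma rank_structured_mat:
  assumes "M \<in> carrier_mat p v"
  shows "vec_space.rank (dim_row (structured_mat M a)) (eval_mat (structured_mat M a) z)
    = rk p v (\<lambda>i j. zeval z (entry M a i j))"
proof -
  have "eval_mat (structured_mat M a) z = mat p v (\<lambda>(i, j). zeval z (entry M a i j))"
    using assms by (intro eq_matI) (auto simp: eval_mat_def structured_mat_def entry_def zeval_def)
  then show ?thesis using assms by (simp add: rk_def structured_mat_def)
qed

lemma polyfun_var_degree:
  "(i, j) \<in> nonzero_positions M \<Longrightarrow> k \<le> degree (M $$ (i, j)) \<Longrightarrow> polyfun (parameters M) (\<lambda>a. a (i, j, k))"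
  by (rule polyfun.var) (simp add: parameters_def)

lemma cpolyfun_monom: "polyfun X f \<Longrightarrow> cpolyfun X (\<lambda>a. monom (f a) n)"
  unfolding cpolyfun_def
proof (intro conjI allI exI)
  fix m assume "polyfun X f"
  then show "polyfun X (\<lambda>a. coeff (monom (f a) n) m)"
    by (cases "n = m") (simp_all add: polyfun.const)
qed (rule degree_monom_le)

lemma cpolyfun_entry: "cpolyfun (parameters M) (\<lambda>a. entry M a i j)"
proof (cases "(i, j) \<in> nonzero_positions M")
  case True
  then have "cpolyfun (parameters M) (\<lambda>a. \<Sum>k\<le>degree (M $$ (i, j)). monom (a (i, j, k)) k)"
    by (intro cpolyfun_sum cpolyfun_monom polyfun_var_degree) auto
  with True show ?thesis by (simp add: entry_def)
next
  case False
  then show ?thesis by (simp add: entry_def cpolyfun_const)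
qed

lemma polyfun_coeff: "cpolyfun X h \<Longrightarrow> polyfun X (\<lambda>a. coeff (h a) n)"
  by (simp add: cpolyfun_def)

lemma polyfun_prod_nonzero:
  assumes "finite I" "\<And>i. i \<in> I \<Longrightarrow> polyfun X (f i)" "\<And>i. i \<in> I \<Longrightarrow> \<exists>a. f i a \<noteq> 0"
  shows "\<exists>a. (\<Prod>i\<in>I. f i a) \<noteq> 0"
  using assms
proof (induction I rule: finite_induct)
  case (insert i I)
  have "polyfun X (\<lambda>a. \<Prod>i\<in>I. f i a)" using insert.prems(1) by (intro polyfun_prod) auto
  moreover obtain a where "(\<Prod>i\<in>I. f i a) \<noteq> 0" using insert.IH insert.prems by blast
  moreover obtain b where "f i b \<noteq> 0" using insert.prems(2) by blast
  ultimately obtain c where "f i c \<noteq> 0" "(\<Prod>i\<in>I. f i c) \<noteq> 0"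
    using polyfun_nonzero_mult[of X "f i" b "\<lambda>a. \<Prod>i\<in>I. f i a" a] insert.prems(1) by blast
  then show ?case using insert.hyps by (intro exI[of _ c]) simp
qed simp

lemma entry_upd_other:
  "(i, j) \<noteq> (i', j') \<Longrightarrow> entry M (a((i', j', k) := b)) i j = entry M a i j"
  by (auto simp: entry_def intro!: sum.cong)

lemma zeval_entry_upd:
  assumes "(i, j) \<in> nonzero_positions M"
  shows "zeval z (entry M (a((i, j, 0) := b)) i j) = zeval z (entry M a i j) + of_real (b - a (i, j, 0))"
  using assms by (simp add: entry_def zeval_sum zeval_monom sum.atMost_shift zeval_add algebra_simps)

section \<open>Specialising the free entries\<close>

text \<open>The entries at positions in \<open>U\<close> are free complex variables whose values may
  depend on \<open>z\<close>; all others are determined by the parameter point \<open>a\<close>. For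
  \<open>U = {}\<close> this says that the \<open>k\<close>-minors have no common zero.\<close>

definition nearly_full :: "real poly mat \<Rightarrow> nat \<Rightarrow> (nat \<times> nat) set \<Rightarrow> (nat \<times> nat \<times> nat \<Rightarrow> real) \<Rightarrow> bool" where
  "nearly_full M k U a \<longleftrightarrow> (\<forall>z. \<exists>N r c.
     (\<forall>i j. (i, j) \<notin> U \<longrightarrow> N i j = zeval z (entry M a i j)) \<and> minor k r c N \<noteq> 0)"

text \<open>The minor chosen at \<open>z\<close> does not see the position \<open>e\<close>, so the
  free value there can be replaced by the actual one without touching any parameter.\<close>

lemma nearly_full_unmatchable:
  assumes "nearly_full M k (insert e U) a" "e \<in> nonzero_positions M" "U \<subseteq> nonzero_positions M"
    and no: "\<And>m. matching (nonzero_positions M) m \<Longrightarrow> card m = k \<Longrightarrow> e \<notin> m"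
  shows "nearly_full M k U a"
  unfolding nearly_full_def
proof
  fix z
  obtain N r c where N: "\<And>i j. (i, j) \<notin> insert e U \<Longrightarrow> N i j = zeval z (entry M a i j)"
    and nz: "minor k r c N \<noteq> 0"
    using assms(1) unfolding nearly_full_def by blast
  let ?N = "\<lambda>i j. if (i, j) = e then zeval z (entry M a i j) else N i j"
  obtain i0 j0 where e: "e = (i0, j0)" by (cases e)
  have supp: "(i, j) \<in> nonzero_positions M" if "N i j \<noteq> 0" for i j
    using that N[of i j] assms(2,3) by (cases "(i, j) \<in> insert e U") (auto simp: entry_def zeval_0 split: if_splits)
  have "minor k r c (\<lambda>i j. if (i, j) = e then zeval z (entry M a i0 j0) else N i j) = minor k r c N"
    using minor_upd_unmatchable[of N "nonzero_positions M" e k r c, OF supp assms(2) no] by blast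
  moreover have "(\<lambda>i j. if (i, j) = e then zeval z (entry M a i0 j0) else N i j) = ?N"
    by (auto simp: e fun_eq_iff)
  ultimately have "minor k r c ?N \<noteq> 0" using nz by simp
  moreover have "\<forall>i j. (i, j) \<notin> U \<longrightarrow> ?N i j = zeval z (entry M a i j)" using N by auto
  ultimately show "\<exists>N r c. (\<forall>i j. (i, j) \<notin> U \<longrightarrow> N i j = zeval z (entry M a i j)) \<and> minor k r c N \<noteq> 0"
    by (intro exI[of _ ?N] exI[of _ r] exI[of _ c] conjI)
qed

text \<open>Off the finitely many zeros of the minor that avoids the entry, that minor works; at each zero
  the constant coefficient of the entry only has to avoid the roots of one polynomial.\<close>

lemma nearly_full_avoidable:
  assumes full: "nearly_full M k (insert (i0, j0) U) a" and e: "(i0, j0) \<in> nonzero_positions M"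
    and avoid: "i0 \<notin> r0 ` {..<k} \<or> j0 \<notin> c0 ` {..<k}" and nz0: "minor k r0 c0 (entry M a) \<noteq> 0"
  shows "finite {b. \<not> nearly_full M k U (a((i0, j0, 0) := b))}"
proof -
  let ?a = "\<lambda>b. a((i0, j0, 0) := b)"
  define Z where "Z = {z. zeval z (minor k r0 c0 (entry M a)) = 0}"
  have Z: "finite Z" unfolding Z_def using nz0 by (rule finite_zeval_roots)
  have "\<forall>z. \<exists>N r c. (\<forall>i j. (i, j) \<notin> insert (i0, j0) U \<longrightarrow> N i j = zeval z (entry M a i j)) \<and> minor k r c N \<noteq> 0"
    using full unfolding nearly_full_def .
  then obtain N r c where N: "\<And>z i j. (i, j) \<notin> insert (i0, j0) U \<Longrightarrow> N z i j = zeval z (entry M a i j)"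
    and nz: "\<And>z. minor k (r z) (c z) (N z) \<noteq> (0::complex)"
    by metis
  \<comment> \<open>The good minor at \<open>z\<close> as a polynomial in the one freed entry. It is
    nonzero because it does not vanish at the value that \<open>N z\<close> has there.\<close>
  define q where "q z = minor k (r z) (c z) (\<lambda>i j. if (i, j) = (i0, j0) then [:0, 1:] else [:N z i j:])" for z
  have hom: "comm_ring_hom (\<lambda>q. poly q y)" for y :: complex by unfold_locales auto
  have q: "poly (q z) y = minor k (r z) (c z) (\<lambda>i j. if (i, j) = (i0, j0) then y else N z i j)" for z y
    unfolding q_def minor_hom[OF hom, symmetric] by (rule minor_cong) auto
  have q0: "q z \<noteq> 0" for z
  proof -
    have "poly (q z) (N z i0 j0) = minor k (r z) (c z) (N z)"
      unfolding q by (rule minor_cong) auto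
    then show ?thesis using nz by force
  qed
  \<comment> \<open>Changing the constant coefficient translates the value of the entry by a real
    number; this map is injective in \<open>b\<close>, so each of the finitely many \<open>z\<close>
    excludes finitely many \<open>b\<close>.\<close>
  define B where "B = (\<Union>z\<in>Z. {b. poly (q z) (zeval z (entry M a i0 j0) + of_real (b - a (i0, j0, 0))) = 0})"
  have "finite B"
    unfolding B_def
  proof (intro finite_UN_I Z)
    fix z
    have "finite {y. poly (q z) y = 0}" using q0 by (rule poly_roots_finite)
    then have "finite ((\<lambda>b. zeval z (entry M a i0 j0) + of_real (b - a (i0, j0, 0))) -` {y. poly (q z) y = 0})"
      by (rule finite_vimageI) (auto simp: inj_def)
    then show "finite {b. poly (q z) (zeval z (entry M a i0 j0) + of_real (b - a (i0, j0, 0))) = 0}"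
      by (simp add: vimage_def)
  qed
  moreover have "nearly_full M k U (?a b)" if b: "b \<notin> B" for b
    unfolding nearly_full_def
  proof
    fix z
    show "\<exists>N r c. (\<forall>i j. (i, j) \<notin> U \<longrightarrow> N i j = zeval z (entry M (?a b) i j)) \<and> minor k r c N \<noteq> 0"
    proof (cases "z \<in> Z")
      case False
      have "minor k r0 c0 (entry M (?a b)) = minor k r0 c0 (entry M a)"
        using avoid by (intro minor_cong entry_upd_other) auto
      then have "zeval z (minor k r0 c0 (entry M (?a b))) \<noteq> 0"
        using False by (simp add: Z_def)
      then have "minor k r0 c0 (\<lambda>i j. zeval z (entry M (?a b) i j)) \<noteq> 0"
        by (simp add: minor_hom[OF comm_ring_hom_zeval])
      then show ?thesis
        by (intro exI[of _ "\<lambda>i j. zeval z (entry M (?a b) i j)"] exI[of _ r0] exI[of _ c0]) simp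
    next
      case True
      let ?N = "\<lambda>i j. if (i, j) = (i0, j0) then zeval z (entry M (?a b) i0 j0) else N z i j"
      have "minor k (r z) (c z) ?N \<noteq> 0"
        using b True unfolding q[symmetric] zeval_entry_upd[OF e] by (auto simp: B_def)
      moreover have "?N i j = zeval z (entry M (?a b) i j)" if "(i, j) \<notin> U" for i j
        using N[of i j] that entry_upd_other[of i j i0 j0] by auto
      ultimately show ?thesis
        by (intro exI[of _ ?N] exI[of _ "r z"] exI[of _ "c z"] conjI) blast+
    qed
  qed
  ultimately show ?thesis by (auto intro: finite_subset)
qed

text \<open>The function \<open>g\<close> carries what must survive all specialisations: where it is
  nonzero, every minor belonging to a matching is a nonzero polynomial in \<open>s\<close>. An entry
  whose row or column is missed by a matching thus always has an avoiding minor at hand, and keeping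
  \<open>g\<close> nonzero excludes only finitely many values in each step.\<close>

lemma exists_nearly_full_empty:
  assumes U: "finite U" "U \<subseteq> nonzero_positions M" "nearly_full M k U a"
    and e: "\<And>e. e \<in> U \<Longrightarrow> harmless (nonzero_positions M) k e"
    and g: "polyfun X g" "g a \<noteq> 0"
    and mnz: "\<And>a r c. g a \<noteq> 0 \<Longrightarrow> inj_on r {..<k} \<Longrightarrow> inj_on c {..<k} \<Longrightarrow>
      (\<And>x. x < k \<Longrightarrow> (r x, c x) \<in> nonzero_positions M) \<Longrightarrow> minor k r c (entry M a) \<noteq> 0"
  shows "\<exists>a. nearly_full M k {} a \<and> g a \<noteq> 0"
  using assms(1-3,4,6)
proof (induction U arbitrary: a rule: finite_induct)
  case empty
  then show ?case by blast
next
  case (insert e U)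
  let ?G = "nonzero_positions M"
  obtain i0 j0 where e: "e = (i0, j0)" by (cases e)
  have "\<exists>a'. nearly_full M k U a' \<and> g a' \<noteq> 0"
  proof (cases "\<forall>m. matching ?G m \<longrightarrow> card m = k \<longrightarrow> e \<notin> m")
    case True
    then have "nearly_full M k U a"
      using insert.prems(1,2) by (intro nearly_full_unmatchable[of M k e U a]) auto
    then show ?thesis using insert.prems(4) by blast
  next
    case False
    then obtain m where m: "matching ?G m" "card m = k" "i0 \<notin> fst ` m \<or> j0 \<notin> snd ` m"
      using insert.prems(3)[of e] e by (auto simp: harmless_def)
    obtain r c where rc: "m = (\<lambda>x. (r x, c x)) ` {..<k}" "inj_on r {..<k}" "inj_on c {..<k}"
      using matching_enum[OF m(1)] m(2) by metis
    have rcG: "(r x, c x) \<in> ?G" if "x < k" for x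
      using m(1) that unfolding rc(1) matching_def by auto
    have avoid: "i0 \<notin> r ` {..<k} \<or> j0 \<notin> c ` {..<k}"
      using m(3) unfolding rc(1) by (auto simp: image_image)
    have "minor k r c (entry M a) \<noteq> 0"
      using mnz[OF insert.prems(4) rc(2,3) rcG] .
    then have "finite {b. \<not> nearly_full M k U (a((i0, j0, 0) := b))}"
      using insert.prems(1,2) e avoid by (intro nearly_full_avoidable) auto
    moreover have "finite {b. g (a((i0, j0, 0) := b)) = 0}"
      using g(1) insert.prems(4) by (rule polyfun_upd_finite)
    ultimately have "finite ({b. \<not> nearly_full M k U (a((i0, j0, 0) := b))} \<union> {b. g (a((i0, j0, 0) := b)) = 0})"
      by blast
    then obtain b where "b \<notin> {b. \<not> nearly_full M k U (a((i0, j0, 0) := b))} \<union> {b. g (a((i0, j0, 0) := b)) = 0}"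
      using ex_new_if_finite[OF infinite_UNIV_char_0] by blast
    then show ?thesis by blast
  qed
  then obtain a' where "nearly_full M k U a'" "g a' \<noteq> 0" by blast
  then show ?case using insert.IH[of a'] insert.prems by blast
qed

text \<open>With constant coefficient 1 on the matching and all other parameters 0 the submatrix is
  the identity. Stating this for the constant coefficient makes such minors generically nonzero even
  at \<open>z = 0\<close>.\<close>

lemma minor_entry_matching_nonzero:
  assumes inj: "inj_on r {..<k}" "inj_on c {..<k}" and G: "\<And>x. x < k \<Longrightarrow> (r x, c x) \<in> nonzero_positions M"
  shows "\<exists>a. coeff (minor k r c (entry M a)) 0 \<noteq> 0"
proof -
  define a :: "nat \<times> nat \<times> nat \<Rightarrow> real"
    where "a = (\<lambda>(i, j, l). if l = 0 \<and> (\<exists>x<k. i = r x \<and> j = c x) then 1 else 0)"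
  have "minor k r c (entry M a) = (\<Prod>x = 0..<k. 1)"
  proof (rule minor_diagonal)
    fix x y assume xy: "x < k" "y < k"
    have "(\<exists>z<k. r x = r z \<and> c y = c z) \<longleftrightarrow> x = y"
      using xy inj by (auto dest: inj_onD)
    then have "a (r x, c y, l) = (if l = 0 \<and> x = y then 1 else 0)" for l
      by (simp only: a_def prod.case)
    then have "(\<Sum>l\<le>n. monom (a (r x, c y, l)) l) = (if x = y then 1 else 0)" for n
      by (simp add: sum.atMost_shift monom_0 pCons_one)
    then show "entry M a (r x) (c y) = (if x = y then 1 else 0)"
      using G[OF xy(1)] by (auto simp: entry_def)
  qed
  then show ?thesis by (intro exI[of _ a]) simp
qed

section \<open>Resultants and common zeros\<close>

text \<open>A vanishing resultant means a nonconstant gcd, and over the complex numbers this means a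
  common root. By \<open>f \<noteq> 0\<close> the gcd is nonzero, so that a root forces positive
  degree.\<close>

lemma resultant_complex_eq_0_iff:
  fixes f g :: "complex poly"
  assumes "f \<noteq> 0"
  shows "resultant f g = 0 \<longleftrightarrow> (\<exists>z. poly f z = 0 \<and> poly g z = 0)"
proof -
  have "degree (gcd f g) \<noteq> 0 \<longleftrightarrow> (\<exists>z. poly (gcd f g) z = 0)"
  proof
    assume "degree (gcd f g) \<noteq> 0"
    then have "\<not> constant (poly (gcd f g))" by (simp add: constant_degree)
    then show "\<exists>z. poly (gcd f g) z = 0" by (rule fundamental_theorem_of_algebra)
  next
    assume "\<exists>z. poly (gcd f g) z = 0"
    then obtain z where "[:- z, 1:] dvd gcd f g" by (auto simp: poly_eq_0_iff_dvd)
    moreover have "gcd f g \<noteq> 0" using assms by simp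
    ultimately have "degree [:- z, 1:] \<le> degree (gcd f g)" by (rule dvd_imp_degree_le)
    then show "degree (gcd f g) \<noteq> 0" by simp
  qed
  also have "\<dots> \<longleftrightarrow> (\<exists>z. poly f z = 0 \<and> poly g z = 0)"
    by (auto simp: poly_eq_0_iff_dvd)
  finally show ?thesis by (simp add: resultant_0_gcd)
qed

lemma resultant_eq_0_iff_zeval:
  assumes "f \<noteq> 0"
  shows "resultant f g = 0 \<longleftrightarrow> (\<exists>z. zeval z f = 0 \<and> zeval z g = 0)"
proof -
  have "resultant (map_poly complex_of_real f) (map_poly complex_of_real g) = of_real (resultant f g)"
    by (rule of_real_hom.resultant_hom)
  moreover have "map_poly complex_of_real f \<noteq> 0" using assms by simp
  ultimately show ?thesis
    using resultant_complex_eq_0_iff[of "map_poly complex_of_real f" "map_poly complex_of_real g"]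
    by (simp add: zeval_def)
qed

lemma finite_nonzero_positions: "finite (nonzero_positions M)"
proof -
  have "nonzero_positions M \<subseteq> {..<dim_row M} \<times> {..<dim_col M}"
    by (auto simp: nonzero_positions_def)
  then show ?thesis by (rule finite_subset) simp
qed

section \<open>Characterisation of structural controllability\<close>

text \<open>The cover bounds the rank by \<open>k\<close> for all parameters and all
  \<open>z\<close>. Constant rank therefore follows as soon as the \<open>k\<close>-minors have no
  common zero.\<close>

lemma structurally_controllable_if_harmless:
  fixes M :: "real poly mat"
  defines "G \<equiv> nonzero_positions M"
  assumes m0: "matching G m0" "card m0 = k"
    and cov: "cover G R C" "card R + card C = k"
    and harmless: "\<And>i j. (i, j) \<in> G \<Longrightarrow> degree (M $$ (i, j)) > 0 \<Longrightarrow> harmless G k (i, j)"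
  shows "structurally_controllable M"
proof -
  let ?X = "parameters M" and ?p = "dim_row M" and ?v = "dim_col M"
  have M: "M \<in> carrier_mat ?p ?v" by simp
  have Gpv: "i < ?p" "j < ?v" if "(i, j) \<in> G" for i j
    using that by (auto simp: G_def nonzero_positions_def)
  \<comment> \<open>Extensional index maps, so that only finitely many minors have to be
    summed.\<close>
  define F where "F = ({..<k} \<rightarrow>\<^sub>E {..<?p}) \<times> ({..<k} \<rightarrow>\<^sub>E {..<?v})"
  have F: "finite F" by (auto simp: F_def intro!: finite_PiE)
  define T where "T = {(r, c) \<in> F. inj_on r {..<k} \<and> inj_on c {..<k} \<and> (\<forall>x<k. (r x, c x) \<in> G)}"
  have T: "finite T" "T \<subseteq> F" using F by (auto simp: T_def intro: finite_subset)
  define D where "D f a = minor k (fst f) (snd f) (entry M a)" for f a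
  have cD: "cpolyfun ?X (D f)" for f
    unfolding D_def by (intro cpolyfun_minor cpolyfun_entry)
  have restr: "\<exists>f\<in>T. \<forall>a. minor k r c (entry M a) = D f a"
    if rc: "inj_on r {..<k}" "inj_on c {..<k}" "\<And>x. x < k \<Longrightarrow> (r x, c x) \<in> G" for r c
  proof (intro bexI allI)
    show "minor k r c (entry M a) = D (restrict r {..<k}, restrict c {..<k}) a" for a
      unfolding D_def by (rule minor_cong) simp
    have "r x < ?p" "c x < ?v" if x: "x < k" for x
      using Gpv[OF rc(3)[OF x]] by blast+
    then show "(restrict r {..<k}, restrict c {..<k}) \<in> T"
      using rc by (simp add: T_def F_def)
  qed
  obtain r0 c0 where rc0: "m0 = (\<lambda>x. (r0 x, c0 x)) ` {..<k}" "inj_on r0 {..<k}" "inj_on c0 {..<k}"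
    using matching_enum[OF m0(1)] m0(2) by metis
  have "\<And>x. x < k \<Longrightarrow> (r0 x, c0 x) \<in> G" using m0(1) unfolding rc0(1) matching_def by auto
  then obtain f0 where f0: "f0 \<in> T" using restr[OF rc0(2,3)] by blast
  have Tnz: "\<exists>a. coeff (D f a) 0 \<noteq> 0" if "f \<in> T" for f
    unfolding D_def using that by (intro minor_entry_matching_nonzero) (auto simp: T_def G_def)
  obtain B0 where B0: "\<And>a. degree (D f0 a) \<le> B0"
    using cD[of f0] by (auto simp: cpolyfun_def)
  \<comment> \<open>The largest degree that this minor attains: the coefficient in this degree is a
    polynomial function of the parameters that is not identically zero.\<close>
  have "\<exists>a. D f0 a \<noteq> 0 \<and> (\<forall>b. D f0 b \<noteq> 0 \<longrightarrow> degree (D f0 b) \<le> degree (D f0 a))"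
  proof -
    obtain a where a: "D f0 a \<noteq> 0" using Tnz[OF f0] by force
    show ?thesis
      using ex_has_greatest_nat[of "\<lambda>a. D f0 a \<noteq> 0" a "\<lambda>a. degree (D f0 a)" "Suc B0"] a B0
      by (auto simp: less_Suc_eq_le)
  qed
  then obtain a1 where a1: "D f0 a1 \<noteq> 0" "\<And>b. D f0 b \<noteq> 0 \<Longrightarrow> degree (D f0 b) \<le> degree (D f0 a1)"
    by blast
  define n where "n = degree (D f0 a1)"
  have degD: "degree (D f0 a) \<le> n" for a using a1(2)[of a] by (cases "D f0 a = 0") (auto simp: n_def)
  \<comment> \<open>The constant coefficients keep all matching minors nonzero, as the
    specialisation requires; the last factor fixes the degree of \<open>D f0\<close>, as the
    resultant requires.\<close>
  define g where "g a = (\<Prod>f\<in>T. coeff (D f a) 0) * coeff (D f0 a) n" for a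
  have g: "polyfun ?X g"
    unfolding g_def by (intro polyfun.mult polyfun_prod polyfun_coeff cD)
  have "\<exists>a. g a \<noteq> 0"
  proof -
    obtain a where a: "(\<Prod>f\<in>T. coeff (D f a) 0) \<noteq> 0"
      using polyfun_prod_nonzero[OF T(1), of ?X "\<lambda>f a. coeff (D f a) 0"] polyfun_coeff[OF cD] Tnz by blast
    have "polyfun ?X (\<lambda>a. \<Prod>f\<in>T. coeff (D f a) 0)" by (intro polyfun_prod polyfun_coeff cD)
    moreover have "polyfun ?X (\<lambda>a. coeff (D f0 a) n)" by (intro polyfun_coeff cD)
    moreover have "coeff (D f0 a1) n \<noteq> 0" using a1(1) by (simp add: n_def)
    ultimately show ?thesis
      using polyfun_nonzero_mult[of ?X "\<lambda>a. \<Prod>f\<in>T. coeff (D f a) 0" a "\<lambda>a. coeff (D f0 a) n" a1] a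
      unfolding g_def by simp
  qed
  then obtain a0 where a0: "g a0 \<noteq> 0" by blast
  have gT: "coeff (D f a) 0 \<noteq> 0" if "g a \<noteq> 0" "f \<in> T" for f a
    using that T(1) by (auto simp: g_def)
  define U where "U = {(i, j) \<in> G. degree (M $$ (i, j)) > 0}"
  have U: "finite U" "U \<subseteq> nonzero_positions M"
    using finite_nonzero_positions[of M] by (auto simp: U_def G_def intro: finite_subset)
  \<comment> \<open>Off \<open>U\<close> the entries are constant in \<open>s\<close>, so the matrix
    evaluated at 0 agrees there with the matrix at any \<open>z\<close> and can serve as
    \<open>N\<close>.\<close>
  have full0: "nearly_full M k U a0"
    unfolding nearly_full_def
  proof
    fix z
    have "minor k (fst f0) (snd f0) (\<lambda>i j. zeval 0 (entry M a0 i j)) = zeval 0 (D f0 a0)"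
      unfolding D_def by (rule minor_hom[OF comm_ring_hom_zeval])
    then have "minor k (fst f0) (snd f0) (\<lambda>i j. zeval 0 (entry M a0 i j)) \<noteq> 0"
      using gT[OF a0 f0] by (simp add: zeval_at_0)
    moreover have "zeval 0 (entry M a0 i j) = zeval z (entry M a0 i j)" if "(i, j) \<notin> U" for i j
      using that by (auto simp: U_def G_def entry_def zeval_monom zeval_0)
    ultimately show "\<exists>N r c. (\<forall>i j. (i, j) \<notin> U \<longrightarrow> N i j = zeval z (entry M a0 i j)) \<and> minor k r c N \<noteq> 0"
      by (intro exI[of _ "\<lambda>i j. zeval 0 (entry M a0 i j)"] exI[of _ "fst f0"] exI[of _ "snd f0"]) simp
  qed
  have "\<exists>a. nearly_full M k {} a \<and> g a \<noteq> 0"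
  proof (rule exists_nearly_full_empty[OF U full0 _ g a0])
    show "harmless (nonzero_positions M) k e" if "e \<in> U" for e
      using that harmless[of "fst e" "snd e"] by (auto simp: U_def G_def)
    fix a r c
    assume ga: "g a \<noteq> 0" and inj: "inj_on r {..<k}" "inj_on c {..<k}"
      and rcG: "\<And>x. x < k \<Longrightarrow> (r x, c x) \<in> nonzero_positions M"
    obtain f where "f \<in> T" "minor k r c (entry M a) = D f a"
      using restr[OF inj] rcG unfolding G_def by blast
    then show "minor k r c (entry M a) \<noteq> 0" using gT[OF ga, of f] by auto
  qed
  then obtain a2 where a2: "nearly_full M k {} a2" "g a2 \<noteq> 0" by blast
  have full2: "\<exists>f\<in>F. zeval z (D f a2) \<noteq> 0" for z
  proof -
    obtain N r c where N: "\<forall>i j. (i, j) \<notin> {} \<longrightarrow> N i j = zeval z (entry M a2 i j)" "minor k r c N \<noteq> 0"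
      using a2(1)[unfolded nearly_full_def, rule_format, of z] by (elim exE conjE) (rule that)
    have "N = (\<lambda>i j. zeval z (entry M a2 i j))" using N(1) by (intro ext) simp
    then have ne: "zeval z (minor k r c (entry M a2)) \<noteq> 0"
      using N(2) minor_hom[OF comm_ring_hom_zeval] by metis
    \<comment> \<open>A nonzero Leibniz term places all its positions in \<open>G\<close>, which
      shows that the index maps respect the dimensions and hence can be taken from
      \<open>F\<close>.\<close>
    have "\<exists>\<pi>. \<pi> permutes {0..<k} \<and> (\<Prod>x = 0..<k. entry M a2 (r x) (c (\<pi> x))) \<noteq> 0"
    proof (rule ccontr)
      assume "\<not> ?thesis"
      then have "minor k r c (entry M a2) = 0" unfolding minor_eq_sum by (intro sum.neutral) auto
      then show False using ne by (simp add: zeval_0)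
    qed
    then obtain \<pi> where \<pi>: "\<pi> permutes {0..<k}" "(\<Prod>x = 0..<k. entry M a2 (r x) (c (\<pi> x))) \<noteq> 0"
      by blast
    then have in_G: "(r x, c (\<pi> x)) \<in> G" if "x < k" for x
      using that by (auto simp: entry_def G_def split: if_splits)
    have "c y < ?v" if "y < k" for y
    proof -
      have "y \<in> \<pi> ` {0..<k}" using permutes_image[OF \<pi>(1)] that by simp
      then obtain x where "x < k" "y = \<pi> x" by auto
      then show ?thesis using Gpv(2)[OF in_G] by simp
    qed
    moreover have "r x < ?p" if "x < k" for x using Gpv in_G[OF that] by blast
    ultimately have "(restrict r {..<k}, restrict c {..<k}) \<in> F" by (auto simp: F_def)
    moreover have "D (restrict r {..<k}, restrict c {..<k}) a2 = minor k r c (entry M a2)"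
      unfolding D_def by (rule minor_cong) simp
    ultimately show ?thesis using ne by metis
  qed
  obtain idx :: "(nat \<Rightarrow> nat) \<times> (nat \<Rightarrow> nat) \<Rightarrow> nat" where idx: "inj_on idx F"
    using finite_imp_inj_to_nat_seg[OF F] by blast
  have D0nz: "D f0 a2 \<noteq> 0" using gT[OF a2(2) f0] by auto
  \<comment> \<open>For fixed \<open>z\<close> the values of the minors become coefficients of a
    polynomial in an unknown weight; distinct exponents prevent cancellation. Since
    \<open>D f0 a2\<close> has finitely many zeros, one real weight \<open>\<tau>\<close> avoids the
    roots of \<open>Q z\<close> at all of them.\<close>
  define Q where "Q z = (\<Sum>f\<in>F. monom (zeval z (D f a2)) (idx f))" for z
  have Q: "Q z \<noteq> 0" for z
  proof -
    obtain f where f: "f \<in> F" "zeval z (D f a2) \<noteq> 0" using full2 by blast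
    have "coeff (Q z) (idx f) = (\<Sum>f'\<in>F. if f' = f then zeval z (D f a2) else 0)"
      unfolding Q_def coeff_sum using idx f(1) by (intro sum.cong) (auto simp: inj_on_def)
    also have "\<dots> = zeval z (D f a2)" using F f(1) by simp
    finally show ?thesis using f(2) by force
  qed
  define W where "W = (\<Union>z\<in>{z. zeval z (D f0 a2) = 0}. of_real -` {y. poly (Q z) y = 0} :: real set)"
  have "finite W"
    unfolding W_def using finite_zeval_roots[OF D0nz] poly_roots_finite[OF Q]
    by (intro finite_UN_I finite_vimageI) (auto simp: inj_def)
  then obtain \<tau> where "\<tau> \<notin> W"
    using ex_new_if_finite[OF infinite_UNIV_char_0] by metis
  then have \<tau>: "poly (Q z) (of_real \<tau>) \<noteq> 0" if "zeval z (D f0 a2) = 0" for z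
    using that by (auto simp: W_def)
  define P where "P a = (\<Sum>f\<in>F. [:\<tau> ^ idx f:] * D f a)" for a
  have cP: "cpolyfun ?X P"
    unfolding P_def by (intro cpolyfun_sum cpolyfun_mult cpolyfun_const cD)
  have zP: "zeval z (P a) = (\<Sum>f\<in>F. of_real (\<tau> ^ idx f) * zeval z (D f a))" for z a
    unfolding P_def zeval_sum zeval_mult zeval_const by simp
  have PQ: "zeval z (P a2) = poly (Q z) (of_real \<tau>)" for z
    unfolding zP Q_def by (simp add: poly_sum poly_monom mult.commute)
  obtain B where B: "\<And>a. degree (P a) \<le> B" using cP by (auto simp: cpolyfun_def)
  define K where "K = Suc B"
  \<comment> \<open>Adding a multiple of \<open>D f0 a\<close> changes no common zero and fixes the degree, so that the Sylvester
    matrix has a size that does not depend on the parameters.\<close>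
  define P' where "P' a = P a + monom 1 K * D f0 a" for a
  have cP': "cpolyfun ?X P'"
    unfolding P'_def by (intro cpolyfun_add cP cpolyfun_mult cpolyfun_const cD)
  have zP': "zeval z (D f0 a) = 0 \<Longrightarrow> zeval z (P' a) = zeval z (P a)" for z a
    by (simp add: P'_def zeval_add zeval_mult)
  have degP': "degree (P' a) = K + n" if "coeff (D f0 a) n \<noteq> 0" for a
  proof (rule antisym)
    have "degree (monom 1 K * D f0 a) \<le> K + n"
      using degD[of a] by (intro order.trans[OF degree_mult_le] add_mono degree_monom_le)
    then show "degree (P' a) \<le> K + n"
      unfolding P'_def using B[of a] by (intro degree_add_le) (auto simp: K_def)
    have "coeff (P a) (K + n) = 0" using B[of a] by (intro coeff_eq_0) (simp add: K_def)
    then have "coeff (P' a) (K + n) \<noteq> 0" using that by (simp add: P'_def coeff_monom_mult)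
    then show "K + n \<le> degree (P' a)" by (rule le_degree)
  qed
  have degDn: "degree (D f0 a) = n" if "coeff (D f0 a) n \<noteq> 0" for a
    using degD[of a] le_degree[OF that] by simp
  \<comment> \<open>Forming the Sylvester matrix with the fixed degrees \<open>n\<close> and
    \<open>K + n\<close> makes its determinant polynomial in the parameters everywhere. The factor
    in front ensures that these are the true degrees wherever \<open>S\<close> is nonzero.\<close>
  define S where "S a = coeff (D f0 a) n * det (sylvester_mat_sub n (K + n) (D f0 a) (P' a))" for a
  have S_res: "S a = coeff (D f0 a) n * resultant (D f0 a) (P' a)" if "coeff (D f0 a) n \<noteq> 0" for a
    using degP'[OF that] degDn[OF that] by (simp add: S_def resultant_def sylvester_mat_def)
  have "polyfun ?X S"
  proof -
    have "det (sylvester_mat_sub n (K + n) (D f0 a) (P' a)) = minor (n + (K + n)) id id (\<lambda>i j.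
       if i < K + n then if i \<le> j \<and> j - i \<le> n then coeff (D f0 a) (n + i - j) else 0
       else if i - (K + n) \<le> j \<and> j \<le> i then coeff (P' a) (i - j) else 0)" for a
      unfolding sylvester_mat_sub_def minor_def id_apply ..
    moreover have "polyfun ?X (\<lambda>a. minor (n + (K + n)) id id (\<lambda>i j.
       if i < K + n then if i \<le> j \<and> j - i \<le> n then coeff (D f0 a) (n + i - j) else 0
       else if i - (K + n) \<le> j \<and> j \<le> i then coeff (P' a) (i - j) else 0))"
    proof (rule polyfun_minor)
      fix i j
      show "polyfun ?X (\<lambda>a. if i < K + n then if i \<le> j \<and> j - i \<le> n then coeff (D f0 a) (n + i - j) else 0
       else if i - (K + n) \<le> j \<and> j \<le> i then coeff (P' a) (i - j) else 0)"
        by (intro polyfun_if polyfun_coeff cD cP' polyfun.const)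
    qed
    ultimately show ?thesis
      unfolding S_def by (intro polyfun.mult polyfun_coeff cD) simp
  qed
  moreover have "S a2 \<noteq> 0"
  proof -
    have nz: "coeff (D f0 a2) n \<noteq> 0" using a2(2) by (auto simp: g_def)
    have "resultant (D f0 a2) (P' a2) \<noteq> 0"
      unfolding resultant_eq_0_iff_zeval[OF D0nz] using zP' PQ \<tau> by metis
    then show ?thesis using S_res[OF nz] nz by simp
  qed
  moreover have "controllable (structured_mat M a)" if "S a \<noteq> 0" for a
    unfolding controllable_def rank_structured_mat[OF M]
  proof (intro exI[of _ k] allI antisym)
    fix z
    have nz: "coeff (D f0 a) n \<noteq> 0" using that by (auto simp: S_def)
    then have D0: "D f0 a \<noteq> 0" by auto
    have "resultant (D f0 a) (P' a) \<noteq> 0" using S_res[OF nz] that by auto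
    then have no_common: "zeval z (D f0 a) \<noteq> 0 \<or> zeval z (P' a) \<noteq> 0"
      unfolding resultant_eq_0_iff_zeval[OF D0] by blast
    have "\<exists>f\<in>F. zeval z (D f a) \<noteq> 0"
    proof (cases "zeval z (D f0 a) = 0")
      case True
      then have "zeval z (P a) \<noteq> 0" using no_common zP' by simp
      then show ?thesis unfolding zP by (metis (no_types, lifting) mult_zero_right sum.neutral)
    qed (use f0 T(2) in blast)
    then obtain f where f: "f \<in> F" "zeval z (D f a) \<noteq> 0" by blast
    have "minor k (fst f) (snd f) (\<lambda>i j. zeval z (entry M a i j)) \<noteq> 0"
      using f(2) unfolding D_def minor_hom[OF comm_ring_hom_zeval] .
    moreover have "fst f x < ?p" "snd f x < ?v" if "x < k" for x
      using f(1) PiE_mem[of "fst f" "{..<k}" "\<lambda>_. {..<?p}" x] PiE_mem[of "snd f" "{..<k}" "\<lambda>_. {..<?v}" x] that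
      by (simp_all add: F_def mem_Times_iff)
    ultimately show "k \<le> rk ?p ?v (\<lambda>i j. zeval z (entry M a i j))"
      by (intro rk_ge_minor[of k "fst f" _ "snd f"])
    have "rk ?p ?v (\<lambda>i j. zeval z (entry M a i j)) \<le> card R + card C"
    proof (rule rk_le_cover)
      show "finite R" "finite C" using cov(1) by (simp_all add: cover_def)
      fix i j assume "zeval z (entry M a i j) \<noteq> 0"
      then have "(i, j) \<in> G" by (auto simp: entry_def G_def zeval_0 split: if_splits)
      then show "i \<in> R \<or> j \<in> C" using cov(1) unfolding cover_def by blast
    qed
    then show "rk ?p ?v (\<lambda>i j. zeval z (entry M a i j)) \<le> k" using cov(2) by simp
  qed
  ultimately show ?thesis
    unfolding structurally_controllable_def by (intro holds_genericallyI[of _ S a2])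
qed

text \<open>Two points refute constant rank: at \<open>z = 0\<close> the rank is at least
  \<open>card m0\<close>, and at a zero of the block determinant it is smaller.\<close>

lemma not_structurally_controllable_if_harmful:
  fixes M :: "real poly mat"
  defines "G \<equiv> nonzero_positions M"
  assumes m0: "matching G m0" and harmful: "harmful_block G (card m0) (i0, j0)"
    and deg: "degree (M $$ (i0, j0)) > 0"
  shows "\<not> structurally_controllable M"
proof
  assume sc: "structurally_controllable M"
  let ?X = "parameters M" and ?p = "dim_row M" and ?v = "dim_col M"
  have M: "M \<in> carrier_mat ?p ?v" by simp
  have Gpv: "i < ?p" "j < ?v" if "(i, j) \<in> G" for i j
    using that by (auto simp: G_def nonzero_positions_def)
  obtain m R C where m: "matching G m" "(i0, j0) \<in> m" "finite R" "finite C"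
    "card R + card C + card m = card m0"
    "\<forall>(i, j)\<in>G. i \<in> R \<or> j \<in> C \<or> (i \<in> fst ` m \<and> j \<in> snd ` m)"
    using harmful unfolding harmful_block_def by blast
  obtain r0 c0 where rc0: "m0 = (\<lambda>x. (r0 x, c0 x)) ` {..<card m0}" "inj_on r0 {..<card m0}" "inj_on c0 {..<card m0}"
    by (rule matching_enum[OF m0])
  have rc0G: "(r0 x, c0 x) \<in> G" if "x < card m0" for x
  proof -
    have "(r0 x, c0 x) \<in> m0" using that by (subst rc0(1)) blast
    then show ?thesis using m0 by (auto simp: matching_def)
  qed
  obtain r c where rc: "m = (\<lambda>x. (r x, c x)) ` {..<card m}" "inj_on r {..<card m}" "inj_on c {..<card m}"
    by (rule matching_enum[OF m(1)])
  have rcG: "(r x, c x) \<in> G" if "x < card m" for x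
  proof -
    have "(r x, c x) \<in> m" using that by (subst rc(1)) blast
    then show ?thesis using m(1) by (auto simp: matching_def)
  qed
  have fs: "fst ` m = r ` {..<card m}" "snd ` m = c ` {..<card m}"
    by (subst rc(1), simp add: image_image)+
  \<comment> \<open>A nonzero coefficient of \<open>s\<close> makes the block minor nonconstant and
    so provides the complex zero; \<open>g2\<close> provides the rank at 0.\<close>
  define g1 where "g1 a = coeff (minor (card m) r c (entry M a)) 1" for a
  define g2 where "g2 a = coeff (minor (card m0) r0 c0 (entry M a)) 0" for a
  have g1: "polyfun ?X g1" and g2: "polyfun ?X g2"
    unfolding g1_def g2_def by (intro polyfun_coeff cpolyfun_minor cpolyfun_entry)+
  have "\<exists>a. g2 a \<noteq> 0"
    unfolding g2_def using rc0G by (intro minor_entry_matching_nonzero rc0) (auto simp: G_def)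
  moreover have "\<exists>a. g1 a \<noteq> 0"
  proof -
    have "(i0, j0) \<in> (\<lambda>x. (r x, c x)) ` {..<card m}" using m(2) rc(1) by argo
    then obtain x0 where x0: "x0 < card m" "i0 = r x0" "j0 = c x0" by blast
    \<comment> \<open>Ones on the matching, but \<open>s\<close> at \<open>(i0, j0)\<close>: the
      block becomes diagonal with determinant \<open>s\<close>. The parameter in front of
      \<open>s\<close> exists because the degree of that entry is positive.\<close>
    define a :: "nat \<times> nat \<times> nat \<Rightarrow> real"
      where "a = (\<lambda>(i, j, l). if (\<exists>x<card m. i = r x \<and> j = c x \<and> l = (if x = x0 then 1 else 0)) then 1 else 0)"
    have "minor (card m) r c (entry M a) = (\<Prod>x = 0..<card m. if x = x0 then monom 1 1 else 1)"
    proof (rule minor_diagonal)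
      fix x y assume xy: "x < card m" "y < card m"
      have a: "a (r x, c y, l) = (if x = y \<and> l = (if x = x0 then 1 else 0) then 1 else 0)" for l
      proof -
        have "(\<exists>z<card m. r x = r z \<and> c y = c z \<and> l = (if z = x0 then 1 else 0))
          \<longleftrightarrow> x = y \<and> l = (if x = x0 then 1 else 0)" (is "?L \<longleftrightarrow> ?R")
        proof
          assume ?L
          then obtain z where z: "z < card m" "r x = r z" "c y = c z" "l = (if z = x0 then 1 else 0)" by blast
          have "x = z" using inj_onD[OF rc(2) z(2)] xy z(1) by simp
          moreover have "y = z" using inj_onD[OF rc(3) z(3)] xy z(1) by simp
          ultimately show ?R using z(4) by simp
        next
          assume ?R
          then show ?L using xy by blast
        qed
        then show ?thesis by (simp only: a_def prod.case)
      qed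
      have "(\<Sum>l\<le>n. monom (a (r x, c y, l)) l) = (if x = y then if x = x0 then monom 1 1 else 1 else 0)"
        if "x = x0 \<Longrightarrow> 1 \<le> n" for n
      proof -
        have "(\<Sum>l\<le>n. monom (a (r x, c y, l)) l)
          = (\<Sum>l\<le>n. if l = (if x = x0 then 1 else 0) then (if x = y then monom 1 l else 0) else 0)"
          by (intro sum.cong) (auto simp: a)
        also have "\<dots> = (if x = y then if x = x0 then monom 1 1 else 1 else 0)"
          using that by (subst sum.delta) (auto simp: monom_0 pCons_one)
        finally show ?thesis .
      qed
      moreover have "x = x0 \<Longrightarrow> x = y \<Longrightarrow> 1 \<le> degree (M $$ (r x, c y))"
        using deg x0 by simp
      ultimately show "entry M a (r x) (c y) = (if x = y then if x = x0 then monom 1 1 else 1 else 0)"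
        using rcG[OF xy(1)] a by (cases "x = y") (auto simp: entry_def G_def)
    qed
    also have "\<dots> = monom 1 1" using x0(1) by (simp add: prod.delta)
    finally show ?thesis unfolding g1_def by (intro exI[of _ a]) simp
  qed
  ultimately obtain a1 where a1: "g1 a1 \<noteq> 0" "g2 a1 \<noteq> 0"
    using polyfun_nonzero_mult[OF g1 _ g2] by blast
  have "polyfun ?X (\<lambda>a. g1 a * g2 a)" using g1 g2 by (rule polyfun.mult)
  then obtain a where a: "g1 a * g2 a \<noteq> 0" "controllable (structured_mat M a)"
    using holds_genericallyD[OF sc[unfolded structurally_controllable_def], of "\<lambda>a. g1 a * g2 a" a1] a1 by auto
  then obtain k where k: "\<And>z. rk ?p ?v (\<lambda>i j. zeval z (entry M a i j)) = k"
    unfolding controllable_def rank_structured_mat[OF M] by blast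
  have "minor (card m0) r0 c0 (\<lambda>i j. zeval 0 (entry M a i j)) \<noteq> 0"
    unfolding minor_hom[OF comm_ring_hom_zeval] using a(1) by (simp add: g2_def zeval_at_0)
  then have "card m0 \<le> rk ?p ?v (\<lambda>i j. zeval 0 (entry M a i j))"
    using rc0G Gpv by (intro rk_ge_minor[of _ r0 _ c0]) blast+
  moreover
  have "degree (minor (card m) r c (entry M a)) \<noteq> 0"
    using a(1) le_degree[of "minor (card m) r c (entry M a)" 1] by (auto simp: g1_def)
  then have "\<not> constant (poly (map_poly complex_of_real (minor (card m) r c (entry M a))))"
    by (simp add: constant_degree)
  then obtain z where z: "zeval z (minor (card m) r c (entry M a)) = 0"
    using fundamental_theorem_of_algebra unfolding zeval_def by blast
  have "rk ?p ?v (\<lambda>i j. zeval z (entry M a i j)) < card R + card C + card m"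
  proof (rule rk_less_singular_block[OF m(3,4) _ rc(2)])
    show "minor (card m) r c (\<lambda>i j. zeval z (entry M a i j)) = 0"
      unfolding minor_hom[OF comm_ring_hom_zeval] by (rule z)
    fix i j assume "zeval z (entry M a i j) \<noteq> 0"
    then have "(i, j) \<in> G" by (auto simp: entry_def G_def zeval_0 split: if_splits)
    then show "i \<in> R \<or> j \<in> C \<or> (i \<in> r ` {..<card m} \<and> j \<in> c ` {..<card m})"
      using m(6) unfolding fs by blast
  qed
  ultimately show False using m(5) k by simp
qed

section \<open>Breadth-first search for alternating paths\<close>

abbreviation row_of :: "(nat \<times> nat \<times> nat) list \<Rightarrow> nat \<Rightarrow> nat" where "row_of es e \<equiv> fst (es ! e)"
abbreviation col_of :: "(nat \<times> nat \<times> nat) list \<Rightarrow> nat \<Rightarrow> nat" where "col_of es e \<equiv> fst (snd (es ! e))"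
abbreviation weight_of :: "(nat \<times> nat \<times> nat) list \<Rightarrow> nat \<Rightarrow> nat" where "weight_of es e \<equiv> snd (snd (es ! e))"

definition graph_of :: "(nat \<times> nat \<times> nat) list \<Rightarrow> (nat \<times> nat) set" where
  "graph_of es = (\<lambda>e. (row_of es e, col_of es e)) ` {..<length es}"

lemma graph_ofI: "e < length es \<Longrightarrow> (row_of es e, col_of es e) \<in> graph_of es"
  by (auto simp: graph_of_def)

lemma fst_graph_of: "fst ` graph_of es = row_of es ` {..<length es}"
  by (simp add: graph_of_def image_image)

lemma finite_graph_of: "finite (graph_of es)"
  by (simp add: graph_of_def)

text \<open>\<open>prev_edge es i k\<close> is \<open>Suc e\<close> for the last edge \<open>e < k\<close> in row \<open>i\<close>, and \<open>0\<close> if there is none.\<close>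

fun prev_edge :: "(nat \<times> nat \<times> nat) list \<Rightarrow> nat \<Rightarrow> nat \<Rightarrow> nat" where
  "prev_edge es i 0 = 0"
| "prev_edge es i (Suc k) = (if row_of es k = i then Suc k else prev_edge es i k)"

lemma prev_edge_le: "prev_edge es i k \<le> k"
  by (induction k) (auto simp: le_SucI)

lemma row_prev_edge: "0 < prev_edge es i k \<Longrightarrow> row_of es (prev_edge es i k - 1) = i"
  by (induction k) auto

lemma row_after_prev_edge: "prev_edge es i k \<le> e \<Longrightarrow> e < k \<Longrightarrow> row_of es e \<noteq> i"
  by (induction k) (auto simp: less_Suc_eq split: if_splits)

text \<open>Partners are stored shifted by one and 0 means unmatched, so the initial memory already
  represents the empty matching.\<close>

definition mates :: "(nat \<Rightarrow> nat) \<Rightarrow> (nat \<times> nat) set" where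
  "mates mr = {(i, j). mr i = Suc j}"

definition consistent :: "(nat \<times> nat \<times> nat) list \<Rightarrow> (nat \<Rightarrow> nat) \<Rightarrow> (nat \<Rightarrow> nat) \<Rightarrow> bool" where
  "consistent es mr mc \<longleftrightarrow> (\<forall>i j. mr i = Suc j \<longleftrightarrow> mc j = Suc i) \<and> mates mr \<subseteq> graph_of es"

definition matched_rows :: "(nat \<Rightarrow> nat) \<Rightarrow> nat set" where
  "matched_rows mr = {i. mr i \<noteq> 0}"

lemma fst_mates: "fst ` mates mr = matched_rows mr"
  by (force simp: mates_def matched_rows_def gr0_conv_Suc)

lemma in_mates: "(i, j) \<in> mates mr \<longleftrightarrow> mr i = Suc j"
  by (simp add: mates_def)

lemma matching_mates:
  assumes "consistent es mr mc"
  shows "matching (graph_of es) (mates mr)"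
proof -
  have "finite (mates mr)"
    using assms finite_graph_of[of es] by (auto simp: consistent_def intro: finite_subset)
  moreover have "inj_on fst (mates mr)" by (auto simp: inj_on_def mates_def)
  moreover have "inj_on snd (mates mr)"
  proof (rule inj_onI)
    fix x y assume xy: "x \<in> mates mr" "y \<in> mates mr" "snd x = snd y"
    then have "mc (snd x) = Suc (fst x)" "mc (snd x) = Suc (fst y)"
      using assms by (auto simp: consistent_def mates_def)
    then show "x = y" using xy(3) by (simp add: prod_eq_iff)
  qed
  ultimately show ?thesis using assms by (simp add: matching_def consistent_def)
qed

lemma snd_mates: "consistent es mr mc \<Longrightarrow> j \<in> snd ` mates mr \<longleftrightarrow> mc j \<noteq> 0"
  by (force simp: consistent_def mates_def gr0_conv_Suc)

lemma finite_matched_rows: "consistent es mr mc \<Longrightarrow> finite (matched_rows mr)"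
  using matching_mates[of es mr mc] fst_mates[of mr] by (metis finite_imageI matching_def)

lemma matched_rows_subset: "consistent es mr mc \<Longrightarrow> matched_rows mr \<subseteq> fst ` graph_of es"
  unfolding fst_mates[symmetric] consistent_def by blast

lemma card_rows_le: "card (fst ` graph_of es) \<le> length es"
  unfolding fst_graph_of by (metis card_image_le card_lessThan finite_lessThan)

lemma card_matched_rows_le: "consistent es mr mc \<Longrightarrow> card (matched_rows mr) \<le> length es"
  using card_mono[OF _ matched_rows_subset] card_rows_le finite_graph_of by (metis finite_imageI order.trans)

text \<open>Augmentation overwrites one matched edge at a time, from the uncovered column \<open>fj\<close> backwards. In between,
  the entry of \<open>mc\<close> at the column to be covered next is stale.\<close>

lemma augment_last:
  assumes c: "consistent es mr (mc(fj := 0))" and i: "mr i = 0" and G: "(i, fj) \<in> graph_of es"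
  shows "consistent es (mr(i := Suc fj)) (mc(fj := Suc i))"
    and "card (matched_rows (mr(i := Suc fj))) = Suc (card (matched_rows mr))"
proof -
  have eq: "mr i' = Suc j \<longleftrightarrow> (mc(fj := 0)) j = Suc i'" for i' j
    using c by (simp add: consistent_def)
  have 1: "mr i' \<noteq> Suc fj" for i' unfolding eq by simp
  have 2: "mc j \<noteq> Suc i" if "j \<noteq> fj" for j
  proof
    assume "mc j = Suc i"
    then have "mr i = Suc j" unfolding eq using that by simp
    then show False using i by simp
  qed
  have "(mr(i := Suc fj)) i' = Suc j \<longleftrightarrow> (mc(fj := Suc i)) j = Suc i'" for i' j
    using eq[of i' j] 1[of i'] 2[of j] by (cases "i' = i"; cases "j = fj") auto
  moreover have "mates (mr(i := Suc fj)) \<subseteq> insert (i, fj) (mates mr)"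
    by (auto simp: mates_def split: if_splits)
  ultimately show "consistent es (mr(i := Suc fj)) (mc(fj := Suc i))"
    using c G unfolding consistent_def by blast
  have "matched_rows (mr(i := Suc fj)) = insert i (matched_rows mr)" "i \<notin> matched_rows mr"
    using i by (auto simp: matched_rows_def)
  then show "card (matched_rows (mr(i := Suc fj))) = Suc (card (matched_rows mr))"
    using finite_matched_rows[OF c] by simp
qed

lemma augment_step:
  assumes c: "consistent es mr (mc(fj := 0))" and i: "mr i = Suc j'" and G: "(i, fj) \<in> graph_of es"
  shows "consistent es (mr(i := Suc fj)) (mc(fj := Suc i, j' := 0))"
    and "matched_rows (mr(i := Suc fj)) = matched_rows mr"
proof -
  have eq: "mr i' = Suc j \<longleftrightarrow> (mc(fj := 0)) j = Suc i'" for i' j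
    using c by (simp add: consistent_def)
  have 1: "mr i' \<noteq> Suc fj" for i' using eq[of i' fj] by simp
  have ne: "j' \<noteq> fj" using 1[of i] i by auto
  have 2: "j = j'" if "j \<noteq> fj" "mc j = Suc i" for j using eq[of i j] i that by simp
  have 3: "i' = i" if "mr i' = Suc j'" for i' using eq[of i' j'] eq[of i j'] that i ne by simp
  have "(mr(i := Suc fj)) i' = Suc j \<longleftrightarrow> (mc(fj := Suc i, j' := 0)) j = Suc i'" for i' j
  proof (cases "i' = i")
    case True
    have "mc j \<noteq> Suc i" if "j \<noteq> fj" "j \<noteq> j'" using 2 that by blast
    then show ?thesis using ne by (simp add: True)
  next
    case False
    then have "mr i' \<noteq> Suc j'" using 3 by blast
    with False show ?thesis using ne eq[of i' j] 1[of i'] by (cases "j = fj"; cases "j = j'") simp_all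
  qed
  moreover have "mates (mr(i := Suc fj)) \<subseteq> insert (i, fj) (mates mr)"
    by (auto simp: mates_def split: if_splits)
  ultimately show "consistent es (mr(i := Suc fj)) (mc(fj := Suc i, j' := 0))"
    using c G unfolding consistent_def by blast
  show "matched_rows (mr(i := Suc fj)) = matched_rows mr"
    using i by (auto simp: matched_rows_def)
qed

text \<open>\<open>queued\<close>: the queue \<open>q\<close> of length \<open>qt\<close> lists the rows stamped \<open>st\<close>. \<open>linked\<close>: a queued row outside
  the initial set \<open>I\<close> was discovered through the row at the smaller position \<open>fq k\<close>.\<close>

definition queued :: "(nat \<Rightarrow> nat) \<Rightarrow> nat \<Rightarrow> (nat \<Rightarrow> nat) \<Rightarrow> nat \<Rightarrow> bool" where
  "queued q qt seen st \<longleftrightarrow> inj_on q {..<qt} \<and> q ` {..<qt} = {r. seen r = st} \<and> (\<forall>r. seen r \<le> st)"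

definition linked :: "(nat \<times> nat \<times> nat) list \<Rightarrow> (nat \<Rightarrow> nat) \<Rightarrow> nat set \<Rightarrow> (nat \<Rightarrow> nat) \<Rightarrow> (nat \<Rightarrow> nat) \<Rightarrow> nat \<Rightarrow> bool" where
  "linked es mr I q fq qt \<longleftrightarrow> (\<forall>k<qt. q k \<in> I \<or>
     (fq k < k \<and> (\<exists>j. (q (fq k), j) \<in> graph_of es \<and> mr (q k) = Suc j)))"

text \<open>The edges of a row are traversed from the last to the first, and \<open>cur\<close> is
  one more than the edge to be treated next. All edges of earlier popped rows are done, and in the
  row popped last those from \<open>cur\<close> on.\<close>

definition scanned :: "(nat \<times> nat \<times> nat) list \<Rightarrow> (nat \<Rightarrow> nat) \<Rightarrow> nat \<Rightarrow> nat \<Rightarrow> nat set" where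
  "scanned es q qh cur = {e. e < length es \<and> (\<exists>k<qh. q k = row_of es e \<and> (Suc k < qh \<or> cur \<le> e))}"

text \<open>The complete search invariant. Once a free column is found, the condition on scanned
  edges is dropped, because the edge leading to that column has no matched partner; what is kept is
  the adjacency of the row popped last to \<open>fj\<close>.\<close>

definition searching :: "(nat \<times> nat \<times> nat) list \<Rightarrow> (nat \<Rightarrow> nat) \<Rightarrow> (nat \<Rightarrow> nat) \<Rightarrow> nat set \<Rightarrow>
    (nat \<Rightarrow> nat) \<Rightarrow> nat \<Rightarrow> (nat \<Rightarrow> nat) \<Rightarrow> (nat \<Rightarrow> nat) \<Rightarrow> nat \<Rightarrow> nat \<Rightarrow> nat \<Rightarrow> nat \<Rightarrow> nat \<Rightarrow> bool" where
  "searching es mr mc I seen st q fq qh qt cur found fj \<longleftrightarrow>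
     consistent es mr mc \<and> queued q qt seen st \<and> linked es mr I q fq qt \<and>
     I \<subseteq> q ` {..<qt} \<and> q ` {..<qt} \<subseteq> fst ` graph_of es \<and> qh \<le> qt \<and>
     (0 < cur \<longrightarrow> cur \<le> length es \<and> 0 < qh \<and> row_of es (cur - 1) = q (qh - 1)) \<and>
     (found = 0 \<longrightarrow> (\<forall>e\<in>scanned es q qh cur. \<exists>r. mc (col_of es e) = Suc r \<and> seen r = st)) \<and>
     (0 < found \<longrightarrow> 0 < qh \<and> (q (qh - 1), fj) \<in> graph_of es \<and> mc fj = 0)"

definition unscanned :: "(nat \<times> nat \<times> nat) list \<Rightarrow> (nat \<Rightarrow> nat) \<Rightarrow> nat \<Rightarrow> nat \<Rightarrow> nat" where
  "unscanned es q qh cur = length es - card (scanned es q qh cur)"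

lemma finite_scanned: "finite (scanned es q qh cur)"
  by (simp add: scanned_def)

lemma card_scanned_le: "card (scanned es q qh cur) \<le> length es"
proof -
  have "scanned es q qh cur \<subseteq> {..<length es}" by (auto simp: scanned_def)
  then show ?thesis using card_mono[of "{..<length es}"] by fastforce
qed

text \<open>No edge of the row lies strictly between \<open>cur - 1\<close> and its predecessor, so
  exactly one edge is added. It is new, because an injective queue cannot have popped the row
  before.\<close>

lemma scanned_scan:
  assumes cur: "0 < cur" "cur \<le> length es" "0 < qh" "row_of es (cur - 1) = q (qh - 1)"
    and inj: "inj_on q {..<qh}"
  shows "scanned es q qh (prev_edge es (row_of es (cur - 1)) (cur - 1)) = insert (cur - 1) (scanned es q qh cur)"
    and "cur - 1 \<notin> scanned es q qh cur"
proof -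
  let ?p = "prev_edge es (row_of es (cur - 1)) (cur - 1)"
  have p: "?p \<le> cur - 1" by (rule prev_edge_le)
  show "scanned es q qh ?p = insert (cur - 1) (scanned es q qh cur)"
  proof (intro equalityI subsetI)
    fix e assume "e \<in> scanned es q qh ?p"
    then obtain k where k: "e < length es" "k < qh" "q k = row_of es e" "Suc k < qh \<or> ?p \<le> e"
      by (auto simp: scanned_def)
    show "e \<in> insert (cur - 1) (scanned es q qh cur)"
    proof (cases "Suc k < qh \<or> cur - 1 \<le> e")
      case True
      then have "Suc k < qh \<or> e = cur - 1 \<or> cur \<le> e" by linarith
      then show ?thesis using k by (auto simp: scanned_def)
    next
      case False
      then have "row_of es e \<noteq> row_of es (cur - 1)"
        using k(4) row_after_prev_edge[of es "row_of es (cur - 1)" "cur - 1" e] by simp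
      moreover have "k = qh - 1" using False k(2) by linarith
      ultimately show ?thesis using k(3) cur(4) by simp
    qed
  next
    fix e assume "e \<in> insert (cur - 1) (scanned es q qh cur)"
    then show "e \<in> scanned es q qh ?p"
    proof
      assume "e = cur - 1"
      then have "e < length es \<and> qh - 1 < qh \<and> q (qh - 1) = row_of es e \<and> (Suc (qh - 1) < qh \<or> ?p \<le> e)"
        using cur p by simp
      then show ?thesis unfolding scanned_def by blast
    next
      assume "e \<in> scanned es q qh cur"
      then show ?thesis using p cur(1) by (fastforce simp: scanned_def)
    qed
  qed
  show "cur - 1 \<notin> scanned es q qh cur"
  proof
    assume "cur - 1 \<in> scanned es q qh cur"
    then obtain k where "k < qh" "q k = q (qh - 1)" "Suc k < qh"
      using cur by (auto simp: scanned_def)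
    then show False using inj_onD[OF inj, of k "qh - 1"] by simp
  qed
qed

lemma unscanned_scan:
  assumes "0 < cur" "cur \<le> length es" "0 < qh" "row_of es (cur - 1) = q (qh - 1)" "inj_on q {..<qh}"
  shows "Suc (unscanned es q qh (prev_edge es (row_of es (cur - 1)) (cur - 1))) = unscanned es q qh cur"
proof -
  let ?p = "prev_edge es (row_of es (cur - 1)) (cur - 1)"
  have "card (scanned es q qh ?p) = Suc (card (scanned es q qh cur))"
    unfolding scanned_scan(1)[OF assms] using finite_scanned scanned_scan(2)[OF assms] by (rule card_insert_disjoint)
  then show ?thesis
    using card_scanned_le[of es q qh ?p] unfolding unscanned_def by linarith
qed

text \<open>A freshly popped row starts at its last edge, so none of its edges counts as scanned
  yet.\<close>

lemma scanned_pop: "scanned es q (Suc qh) (prev_edge es (q qh) (length es)) = scanned es q qh 0"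
proof (intro equalityI subsetI)
  fix e assume "e \<in> scanned es q (Suc qh) (prev_edge es (q qh) (length es))"
  then obtain k where k: "e < length es" "k < Suc qh" "q k = row_of es e"
    "Suc k < Suc qh \<or> prev_edge es (q qh) (length es) \<le> e"
    by (auto simp: scanned_def)
  have "k < qh"
  proof (rule ccontr)
    assume "\<not> k < qh"
    then have "k = qh" using k(2) by simp
    then show False using row_after_prev_edge[of es "q qh" "length es" e] k by simp
  qed
  then show "e \<in> scanned es q qh 0" using k by (auto simp: scanned_def)
next
  fix e assume "e \<in> scanned es q qh 0"
  then obtain k where "e < length es" "k < qh" "q k = row_of es e" by (auto simp: scanned_def)
  then show "e \<in> scanned es q (Suc qh) (prev_edge es (q qh) (length es))"
    unfolding scanned_def by (intro CollectI conjI exI[of _ k]) auto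
qed

lemma scanned_cong: "(\<And>k. k < qh \<Longrightarrow> q k = q' k) \<Longrightarrow> scanned es q qh cur = scanned es q' qh cur"
  by (auto simp: scanned_def)

lemma queued_inj: "queued q qt seen st \<Longrightarrow> qh \<le> qt \<Longrightarrow> inj_on q {..<qh}"
  by (auto simp: queued_def intro: inj_on_subset)

lemma searching_cur:
  assumes "searching es mr mc I seen st q fq qh qt cur found fj" "0 < cur"
  shows "cur \<le> length es" "0 < qh" "row_of es (cur - 1) = q (qh - 1)" "inj_on q {..<qh}"
  using assms queued_inj[of q qt seen st qh] by (simp_all add: searching_def)

lemma next_cur:
  assumes "searching es mr mc I seen st q fq qh qt cur found fj" "0 < cur"
    and p: "0 < prev_edge es (row_of es (cur - 1)) (cur - 1)"
  shows "prev_edge es (row_of es (cur - 1)) (cur - 1) \<le> length es"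
    "row_of es (prev_edge es (row_of es (cur - 1)) (cur - 1) - 1) = q (qh - 1)"
proof -
  show "prev_edge es (row_of es (cur - 1)) (cur - 1) \<le> length es"
    using searching_cur(1)[OF assms(1,2)] prev_edge_le[of es "row_of es (cur - 1)" "cur - 1"] by linarith
  show "row_of es (prev_edge es (row_of es (cur - 1)) (cur - 1) - 1) = q (qh - 1)"
    unfolding row_prev_edge[OF p] by (rule searching_cur(3)[OF assms(1,2)])
qed

lemma searching_scan_seen:
  assumes s: "searching es mr mc I seen st q fq qh qt cur 0 fj" and cur: "0 < cur"
    and r: "mc (col_of es (cur - 1)) = Suc r" "seen r = st"
  shows "searching es mr mc I seen st q fq qh qt (prev_edge es (row_of es (cur - 1)) (cur - 1)) 0 fj"
  using s r next_cur[OF s cur] searching_cur(2)[OF s cur] scanned_scan(1)[OF cur searching_cur[OF s cur]]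
  by (simp add: searching_def)

lemma queued_push:
  assumes "queued q qt seen st" "seen r \<noteq> st"
  shows "queued (q(qt := r)) (Suc qt) (seen(r := st)) st"
proof -
  have "(q(qt := r)) ` {..<Suc qt} = insert r (q ` {..<qt})"
    by (auto simp: lessThan_Suc)
  moreover have "inj_on (q(qt := r)) {..<Suc qt}"
  proof -
    have "inj_on (q(qt := r)) {..<qt}" using assms(1) by (auto simp: queued_def inj_on_def)
    moreover have "r \<notin> (q(qt := r)) ` ({..<qt} - {qt})" using assms by (auto simp: queued_def)
    ultimately show ?thesis by (simp add: lessThan_Suc inj_on_insert)
  qed
  ultimately show ?thesis using assms by (auto simp: queued_def)
qed

lemma searching_scan_new:
  assumes s: "searching es mr mc I seen st q fq qh qt cur 0 fj" and cur: "0 < cur"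
    and r: "mc (col_of es (cur - 1)) = Suc r" "seen r \<noteq> st"
  shows "searching es mr mc I (seen(r := st)) st (q(qt := r)) (fq(qt := qh - 1)) qh (Suc qt)
    (prev_edge es (row_of es (cur - 1)) (cur - 1)) 0 fj"
proof -
  let ?p = "prev_edge es (row_of es (cur - 1)) (cur - 1)" and ?e = "cur - 1"
  note c = searching_cur[OF s cur]
  have s': "consistent es mr mc" "queued q qt seen st" "linked es mr I q fq qt" "I \<subseteq> q ` {..<qt}"
    "q ` {..<qt} \<subseteq> fst ` graph_of es" "qh \<le> qt"
    "\<forall>e\<in>scanned es q qh cur. \<exists>r. mc (col_of es e) = Suc r \<and> seen r = st"
    using s by (simp_all add: searching_def)
  have mr: "mr r = Suc (col_of es ?e)" using r(1) s'(1) by (simp add: consistent_def)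
  have rG: "r \<in> fst ` graph_of es"
    using matched_rows_subset[OF s'(1)] mr by (auto simp: matched_rows_def)
  have eG: "(q (qh - 1), col_of es ?e) \<in> graph_of es"
    using graph_ofI[of ?e es] c cur by simp
  have img: "(q(qt := r)) ` {..<Suc qt} = insert r (q ` {..<qt})" by (auto simp: lessThan_Suc)
  have "linked es mr I (q(qt := r)) (fq(qt := qh - 1)) (Suc qt)"
    using s'(3,6) eG mr c(2) unfolding linked_def by (auto simp: less_Suc_eq)
  moreover have "scanned es (q(qt := r)) qh ?p = insert ?e (scanned es q qh cur)"
    using scanned_scan(1)[OF cur c] scanned_cong[of qh "q(qt := r)" q es ?p] s'(6) by simp
  moreover have "(q(qt := r)) (qh - 1) = q (qh - 1)"
  proof -
    have "qh - 1 \<noteq> qt" using c(2) s'(6) by linarith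
    then show ?thesis by simp
  qed
  moreover have "\<forall>e\<in>insert ?e (scanned es q qh cur). \<exists>r'. mc (col_of es e) = Suc r' \<and> (seen(r := st)) r' = st"
    using s'(7) r(1) by auto
  moreover have "I \<subseteq> (q(qt := r)) ` {..<Suc qt}" "(q(qt := r)) ` {..<Suc qt} \<subseteq> fst ` graph_of es"
    unfolding img using s'(4,5) rG by blast+
  ultimately show ?thesis
    using s'(1,6) c(2) next_cur[OF s cur] queued_push[OF s'(2) r(2)] unfolding searching_def
    by (simp only: order.refl le_SucI less_numeral_extra simp_thms) blast
qed

lemma searching_found:
  assumes s: "searching es mr mc I seen st q fq qh qt cur 0 fj" and cur: "0 < cur"
    and r: "mc (col_of es (cur - 1)) = 0"
  shows "searching es mr mc I seen st q fq qh qt (prev_edge es (row_of es (cur - 1)) (cur - 1)) 1 (col_of es (cur - 1))"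
  using s r next_cur[OF s cur] searching_cur[OF s cur] graph_ofI[of "cur - 1" es] cur
  by (simp add: searching_def)

lemma searching_pop:
  assumes s: "searching es mr mc I seen st q fq qh qt 0 0 fj" and "qh < qt"
  shows "searching es mr mc I seen st q fq (Suc qh) qt (prev_edge es (q qh) (length es)) 0 fj"
  using assms prev_edge_le[of es "q qh" "length es"] row_prev_edge[of es "q qh" "length es"]
    scanned_pop[of es q qh]
  by (simp add: searching_def)

lemma searching_qt_le:
  assumes "searching es mr mc I seen st q fq qh qt cur found fj"
  shows "qh \<le> qt" "qt \<le> length es"
proof -
  have q: "queued q qt seen st" "q ` {..<qt} \<subseteq> fst ` graph_of es" "qh \<le> qt"
    using assms by (simp_all add: searching_def)
  show "qh \<le> qt" by (rule q(3))
  have "qt = card (q ` {..<qt})" using card_image[OF queued_inj[OF q(1) order.refl]] by simp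
  also have "\<dots> \<le> card (fst ` graph_of es)" using q(2) finite_graph_of by (intro card_mono) auto
  also have "\<dots> \<le> length es" by (rule card_rows_le)
  finally show "qt \<le> length es" .
qed

lemma searching_init:
  assumes "consistent es mr mc" "queued q qt seen st" "q ` {..<qt} \<subseteq> fst ` graph_of es"
  shows "searching es mr mc (q ` {..<qt}) seen st q fq 0 qt 0 0 fj"
  using assms by (auto simp: searching_def linked_def scanned_def)

text \<open>Positions decrease along \<open>fq\<close>, so the chain of predecessors ends in
  \<open>I\<close>, and each link is one alternating step.\<close>

lemma searching_reachable:
  assumes s: "searching es mr mc I seen st q fq qh qt cur found fj" and "k < qt"
  shows "\<exists>i\<in>I. (i, q k) \<in> (alt_step (graph_of es) (mates mr))\<^sup>*"
  using \<open>k < qt\<close>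
proof (induction k rule: less_induct)
  case (less k)
  show ?case
  proof (cases "q k \<in> I")
    case False
    then obtain j where j: "fq k < k" "(q (fq k), j) \<in> graph_of es" "mr (q k) = Suc j"
      using s less.prems unfolding searching_def linked_def by blast
    then have "(q (fq k), q k) \<in> alt_step (graph_of es) (mates mr)"
      unfolding alt_step_def in_mates by blast
    moreover obtain i where "i \<in> I" "(i, q (fq k)) \<in> (alt_step (graph_of es) (mates mr))\<^sup>*"
      using less.IH[OF j(1)] j(1) less.prems by auto
    ultimately show ?thesis by (meson rtrancl.rtrancl_into_rtrancl)
  qed blast
qed

lemma searching_seen: "searching es mr mc I seen st q fq qh qt cur found fj \<Longrightarrow> {r. seen r = st} = q ` {..<qt}"
  by (simp add: searching_def queued_def)

text \<open>With \<open>qh = qt\<close> and \<open>cur = 0\<close> all edges of all queued rows have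
  been scanned, so their columns are matched to stamped rows.\<close>

lemma searching_done_closed:
  assumes s: "searching es mr mc I seen st q fq qt qt 0 0 fj"
  shows "closed_rows (graph_of es) (mates mr) {r. seen r = st}"
  unfolding closed_rows_def
proof (intro ballI allI impI)
  fix i j assume i: "i \<in> {r. seen r = st}" and ij: "(i, j) \<in> graph_of es"
  obtain k where k: "k < qt" "i = q k" using i searching_seen[OF s] by auto
  obtain e where e: "e < length es" "i = row_of es e" "j = col_of es e"
    using ij by (auto simp: graph_of_def)
  have "e \<in> scanned es q qt 0" using k e by (auto simp: scanned_def)
  then obtain r where r: "mc j = Suc r" "seen r = st"
    using s e(3) unfolding searching_def by blast
  have "mr r = Suc j" using s r(1) by (simp add: searching_def consistent_def)
  then show "\<exists>i'\<in>{r. seen r = st}. (i', j) \<in> mates mr" using r(2) by (auto simp: in_mates)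
qed

section \<open>The program and its running time\<close>

text \<open>Total correctness with time credits: \<open>n\<close> credits are available before the execution, and the
  postcondition sees the credits that are left.\<close>

definition wp :: "com \<Rightarrow> (state \<Rightarrow> nat \<Rightarrow> bool) \<Rightarrow> state \<Rightarrow> nat \<Rightarrow> bool" where
  "wp c Q s n \<longleftrightarrow> (\<exists>t s'. exec c s t s' \<and> t \<le> n \<and> Q s' (n - t))"

inductive_cases exec_SkipE: "exec Skip s t s'"
inductive_cases exec_WriteE: "exec (Write x e1 e2) s t s'"
inductive_cases exec_SeqE: "exec (Seq c1 c2) s t s'"
inductive_cases exec_IfE: "exec (If b c1 c2) s t s'"

lemma exec_Skip_iff: "exec Skip s t s' \<longleftrightarrow> t = 1 \<and> s' = s"
  by (metis exec.Skip exec_SkipE)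

lemma exec_Write_iff: "exec (Write x e1 e2) s t s' \<longleftrightarrow>
    t = 1 + acost e1 + acost e2 \<and> s' = s(x := (s x)(aval e1 s := aval e2 s))"
  by (metis exec.Write exec_WriteE)

lemma wp_Skip: "wp Skip Q s n \<longleftrightarrow> 1 \<le> n \<and> Q s (n - 1)"
  by (simp add: wp_def exec_Skip_iff)

lemma wp_Write: "wp (Write x e1 e2) Q s n \<longleftrightarrow>
    1 + acost e1 + acost e2 \<le> n \<and>
    Q (s(x := (s x)(aval e1 s := aval e2 s))) (n - (1 + acost e1 + acost e2))"
  by (simp add: wp_def exec_Write_iff)

lemma wp_Seq: "wp (Seq c1 c2) Q s n \<longleftrightarrow> wp c1 (wp c2 Q) s n"
proof
  assume "wp (Seq c1 c2) Q s n"
  then obtain t s' where t: "exec (Seq c1 c2) s t s'" "t \<le> n" "Q s' (n - t)" by (auto simp: wp_def)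
  from t(1) obtain t1 t2 s1 where "t = t1 + t2" "exec c1 s t1 s1" "exec c2 s1 t2 s'"
    by (rule exec_SeqE)
  then have "exec c1 s t1 s1 \<and> t1 \<le> n \<and> (exec c2 s1 t2 s' \<and> t2 \<le> n - t1 \<and> Q s' (n - t1 - t2))"
    using t(2,3) by auto
  then show "wp c1 (wp c2 Q) s n" unfolding wp_def by blast
next
  assume "wp c1 (wp c2 Q) s n"
  then obtain t1 s1 t2 s2 where *: "exec c1 s t1 s1" "t1 \<le> n" "exec c2 s1 t2 s2" "t2 \<le> n - t1" "Q s2 (n - t1 - t2)"
    unfolding wp_def by blast
  then have "exec (Seq c1 c2) s (t1 + t2) s2 \<and> t1 + t2 \<le> n \<and> Q s2 (n - (t1 + t2))"
    by (auto intro: exec.Seq)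
  then show "wp (Seq c1 c2) Q s n" unfolding wp_def by blast
qed

lemma wp_Seq_fun: "wp (Seq c1 c2) Q = wp c1 (wp c2 Q)"
  by (intro ext) (rule wp_Seq)

lemma split_credits: "a + b \<le> n \<Longrightarrow> \<exists>m. n = m + a \<and> b \<le> (m :: nat)"
  by (rule exI[of _ "n - a"]) simp

lemma wp_If: "wp (If b c1 c2) Q s n \<longleftrightarrow>
    1 + bcost b \<le> n \<and> wp (if bval b s then c1 else c2) Q s (n - (1 + bcost b))"
proof
  assume "wp (If b c1 c2) Q s n"
  then obtain t s' where t: "exec (If b c1 c2) s t s'" "t \<le> n" "Q s' (n - t)" by (auto simp: wp_def)
  from t(1) obtain t' where "t = 1 + bcost b + t'" "exec (if bval b s then c1 else c2) s t' s'"
    by (rule exec_IfE) auto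
  then have "1 + bcost b \<le> n \<and> exec (if bval b s then c1 else c2) s t' s' \<and> t' \<le> n - (1 + bcost b)
      \<and> Q s' (n - (1 + bcost b) - t')"
    using t(2,3) by (auto simp: diff_diff_left)
  then show "1 + bcost b \<le> n \<and> wp (if bval b s then c1 else c2) Q s (n - (1 + bcost b))"
    unfolding wp_def by blast
next
  assume *: "1 + bcost b \<le> n \<and> wp (if bval b s then c1 else c2) Q s (n - (1 + bcost b))"
  then obtain t' s' where t: "exec (if bval b s then c1 else c2) s t' s'" "t' \<le> n - (1 + bcost b)"
    "Q s' (n - (1 + bcost b) - t')" by (auto simp: wp_def)
  have "exec (If b c1 c2) s (1 + bcost b + t') s'"
    using t(1) exec.IfTrue[of b s c1 t' s' c2] exec.IfFalse[of b s c2 t' s' c1] by (cases "bval b s") simp_all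
  moreover have "1 + bcost b + t' \<le> n" "Q s' (n - (1 + bcost b + t'))"
    using * t(2,3) by (auto simp: diff_diff_left)
  ultimately show "wp (If b c1 c2) Q s n" unfolding wp_def by blast
qed

text \<open>No variant is needed, because every iteration consumes credits.\<close>

lemma wp_While:
  assumes "I s n"
    and step: "\<And>s n. I s n \<Longrightarrow> bval b s \<Longrightarrow> 1 + bcost b \<le> n \<and> wp c I s (n - (1 + bcost b))"
    and exit: "\<And>s n. I s n \<Longrightarrow> \<not> bval b s \<Longrightarrow> 1 + bcost b \<le> n \<and> Q s (n - (1 + bcost b))"
  shows "wp (While b c) Q s n"
  using assms(1)
proof (induction n arbitrary: s rule: less_induct)
  case (less n)
  show ?case
  proof (cases "bval b s")
    case False
    then have "exec (While b c) s (1 + bcost b) s" by (rule exec.WhileFalse)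
    then show ?thesis using exit[OF less.prems False] unfolding wp_def by blast
  next
    case True
    obtain t1 s1 where t1: "1 + bcost b \<le> n" "exec c s t1 s1" "t1 \<le> n - (1 + bcost b)"
      "I s1 (n - (1 + bcost b) - t1)"
      using step[OF less.prems True] unfolding wp_def by blast
    then have "n - (1 + bcost b) - t1 < n" by linarith
    from less.IH[OF this t1(4)] obtain t2 s2 where t2: "exec (While b c) s1 t2 s2"
      "t2 \<le> n - (1 + bcost b) - t1" "Q s2 (n - (1 + bcost b) - t1 - t2)"
      unfolding wp_def by blast
    have "exec (While b c) s (1 + bcost b + t1 + t2) s2"
      using True t1(2) t2(1) by (rule exec.WhileTrue)
    moreover have "1 + bcost b + t1 + t2 \<le> n" using t1 t2 by linarith
    moreover have "n - (1 + bcost b) - t1 - t2 = n - (1 + bcost b + t1 + t2)" by linarith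
    ultimately show ?thesis using t2(3) unfolding wp_def by metis
  qed
qed

lemma wp_mono: "wp c Q s n \<Longrightarrow> (\<And>s' n'. Q s' n' \<Longrightarrow> Q' s' n') \<Longrightarrow> wp c Q' s n"
  unfolding wp_def by blast

lemmas wp_simps = wp_Skip wp_Write wp_Seq wp_If

abbreviation Var :: "name \<Rightarrow> aexp" where "Var x \<equiv> Read x (Const 0)"
abbreviation Assign :: "name \<Rightarrow> aexp \<Rightarrow> com" where "Assign x e \<equiv> Write x (Const 0) e"

definition frame :: "name set \<Rightarrow> state \<Rightarrow> state \<Rightarrow> bool" where
  "frame X s s' \<longleftrightarrow> (\<forall>x. x \<notin> X \<longrightarrow> s' x = s x)"

lemma frame_refl: "frame X s s"
  by (simp add: frame_def)

lemma frame_upd: "frame X s s' \<Longrightarrow> x \<in> X \<Longrightarrow> frame X s (s'(x := v))"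
  by (auto simp: frame_def)

lemma frame_trans: "frame X s s' \<Longrightarrow> frame Y s' s'' \<Longrightarrow> X \<subseteq> Z \<Longrightarrow> Y \<subseteq> Z \<Longrightarrow> frame Z s s''"
  unfolding frame_def by (metis subsetD)

definition for_edges :: "name \<Rightarrow> com \<Rightarrow> com" where
  "for_edges x c = Seq (Assign x (Const 0))
     (While (Less (Var x) (Var ''edges'')) (Seq c (Assign x (Plus (Var x) (Const 1)))))"

text \<open>\<open>C\<close> pays for one run of the body, 20 for the test and the increment, and
  \<open>K\<close> is left for what follows. The body re-establishes \<open>J\<close> for the state
  after the increment.\<close>

lemma wp_for_edges:
  assumes x: "x \<noteq> ''edges''"
    and init: "J 0 (s(x := (s x)(0 := 0)))"
    and edges: "\<And>k s. J k s \<Longrightarrow> s ''edges'' 0 = E"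
    and body: "\<And>k s n. k < E \<Longrightarrow> J k s \<Longrightarrow> s x 0 = k \<Longrightarrow> C \<le> n \<Longrightarrow>
      wp c (\<lambda>s' n'. s' x 0 = k \<and> J (Suc k) (s'(x := (s' x)(0 := Suc k))) \<and> n \<le> n' + C) s n"
    and n: "(C + 20) * E + 20 + K \<le> n"
    and fin: "\<And>s n. J E s \<Longrightarrow> K \<le> n \<Longrightarrow> Q s n"
  shows "wp (for_edges x c) Q s n"
  unfolding for_edges_def wp_Seq wp_Write
proof (intro conjI)
  show "1 + acost (Const 0) + acost (Const 0) \<le> n" using n by simp
  let ?s = "s(x := (s x)(aval (Const 0) s := aval (Const 0) s))"
  show "wp (While (Less (Var x) (Var ''edges'')) (Seq c (Assign x (Plus (Var x) (Const 1))))) Q ?s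
     (n - (1 + acost (Const 0) + acost (Const 0)))"
  proof (rule wp_While[where I = "\<lambda>s n. \<exists>k\<le>E. s x 0 = k \<and> J k s \<and> (C + 20) * (E - k) + 10 + K \<le> n"])
    show "\<exists>k\<le>E. ?s x 0 = k \<and> J k ?s \<and> (C + 20) * (E - k) + 10 + K \<le> n - (1 + acost (Const 0) + acost (Const 0))"
      using init n by (intro exI[of _ 0]) simp
  next
    fix s n
    assume "\<exists>k\<le>E. s x 0 = k \<and> J k s \<and> (C + 20) * (E - k) + 10 + K \<le> n" and "bval (Less (Var x) (Var ''edges'')) s"
    then obtain k where k: "k < E" "s x 0 = k" "J k s" "(C + 20) * (E - k) + 10 + K \<le> n"
      using edges by auto
    have "E - k = Suc (E - Suc k)" using k(1) by simp
    then have n: "(C + 20) * (E - Suc k) + (C + 20) + 10 + K \<le> n" using k(4) by simp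
    have "wp c (wp (Assign x (Plus (Var x) (Const 1)))
       (\<lambda>s n. \<exists>k\<le>E. s x 0 = k \<and> J k s \<and> (C + 20) * (E - k) + 10 + K \<le> n)) s (n - 6)"
    proof (rule wp_mono[OF body[OF k(1,3,2)]])
      show "C \<le> n - 6" using n by simp
      fix s' n' assume s': "s' x 0 = k \<and> J (Suc k) (s'(x := (s' x)(0 := Suc k))) \<and> n - 6 \<le> n' + C"
      show "wp (Assign x (Plus (Var x) (Const 1)))
       (\<lambda>s n. \<exists>k\<le>E. s x 0 = k \<and> J k s \<and> (C + 20) * (E - k) + 10 + K \<le> n) s' n'"
        unfolding wp_Write using s' k(1) n by (auto intro!: exI[of _ "Suc k"])
    qed
    then show "1 + bcost (Less (Var x) (Var ''edges'')) \<le> n \<and>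
      wp (Seq c (Assign x (Plus (Var x) (Const 1)))) (\<lambda>s n. \<exists>k\<le>E. s x 0 = k \<and> J k s \<and> (C + 20) * (E - k) + 10 + K \<le> n)
       s (n - (1 + bcost (Less (Var x) (Var ''edges''))))"
      using n by (simp add: wp_Seq del: One_nat_def)
  next
    fix s n
    assume "\<exists>k\<le>E. s x 0 = k \<and> J k s \<and> (C + 20) * (E - k) + 10 + K \<le> n" and "\<not> bval (Less (Var x) (Var ''edges'')) s"
    then have "J E s" "10 + K \<le> n" using edges by auto
    then show "1 + bcost (Less (Var x) (Var ''edges'')) \<le> n \<and> Q s (n - (1 + bcost (Less (Var x) (Var ''edges''))))"
      using fin by simp
  qed
qed

section \<open>Adjacency lists in memory\<close>

definition input :: "(nat \<times> nat \<times> nat) list \<Rightarrow> state \<Rightarrow> bool" where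
  "input es s \<longleftrightarrow> s ''edges'' 0 = length es \<and>
     (\<forall>e<length es. s ''row'' e = row_of es e \<and> s ''column'' e = col_of es e)"

definition adjacency :: "(nat \<times> nat \<times> nat) list \<Rightarrow> state \<Rightarrow> bool" where
  "adjacency es s \<longleftrightarrow> input es s \<and> (\<forall>i. s ''head'' i = prev_edge es i (length es)) \<and>
     (\<forall>e<length es. s ''next'' e = prev_edge es (row_of es e) e)"

text \<open>Linked lists in two arrays: \<open>head\<close> gives the last edge of a row and
  \<open>next\<close> the preceding edge of the same row, shifted by one so that 0 ends a
  list.\<close>

definition build :: com where
  "build = for_edges ''e''
     (Seq (Write ''next'' (Var ''e'') (Read ''head'' (Read ''row'' (Var ''e''))))
          (Write ''head'' (Read ''row'' (Var ''e'')) (Plus (Var ''e'') (Const 1))))"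

lemma wp_build:
  assumes inp: "input es s" and head: "\<And>i. s ''head'' i = 0" and n: "60 * length es + 20 + K \<le> n"
    and Q: "\<And>s' n'. frame {''e'', ''next'', ''head''} s s' \<Longrightarrow> adjacency es s' \<Longrightarrow> K \<le> n' \<Longrightarrow> Q s' n'"
  shows "wp build Q s n"
  unfolding build_def
proof (rule wp_for_edges[where C = 40 and E = "length es" and K = K and
      J = "\<lambda>k s'. frame {''e'', ''next'', ''head''} s s' \<and> (\<forall>i. s' ''head'' i = prev_edge es i k) \<and>
        (\<forall>e<k. s' ''next'' e = prev_edge es (row_of es e) e)"], goal_cases)
  case 2
  then show ?case using head by (simp add: frame_def)
next
  case (3 k s')
  then show ?case using inp by (simp add: frame_def input_def)
next
  case (4 k s' n)
  then have "s' ''row'' k = row_of es k" using inp by (simp add: frame_def input_def)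
  then show ?case using 4 by (auto simp: wp_simps frame_def less_Suc_eq simp del: One_nat_def)
next
  case (6 s' n')
  then show ?case using inp by (intro Q) (auto simp: frame_def input_def adjacency_def)
qed (use n in simp_all)

section \<open>The search as a program\<close>

text \<open>A single loop that either scans one edge or pops one row, instead of two nested loops,
  so that one potential bounds the whole search.\<close>

definition search :: com where
  "search = While
     (And (Less (Var ''found'') (Const 1)) (Not (And (Less (Var ''cur'') (Const 1)) (Not (Less (Var ''qh'') (Var ''qt''))))))
     (If (Less (Const 0) (Var ''cur''))
        (Seq (Assign ''u'' (Minus (Var ''cur'') (Const 1)))
        (Seq (Assign ''cur'' (Read ''next'' (Var ''u'')))
        (Seq (Assign ''j'' (Read ''column'' (Var ''u'')))
          (If (Less (Const 0) (Read ''mc'' (Var ''j'')))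
             (Seq (Assign ''r'' (Minus (Read ''mc'' (Var ''j'')) (Const 1)))
               (If (Less (Read ''seen'' (Var ''r'')) (Var ''stamp''))
                  (Seq (Write ''seen'' (Var ''r'') (Var ''stamp''))
                  (Seq (Write ''q'' (Var ''qt'') (Var ''r''))
                  (Seq (Write ''fq'' (Var ''qt'') (Minus (Var ''qh'') (Const 1)))
                       (Assign ''qt'' (Plus (Var ''qt'') (Const 1))))))
                  Skip))
             (Seq (Assign ''found'' (Const 1)) (Assign ''fj'' (Var ''j'')))))))
        (Seq (Assign ''cur'' (Read ''head'' (Read ''q'' (Var ''qh''))))
             (Assign ''qh'' (Plus (Var ''qh'') (Const 1)))))"

definition search_vars :: "name set" where
  "search_vars = {''u'', ''j'', ''r'', ''cur'', ''seen'', ''q'', ''fq'', ''qt'', ''qh'', ''found'', ''fj''}"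

lemma in_search_vars:
  "''u'' \<in> search_vars" "''j'' \<in> search_vars" "''r'' \<in> search_vars" "''cur'' \<in> search_vars"
  "''seen'' \<in> search_vars" "''q'' \<in> search_vars" "''fq'' \<in> search_vars" "''qt'' \<in> search_vars"
  "''qh'' \<in> search_vars" "''found'' \<in> search_vars" "''fj'' \<in> search_vars"
  by (simp_all add: search_vars_def)

definition searching_state :: "(nat \<times> nat \<times> nat) list \<Rightarrow> nat set \<Rightarrow> state \<Rightarrow> bool" where
  "searching_state es I s \<longleftrightarrow> searching es (s ''mr'') (s ''mc'') I (s ''seen'') (s ''stamp'' 0) (s ''q'') (s ''fq'')
     (s ''qh'' 0) (s ''qt'' 0) (s ''cur'' 0) (s ''found'' 0) (s ''fj'' 0)"

text \<open>The potential counts the unscanned edges and the rows that may still be popped. Each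
  iteration lowers it by one and is paid by 100 credits. At most \<open>length es\<close> rows are
  queued, since every queued row has an edge.\<close>

lemma wp_search:
  assumes adj: "adjacency es s" and srch: "searching_state es I s" and n: "200 * length es + 50 + K \<le> n"
    and Q: "\<And>s' n'. frame search_vars s s' \<Longrightarrow> searching_state es I s' \<Longrightarrow>
      (s' ''found'' 0 = 0 \<Longrightarrow> s' ''cur'' 0 = 0 \<and> s' ''qh'' 0 = s' ''qt'' 0) \<Longrightarrow> K \<le> n' \<Longrightarrow> Q s' n'"
  shows "wp search Q s n"
  unfolding search_def
proof (rule wp_While[where I = "\<lambda>s' n. frame search_vars s s' \<and> searching_state es I s' \<and>
      100 * (unscanned es (s' ''q'') (s' ''qh'' 0) (s' ''cur'' 0) + (length es - s' ''qh'' 0)) + 50 + K \<le> n"], goal_cases)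
  case 1
  have "unscanned es (s ''q'') (s ''qh'' 0) (s ''cur'' 0) \<le> length es" by (simp add: unscanned_def)
  then show ?case using srch n by (simp add: frame_refl)
next
  case (2 s' n)
  let ?E = "length es"
  have fr: "frame search_vars s s'" and sr: "searching_state es I s'"
    and n: "100 * (unscanned es (s' ''q'') (s' ''qh'' 0) (s' ''cur'' 0) + (?E - s' ''qh'' 0)) + 50 + K \<le> n"
    and found: "s' ''found'' 0 = 0" and go: "0 < s' ''cur'' 0 \<or> s' ''qh'' 0 < s' ''qt'' 0"
    using 2 by auto
  have adj': "adjacency es s'"
    using adj fr by (simp add: frame_def adjacency_def input_def search_vars_def)
  note sr' = sr[unfolded searching_state_def found]
  have credit: "\<exists>m. n = m + 100 \<and> 100 * w' + 50 + K \<le> m" if "w = w' + 1" "100 * w + 50 + K \<le> n" for w w'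
    using that by (intro exI[of _ "n - 100"]) simp
  show ?case
  proof (cases "0 < s' ''cur'' 0")
    case False
    then have cur: "s' ''cur'' 0 = 0" and qh: "s' ''qh'' 0 < s' ''qt'' 0" using go by simp_all
    have head: "s' ''head'' i = prev_edge es i ?E" for i using adj' by (simp add: adjacency_def)
    have same: "unscanned es (s' ''q'') (s' ''qh'' 0 + 1) (prev_edge es (s' ''q'' (s' ''qh'' 0)) ?E)
        = unscanned es (s' ''q'') (s' ''qh'' 0) 0"
      by (simp add: unscanned_def scanned_pop)
    have "?E - s' ''qh'' 0 = (?E - (s' ''qh'' 0 + 1)) + 1"
      using qh searching_qt_le[OF sr'] by linarith
    then have eq: "unscanned es (s' ''q'') (s' ''qh'' 0) 0 + (?E - s' ''qh'' 0) =
        (unscanned es (s' ''q'') (s' ''qh'' 0 + 1) (prev_edge es (s' ''q'' (s' ''qh'' 0)) ?E) + (?E - (s' ''qh'' 0 + 1))) + 1"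
      unfolding same by (subst add.assoc) (rule arg_cong)
    obtain m where m: "n = m + 100" "100 * (unscanned es (s' ''q'') (s' ''qh'' 0 + 1)
        (prev_edge es (s' ''q'' (s' ''qh'' 0)) ?E) + (?E - (s' ''qh'' 0 + 1))) + 50 + K \<le> m"
      using credit[OF eq n[unfolded cur]] by (elim exE conjE) (rule that)
    from m(2) show ?thesis
      unfolding m(1) using fr cur head found searching_pop[OF sr'[unfolded cur] qh, unfolded Suc_eq_plus1]
      by (simp add: wp_simps frame_upd in_search_vars searching_state_def del: One_nat_def)
  next
    case cur: True
    let ?u = "s' ''cur'' 0 - 1"
    note c = searching_cur[OF sr' cur]
    have u: "?u < ?E" using c(1) cur by simp
    have next_u: "s' ''next'' ?u = prev_edge es (row_of es ?u) ?u" and col_u: "s' ''column'' ?u = col_of es ?u"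
      using adj' u by (simp_all add: adjacency_def input_def)
    have dec: "unscanned es (s' ''q'') (s' ''qh'' 0) (s' ''cur'' 0) =
        unscanned es (s' ''q'') (s' ''qh'' 0) (prev_edge es (row_of es ?u) ?u) + 1"
      using unscanned_scan[OF cur c] by simp
    obtain m where m: "n = m + 100" "100 * (unscanned es (s' ''q'') (s' ''qh'' 0) (prev_edge es (row_of es ?u) ?u)
        + (?E - s' ''qh'' 0)) + 50 + K \<le> m"
      using credit[OF _ n, of "unscanned es (s' ''q'') (s' ''qh'' 0) (prev_edge es (row_of es ?u) ?u) + (?E - s' ''qh'' 0)"]
      unfolding dec by auto
    consider (free) "s' ''mc'' (col_of es ?u) = 0"
      | (seen) r where "s' ''mc'' (col_of es ?u) = Suc r" "s' ''seen'' r = s' ''stamp'' 0"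
      | (fresh) r where "s' ''mc'' (col_of es ?u) = Suc r" "s' ''seen'' r \<noteq> s' ''stamp'' 0"
      by (cases "s' ''mc'' (col_of es ?u)") auto
    then show ?thesis
    proof cases
      case free
      then show ?thesis
        unfolding m(1) using m(2) fr cur next_u col_u searching_found[OF sr' cur] found
        by (simp add: wp_simps frame_upd in_search_vars searching_state_def del: One_nat_def)
    next
      case seen
      then show ?thesis
        unfolding m(1) using m(2) fr cur next_u col_u searching_scan_seen[OF sr' cur] found
        by (simp add: wp_simps frame_upd in_search_vars searching_state_def del: One_nat_def)
    next
      case fresh
      have "s' ''seen'' r < s' ''stamp'' 0"
      proof -
        have "s' ''seen'' r \<le> s' ''stamp'' 0" using sr' unfolding searching_def queued_def by blast
        then show ?thesis using fresh(2) by simp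
      qed
      moreover have "unscanned es ((s' ''q'')(s' ''qt'' 0 := r)) (s' ''qh'' 0) k = unscanned es (s' ''q'') (s' ''qh'' 0) k" for k
      proof -
        have "scanned es ((s' ''q'')(s' ''qt'' 0 := r)) (s' ''qh'' 0) k = scanned es (s' ''q'') (s' ''qh'' 0) k"
          using searching_qt_le(1)[OF sr'] by (intro scanned_cong) simp
        then show ?thesis by (simp only: unscanned_def)
      qed
      moreover have "searching es (s' ''mr'') (s' ''mc'') I ((s' ''seen'')(r := s' ''stamp'' 0)) (s' ''stamp'' 0)
          ((s' ''q'')(s' ''qt'' 0 := r)) ((s' ''fq'')(s' ''qt'' 0 := s' ''qh'' 0 - 1)) (s' ''qh'' 0) (s' ''qt'' 0 + 1)
          (prev_edge es (row_of es ?u) ?u) 0 (s' ''fj'' 0)"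
        using searching_scan_new[OF sr' cur fresh] by (simp only: Suc_eq_plus1)
      moreover have "s' ''mc'' (col_of es ?u) = r + 1"
        using fresh(1) by simp
      ultimately show ?thesis
        unfolding m(1) using m(2) fr cur next_u col_u found
        by (simp add: wp_simps frame_upd in_search_vars searching_state_def del: One_nat_def)
    qed
  qed
next
  case (3 s' n)
  then have "s' ''qh'' 0 \<le> s' ''qt'' 0"
    using searching_qt_le(1) unfolding searching_state_def by blast
  with 3 show ?case by (auto intro!: Q)
qed

lemma searching_state_seen_le:
  assumes "searching_state es I s"
  shows "s ''seen'' x \<le> s ''stamp'' 0"
proof -
  have "queued (s ''q'') (s ''qt'' 0) (s ''seen'') (s ''stamp'' 0)"
    using assms by (simp add: searching_state_def searching_def)
  then show ?thesis by (simp add: queued_def)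
qed

section \<open>Augmentation\<close>

text \<open>The path is walked backwards through the queue: the rows at positions up to
  \<open>k\<close> still have their original partners \<open>mr0\<close>, to which the links
  \<open>fq\<close> refer.\<close>

definition augmenting :: "(nat \<times> nat \<times> nat) list \<Rightarrow> (nat \<Rightarrow> nat) \<Rightarrow> nat set \<Rightarrow> (nat \<Rightarrow> nat) \<Rightarrow> (nat \<Rightarrow> nat) \<Rightarrow> nat \<Rightarrow>
    nat \<Rightarrow> (nat \<Rightarrow> nat) \<Rightarrow> (nat \<Rightarrow> nat) \<Rightarrow> nat \<Rightarrow> nat \<Rightarrow> bool" where
  "augmenting es mr0 I q fq qt c mr mc fj k \<longleftrightarrow> k < qt \<and> inj_on q {..<qt} \<and> linked es mr0 I q fq qt \<and>
     (\<forall>i\<in>I. mr0 i = 0) \<and> (q k, fj) \<in> graph_of es \<and> consistent es mr (mc(fj := 0)) \<and>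
     card (matched_rows mr) = c \<and> (\<forall>k'\<le>k. mr (q k') = mr0 (q k'))"

lemma augmenting_init:
  assumes "searching es mr mc I seen st q fq qh qt cur found fj" "0 < found" "\<forall>i\<in>I. mr i = 0"
  shows "augmenting es mr I q fq qt (card (matched_rows mr)) mr mc fj (qh - 1)"
proof -
  have "queued q qt seen st" "mc fj = 0" "0 < qh" "qh \<le> qt"
    using assms(1,2) by (simp_all add: searching_def)
  then have "inj_on q {..<qt}" "mc(fj := 0) = mc" "qh - 1 < qt" by (auto simp: queued_def)
  then show ?thesis using assms by (simp add: augmenting_def searching_def)
qed

text \<open>The row at position \<open>k\<close> passes its old column \<open>j\<close> on to its
  predecessor. Being matched, it lies outside \<open>I\<close>, so a predecessor at a smaller
  position exists.\<close>

lemma augmenting_step: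
  assumes a: "augmenting es mr0 I q fq qt c mr mc fj k" and j: "mr (q k) = Suc j"
  shows "augmenting es mr0 I q fq qt c (mr(q k := Suc fj)) (mc(fj := Suc (q k))) j (fq k)" and "fq k < k"
proof -
  have k: "k < qt" "inj_on q {..<qt}" "mr0 (q k) = Suc j" using a j by (simp_all add: augmenting_def)
  have "q k \<notin> I" using a k(3) by (auto simp: augmenting_def)
  then obtain j' where fq: "fq k < k" "(q (fq k), j') \<in> graph_of es" "mr0 (q k) = Suc j'"
    using a k(1) unfolding augmenting_def linked_def by blast
  have "mr0 (q k') = (mr(q k := Suc fj)) (q k')" if "k' \<le> fq k" for k'
  proof -
    have "q k' \<noteq> q k" using inj_onD[OF k(2), of k' k] that fq(1) k(1) by auto
    then show ?thesis using a that fq(1) by (simp add: augmenting_def)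
  qed
  moreover have "consistent es (mr(q k := Suc fj)) (mc(fj := Suc (q k), j := 0))"
    and "matched_rows (mr(q k := Suc fj)) = matched_rows mr"
    using augment_step[of es mr mc fj "q k" j] a j by (simp_all add: augmenting_def)
  ultimately show "augmenting es mr0 I q fq qt c (mr(q k := Suc fj)) (mc(fj := Suc (q k))) j (fq k)"
    using a fq k by (simp add: augmenting_def)
  show "fq k < k" by (rule fq(1))
qed

lemma augmenting_last:
  assumes "augmenting es mr0 I q fq qt c mr mc fj k" "mr (q k) = 0"
  shows "consistent es (mr(q k := Suc fj)) (mc(fj := Suc (q k)))"
    "card (matched_rows (mr(q k := Suc fj))) = Suc c"
  using augment_last[of es mr mc fj "q k"] assms by (simp_all add: augmenting_def)

text \<open>\<open>go\<close> receives the old partner of the row, shifted by one, and is also the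
  loop condition: it becomes 0 exactly at the uncovered row where the path starts.\<close>

definition augment_loop :: com where
  "augment_loop = While (Less (Const 0) (Var ''go''))
     (Seq (Assign ''i'' (Read ''q'' (Var ''k'')))
     (Seq (Assign ''go'' (Read ''mr'' (Var ''i'')))
     (Seq (Write ''mr'' (Var ''i'') (Plus (Var ''fj'') (Const 1)))
     (Seq (Write ''mc'' (Var ''fj'') (Plus (Var ''i'') (Const 1)))
     (Seq (Assign ''fj'' (Minus (Var ''go'') (Const 1)))
          (Assign ''k'' (Read ''fq'' (Var ''k''))))))))"

definition augment :: com where
  "augment = Seq (Assign ''k'' (Minus (Var ''qh'') (Const 1))) (Seq (Assign ''go'' (Const 1)) augment_loop)"

definition augment_vars :: "name set" where
  "augment_vars = {''k'', ''go'', ''i'', ''mr'', ''mc'', ''fj''}"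

lemma in_augment_vars:
  "''k'' \<in> augment_vars" "''go'' \<in> augment_vars" "''i'' \<in> augment_vars"
  "''mr'' \<in> augment_vars" "''mc'' \<in> augment_vars" "''fj'' \<in> augment_vars"
  by (simp_all add: augment_vars_def)

lemma wp_augment:
  assumes srch: "searching_state es I s" "0 < s ''found'' 0" "\<forall>i\<in>I. s ''mr'' i = 0"
    and n: "100 * length es + 50 + K \<le> n"
    and Q: "\<And>s' n'. frame augment_vars s s' \<Longrightarrow> consistent es (s' ''mr'') (s' ''mc'') \<Longrightarrow>
      card (matched_rows (s' ''mr'')) = Suc (card (matched_rows (s ''mr''))) \<Longrightarrow> K \<le> n' \<Longrightarrow> Q s' n'"
  shows "wp augment Q s n"
proof -
  let ?a = "\<lambda>mr mc fj k. augmenting es (s ''mr'') I (s ''q'') (s ''fq'') (s ''qt'' 0) (card (matched_rows (s ''mr''))) mr mc fj k"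
  \<comment> \<open>80 credits for each position from \<open>k\<close> down to 0; the walk visits
    strictly decreasing positions below \<open>qh\<close>.\<close>
  define J where "J s' n \<longleftrightarrow> frame augment_vars s s' \<and>
     (if 0 < s' ''go'' 0 then ?a (s' ''mr'') (s' ''mc'') (s' ''fj'' 0) (s' ''k'' 0) \<and> 80 * (s' ''k'' 0 + 1) + 10 + K \<le> n
      else consistent es (s' ''mr'') (s' ''mc'') \<and>
        card (matched_rows (s' ''mr'')) = Suc (card (matched_rows (s ''mr''))) \<and> 10 + K \<le> n)" for s' n
  have qh: "s ''qh'' 0 \<le> length es"
    using searching_qt_le srch(1) unfolding searching_state_def by (meson order.trans)
  have init: "?a (s ''mr'') (s ''mc'') (s ''fj'' 0) (s ''qh'' 0 - 1)"
    using augmenting_init[OF srch(1)[unfolded searching_state_def] srch(2,3)] .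
  have "0 < s ''qh'' 0" using srch(1,2) by (simp add: searching_state_def searching_def)
  then have "s ''qh'' 0 - 1 + 1 = s ''qh'' 0" by simp
  then have "80 * (s ''qh'' 0 - 1 + 1) + 10 + K \<le> n - 20" "20 \<le> n"
    using n qh by auto
  then obtain m where m: "n = m + 20" "80 * (s ''qh'' 0 - 1 + 1) + 10 + K \<le> m"
    by (metis le_add_diff_inverse2)
  have fr: "frame augment_vars s s" by (rule frame_refl)
  have loop: "wp augment_loop Q s' n'" if "J s' n'" for s' n'
    unfolding augment_loop_def
  proof (rule wp_While[where I = J, OF that], goal_cases)
    case (1 s' n)
    then have go: "0 < s' ''go'' 0" by simp
    with 1 have fr: "frame augment_vars s s'"
      and a: "?a (s' ''mr'') (s' ''mc'') (s' ''fj'' 0) (s' ''k'' 0)" and n: "80 * (s' ''k'' 0 + 1) + 10 + K \<le> n"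
      by (simp_all add: J_def)
    have q: "s' ''q'' = s ''q''" "s' ''fq'' = s ''fq''" using fr by (simp_all add: frame_def augment_vars_def)
    let ?i = "s ''q'' (s' ''k'' 0)"
    have "n = n - 80 + 80" "80 * s' ''k'' 0 + 10 + K \<le> n - 80" using n by auto
    then obtain m where m: "n = m + 80" "80 * s' ''k'' 0 + 10 + K \<le> m" by blast
    show ?case
    proof (cases "s' ''mr'' ?i")
      case 0
      have "consistent es ((s' ''mr'')(?i := s' ''fj'' 0 + 1)) ((s' ''mc'')(s' ''fj'' 0 := ?i + 1))"
        "card (matched_rows ((s' ''mr'')(?i := s' ''fj'' 0 + 1))) = Suc (card (matched_rows (s ''mr'')))"
        using augmenting_last[OF a 0] by simp_all
      then show ?thesis
        unfolding m(1) using m(2) fr q 0 go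
        by (simp add: J_def wp_simps frame_upd in_augment_vars del: One_nat_def)
    next
      case (Suc j)
      have "?a ((s' ''mr'')(?i := s' ''fj'' 0 + 1)) ((s' ''mc'')(s' ''fj'' 0 := ?i + 1)) j (s ''fq'' (s' ''k'' 0))"
        using augmenting_step(1)[OF a Suc] by simp
      moreover have "80 * (s ''fq'' (s' ''k'' 0) + 1) + 10 + K \<le> m"
        using augmenting_step(2)[OF a Suc] m(2) by simp
      moreover have "s' ''mr'' ?i = j + 1" using Suc by simp
      ultimately show ?thesis
        unfolding m(1) using fr q go
        by (simp add: J_def wp_simps frame_upd in_augment_vars del: One_nat_def)
    qed
  next
    case (2 s' n)
    then show ?case by (auto simp: J_def intro!: Q)
  qed
  show ?thesis
    unfolding augment_def m(1) using m(2) fr init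
    by (simp add: wp_simps del: One_nat_def) (rule loop, simp add: J_def frame_upd in_augment_vars del: One_nat_def)
qed

section \<open>The matching phase\<close>

text \<open>Running over the edges keeps the cost linear in \<open>E\<close> and leaves isolated
  rows out; the stamp prevents duplicates.\<close>

definition queue_free :: com where
  "queue_free = for_edges ''e''
     (If (And (Less (Read ''mr'' (Read ''row'' (Var ''e''))) (Const 1))
              (Less (Read ''seen'' (Read ''row'' (Var ''e''))) (Var ''stamp'')))
        (Seq (Write ''seen'' (Read ''row'' (Var ''e'')) (Var ''stamp''))
        (Seq (Write ''q'' (Var ''qt'') (Read ''row'' (Var ''e'')))
             (Assign ''qt'' (Plus (Var ''qt'') (Const 1)))))
        Skip)"

definition free_rows :: "(nat \<times> nat \<times> nat) list \<Rightarrow> (nat \<Rightarrow> nat) \<Rightarrow> nat \<Rightarrow> nat set" where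
  "free_rows es mr k = {row_of es e | e. e < k \<and> mr (row_of es e) = 0}"

lemma free_rows_all: "free_rows es mr (length es) = fst ` graph_of es - matched_rows mr"
  by (auto simp: free_rows_def fst_graph_of matched_rows_def)

lemma free_rows_Suc:
  "free_rows es mr (Suc k) = (if mr (row_of es k) = 0 then insert (row_of es k) (free_rows es mr k) else free_rows es mr k)"
  by (auto simp: free_rows_def less_Suc_eq)

lemma wp_queue_free:
  assumes adj: "adjacency es s" and seen: "\<And>r. s ''seen'' r < s ''stamp'' 0" and qt: "s ''qt'' 0 = 0"
    and n: "100 * length es + 20 + K \<le> n"
    and Q: "\<And>s' n'. frame {''e'', ''seen'', ''q'', ''qt''} s s' \<Longrightarrow>
      queued (s' ''q'') (s' ''qt'' 0) (s' ''seen'') (s ''stamp'' 0) \<Longrightarrow>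
      s' ''q'' ` {..<s' ''qt'' 0} = fst ` graph_of es - matched_rows (s ''mr'') \<Longrightarrow> K \<le> n' \<Longrightarrow> Q s' n'"
  shows "wp queue_free Q s n"
  unfolding queue_free_def
proof (rule wp_for_edges[where C = 80 and E = "length es" and K = K and
      J = "\<lambda>k s'. frame {''e'', ''seen'', ''q'', ''qt''} s s' \<and>
        queued (s' ''q'') (s' ''qt'' 0) (s' ''seen'') (s ''stamp'' 0) \<and>
        s' ''q'' ` {..<s' ''qt'' 0} = free_rows es (s ''mr'') k"], goal_cases)
  case 2
  have "s ''seen'' r \<noteq> s ''stamp'' 0" for r using seen[of r] by simp
  then have "{r. s ''seen'' r = s ''stamp'' 0} = {}" by simp
  moreover have "s ''seen'' r \<le> s ''stamp'' 0" for r using seen[of r] by simp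
  ultimately show ?case using qt
    by (simp add: frame_def queued_def free_rows_def)
next
  case (3 k s')
  then show ?case using adj by (simp add: frame_def input_def adjacency_def)
next
  case (4 k s' n)
  let ?i = "row_of es k" and ?st = "s ''stamp'' 0"
  have fr: "frame {''e'', ''seen'', ''q'', ''qt''} s s'"
    and qd: "queued (s' ''q'') (s' ''qt'' 0) (s' ''seen'') ?st"
    and img: "s' ''q'' ` {..<s' ''qt'' 0} = free_rows es (s ''mr'') k"
    using 4 by simp_all
  have s': "s' ''row'' k = ?i" "s' ''mr'' = s ''mr''" "s' ''stamp'' = s ''stamp''"
    using fr adj 4(1) by (simp_all add: frame_def input_def adjacency_def)
  have "\<exists>m. n = m + 80" using 4(4) by (metis le_add_diff_inverse2)
  then obtain m where m: "n = m + 80" by blast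
  have seen_iff: "s' ''seen'' ?i = ?st \<longleftrightarrow> ?i \<in> free_rows es (s ''mr'') k"
    using qd unfolding img[symmetric] by (simp add: queued_def)
  have le: "s' ''seen'' ?i \<le> ?st" using qd by (simp add: queued_def)
  show ?case
  proof (cases "s ''mr'' ?i = 0 \<and> s' ''seen'' ?i < ?st")
    case True
    have "queued ((s' ''q'')(s' ''qt'' 0 := ?i)) (s' ''qt'' 0 + 1) ((s' ''seen'')(?i := ?st)) ?st"
      using queued_push[OF qd, of ?i] True by simp
    moreover have "((s' ''q'')(s' ''qt'' 0 := ?i)) ` {..<s' ''qt'' 0 + 1} = free_rows es (s ''mr'') (Suc k)"
    proof -
      have "((s' ''q'')(s' ''qt'' 0 := ?i)) ` {..<Suc (s' ''qt'' 0)} = insert ?i (s' ''q'' ` {..<s' ''qt'' 0})"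
        by (auto simp: lessThan_Suc)
      then show ?thesis using img True by (simp add: free_rows_Suc)
    qed
    ultimately show ?thesis
      unfolding m using fr s' True 4(3) by (simp add: wp_simps frame_upd del: One_nat_def)
  next
    case False
    then have "free_rows es (s ''mr'') (Suc k) = free_rows es (s ''mr'') k"
      using seen_iff le by (auto simp: free_rows_Suc)
    then show ?thesis
      unfolding m using fr s' False 4(3) qd img
      by (cases "s ''mr'' ?i = 0") (simp_all add: wp_simps frame_upd del: One_nat_def)
  qed
next
  case (6 s' n')
  then show ?case by (intro Q) (simp_all add: free_rows_all)
qed (use n in simp_all)

text \<open>What the last search leaves behind: the first two conditions give the tight cover, and
  by the third, flipping a path shows that each row of \<open>Z\<close> is missed by some maximum
  matching.\<close>

definition failed :: "(nat \<times> nat \<times> nat) list \<Rightarrow> (nat \<Rightarrow> nat) \<Rightarrow> nat set \<Rightarrow> bool" where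
  "failed es mr Z \<longleftrightarrow> closed_rows (graph_of es) (mates mr) Z \<and>
     fst ` graph_of es - matched_rows mr \<subseteq> Z \<and>
     (\<forall>r\<in>Z. \<exists>i\<in>fst ` graph_of es - matched_rows mr. (i, r) \<in> (alt_step (graph_of es) (mates mr))\<^sup>*)"

text \<open>Raising the stamp makes all rows unvisited at once.\<close>

definition match_round :: com where
  "match_round =
     Seq (Assign ''stamp'' (Plus (Var ''stamp'') (Const 1)))
    (Seq (Assign ''qt'' (Const 0))
    (Seq (Assign ''qh'' (Const 0))
    (Seq (Assign ''cur'' (Const 0))
    (Seq (Assign ''found'' (Const 0))
    (Seq queue_free
    (Seq search
    (If (Less (Const 0) (Var ''found'')) augment (Assign ''more'' (Const 0)))))))))"

definition match_vars :: "name set" where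
  "match_vars = search_vars \<union> augment_vars \<union> {''stamp'', ''more'', ''e''}"

lemma in_match_vars:
  "''stamp'' \<in> match_vars" "''qt'' \<in> match_vars" "''qh'' \<in> match_vars" "''cur'' \<in> match_vars"
  "''found'' \<in> match_vars" "''more'' \<in> match_vars"
  by (simp_all add: match_vars_def search_vars_def)

lemma wp_match_round:
  assumes adj: "adjacency es s" and con: "consistent es (s ''mr'') (s ''mc'')"
    and seen: "\<And>r. s ''seen'' r \<le> s ''stamp'' 0" and n: "400 * length es + 300 + K \<le> n"
    and Q: "\<And>s' n'. frame match_vars s s' \<Longrightarrow> consistent es (s' ''mr'') (s' ''mc'') \<Longrightarrow>
      (\<And>r. s' ''seen'' r \<le> s' ''stamp'' 0) \<Longrightarrow>
      (s' ''more'' 0 = s ''more'' 0 \<and> card (matched_rows (s' ''mr'')) = Suc (card (matched_rows (s ''mr'')))) \<or>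
      (s' ''more'' 0 = 0 \<and> failed es (s' ''mr'') {r. s' ''seen'' r = s' ''stamp'' 0}) \<Longrightarrow> K \<le> n' \<Longrightarrow> Q s' n'"
  shows "wp match_round Q s n"
proof -
  let ?E = "length es" and ?free = "fst ` graph_of es - matched_rows (s ''mr'')"
  define s1 where "s1 = s(''stamp'' := (s ''stamp'')(0 := s ''stamp'' 0 + 1), ''qt'' := (s ''qt'')(0 := 0),
    ''qh'' := (s ''qh'')(0 := 0), ''cur'' := (s ''cur'')(0 := 0), ''found'' := (s ''found'')(0 := 0))"
  have fr1: "frame match_vars s s1"
    unfolding s1_def by (intro frame_upd frame_refl in_match_vars)
  obtain m where m: "n = m + 50" "400 * ?E + 250 + K \<le> m"
    using split_credits[of 50 "400 * ?E + 250 + K" n] n by auto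
  have m25: "400 * ?E + 200 + K \<le> 32 + m" using m(2) by simp
  have "wp queue_free (wp search (wp (If (Less (Const 0) (Var ''found'')) augment (Assign ''more'' (Const 0))) Q)) s1 (32 + m)"
  proof (rule wp_queue_free[where K = "300 * ?E + 150 + K" and es = es])
    show "adjacency es s1" using adj by (simp add: s1_def adjacency_def input_def)
    show "s1 ''seen'' r < s1 ''stamp'' 0" for r using seen[of r] by (simp add: s1_def)
    show "s1 ''qt'' 0 = 0" by (simp add: s1_def)
    show "100 * ?E + 20 + (300 * ?E + 150 + K) \<le> 32 + m" using m25 by simp
    fix s2 n2
    assume fr2: "frame {''e'', ''seen'', ''q'', ''qt''} s1 s2"
      and qd: "queued (s2 ''q'') (s2 ''qt'' 0) (s2 ''seen'') (s1 ''stamp'' 0)"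
      and img: "s2 ''q'' ` {..<s2 ''qt'' 0} = fst ` graph_of es - matched_rows (s1 ''mr'')"
      and n2: "300 * ?E + 150 + K \<le> n2"
    have s2: "s2 ''mr'' = s ''mr''" "s2 ''mc'' = s ''mc''" "s2 ''stamp'' 0 = s ''stamp'' 0 + 1" "s2 ''qh'' 0 = 0"
      "s2 ''cur'' 0 = 0" "s2 ''found'' 0 = 0" "s1 ''stamp'' 0 = s ''stamp'' 0 + 1" "s1 ''mr'' = s ''mr''" "s2 ''more'' = s ''more''"
      using fr2 by (simp_all add: frame_def s1_def)
    have adj2: "adjacency es s2"
      using adj fr2 by (simp add: frame_def s1_def adjacency_def input_def)
    have img': "s2 ''q'' ` {..<s2 ''qt'' 0} = ?free" using img s2 by simp
    have sr2: "searching_state es ?free s2"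
      using searching_init[OF con qd[unfolded s2], of "s2 ''fq''" "s2 ''fj'' 0"] img'
      unfolding searching_state_def s2 by auto
    show "wp search (wp (If (Less (Const 0) (Var ''found'')) augment (Assign ''more'' (Const 0))) Q) s2 n2"
    proof (rule wp_search[OF adj2 sr2, of "100 * ?E + 60 + K"])
      show "200 * ?E + 50 + (100 * ?E + 60 + K) \<le> n2" using n2 by simp
      fix s3 n3
      assume fr3: "frame search_vars s2 s3" and sr3: "searching_state es ?free s3"
        and fin: "s3 ''found'' 0 = 0 \<Longrightarrow> s3 ''cur'' 0 = 0 \<and> s3 ''qh'' 0 = s3 ''qt'' 0"
        and n3: "100 * ?E + 60 + K \<le> n3"
      have s3: "s3 ''mr'' = s ''mr''" "s3 ''mc'' = s ''mc''" "s3 ''more'' = s ''more''"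
        using fr3 s2 by (simp_all add: frame_def search_vars_def)
      have seen3: "s3 ''seen'' r \<le> s3 ''stamp'' 0" for r
        by (rule searching_state_seen_le[OF sr3])
      have fr03: "frame match_vars s s3"
      proof (rule frame_trans[OF fr1])
        show "frame match_vars s1 s3"
          by (rule frame_trans[OF fr2 fr3]) (auto simp: match_vars_def search_vars_def)
      qed simp_all
      obtain l where l: "n3 = l + 10" "100 * ?E + 50 + K \<le> l"
        using split_credits[of 10 "100 * ?E + 50 + K" n3] n3 by auto
      show "wp (If (Less (Const 0) (Var ''found'')) augment (Assign ''more'' (Const 0))) Q s3 n3"
      proof (cases "0 < s3 ''found'' 0")
        case True
        have "wp augment Q s3 (5 + l)"
        proof (rule wp_augment[OF sr3 True, of K])
          show "\<forall>i\<in>?free. s3 ''mr'' i = 0" by (simp add: s3 matched_rows_def)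
          show "100 * ?E + 50 + K \<le> 5 + l" using l(2) by simp
          fix s4 n4
          assume fr4: "frame augment_vars s3 s4" and con4: "consistent es (s4 ''mr'') (s4 ''mc'')"
            and card4: "card (matched_rows (s4 ''mr'')) = Suc (card (matched_rows (s3 ''mr'')))" and n4: "K \<le> n4"
          have s4: "s4 ''seen'' = s3 ''seen''" "s4 ''stamp'' = s3 ''stamp''" "s4 ''more'' = s3 ''more''"
            using fr4 by (simp_all add: frame_def augment_vars_def)
          show "Q s4 n4"
          proof (rule Q[OF _ con4 _ _ n4])
            show "frame match_vars s s4"
              by (rule frame_trans[OF fr03 fr4]) (auto simp: match_vars_def)
            show "s4 ''seen'' r \<le> s4 ''stamp'' 0" for r using seen3[of r] by (simp add: s4)
            show "s4 ''more'' 0 = s ''more'' 0 \<and> card (matched_rows (s4 ''mr'')) = Suc (card (matched_rows (s ''mr''))) \<or>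
              s4 ''more'' 0 = 0 \<and> failed es (s4 ''mr'') {r. s4 ''seen'' r = s4 ''stamp'' 0}"
              using card4 by (simp add: s4 s3)
          qed
        qed
        then show ?thesis unfolding l(1) using True by (simp add: wp_If del: One_nat_def)
      next
        case False
        then have found: "s3 ''found'' 0 = 0" by simp
        note sr3' = sr3[unfolded searching_state_def found conjunct1[OF fin[OF found]] conjunct2[OF fin[OF found]]]
        let ?s4 = "s3(''more'' := (s3 ''more'')(0 := 0))"
        have "Q ?s4 (l + 2)"
        proof (rule Q)
          show "frame match_vars s ?s4" using fr03 by (intro frame_upd in_match_vars)
          show "consistent es (?s4 ''mr'') (?s4 ''mc'')" using con by (simp add: s3)
          show "?s4 ''seen'' r \<le> ?s4 ''stamp'' 0" for r using seen3[of r] by simp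
          show "K \<le> l + 2" using l(2) by simp
          have "failed es (s3 ''mr'') {r. s3 ''seen'' r = s3 ''stamp'' 0}"
            unfolding failed_def
          proof (intro conjI)
            show "closed_rows (graph_of es) (mates (s3 ''mr'')) {r. s3 ''seen'' r = s3 ''stamp'' 0}"
              by (rule searching_done_closed[OF sr3'])
            show "fst ` graph_of es - matched_rows (s3 ''mr'') \<subseteq> {r. s3 ''seen'' r = s3 ''stamp'' 0}"
              unfolding searching_seen[OF sr3'] using sr3' by (simp add: searching_def s3)
            show "\<forall>r\<in>{r. s3 ''seen'' r = s3 ''stamp'' 0}. \<exists>i\<in>fst ` graph_of es - matched_rows (s3 ''mr'').
                (i, r) \<in> (alt_step (graph_of es) (mates (s3 ''mr'')))\<^sup>*"
              unfolding searching_seen[OF sr3'] using searching_reachable[OF sr3'] by (simp add: s3)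
          qed
          then show "?s4 ''more'' 0 = s ''more'' 0 \<and> card (matched_rows (?s4 ''mr'')) = Suc (card (matched_rows (s ''mr''))) \<or>
              ?s4 ''more'' 0 = 0 \<and> failed es (?s4 ''mr'') {r. ?s4 ''seen'' r = ?s4 ''stamp'' 0}" by simp
        qed
        then show ?thesis unfolding l(1) using found by (simp add: wp_If wp_Write del: One_nat_def)
      qed
    qed
  qed
  then show ?thesis
    unfolding match_round_def m(1) s1_def by (simp add: wp_Seq_fun wp_Write del: One_nat_def)
qed

definition matching_phase :: com where
  "matching_phase = Seq (Assign ''more'' (Const 1)) (While (Less (Const 0) (Var ''more'')) match_round)"

text \<open>Every round but the last enlarges the matching, whose size is at most the number of
  edges, so \<open>length es + 1\<close> rounds suffice.\<close>

lemma wp_matching_phase: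
  assumes adj: "adjacency es s" and mr: "s ''mr'' = (\<lambda>_. 0)" "s ''mc'' = (\<lambda>_. 0)"
    and seen: "\<And>r. s ''seen'' r \<le> s ''stamp'' 0"
    and n: "(400 * length es + 310) * (length es + 1) + 20 + K \<le> n"
    and Q: "\<And>s' n'. frame match_vars s s' \<Longrightarrow> consistent es (s' ''mr'') (s' ''mc'') \<Longrightarrow>
      (\<And>r. s' ''seen'' r \<le> s' ''stamp'' 0) \<Longrightarrow>
      failed es (s' ''mr'') {r. s' ''seen'' r = s' ''stamp'' 0} \<Longrightarrow> K \<le> n' \<Longrightarrow> Q s' n'"
  shows "wp matching_phase Q s n"
proof -
  let ?E = "length es"
  define B where "B = 400 * ?E + 310"
  define J where "J s' n \<longleftrightarrow> frame match_vars s s' \<and> consistent es (s' ''mr'') (s' ''mc'') \<and>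
      (\<forall>r. s' ''seen'' r \<le> s' ''stamp'' 0) \<and>
      (if 0 < s' ''more'' 0 then B * (?E + 1 - card (matched_rows (s' ''mr''))) + 10 + K \<le> n
       else failed es (s' ''mr'') {r. s' ''seen'' r = s' ''stamp'' 0} \<and> 10 + K \<le> n)" for s' n
  let ?s = "s(''more'' := (s ''more'')(0 := 1))"
  have loop: "wp (While (Less (Const 0) (Var ''more'')) match_round) Q ?s (n - 3)"
  proof (rule wp_While[where I = J], goal_cases)
    case 1
    have "consistent es (\<lambda>_. 0) (\<lambda>_. 0)" by (auto simp: consistent_def mates_def)
    moreover have "frame match_vars s ?s" by (intro frame_upd frame_refl in_match_vars)
    moreover have "B * (?E + 1) + 10 + K \<le> n - 3" using n by (simp add: B_def)
    ultimately show ?case using mr seen by (simp add: J_def matched_rows_def)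
  next
    case (2 s' n)
    then have go: "0 < s' ''more'' 0" by simp
    with 2 have fr: "frame match_vars s s'" and con: "consistent es (s' ''mr'') (s' ''mc'')"
      and seen: "\<And>r. s' ''seen'' r \<le> s' ''stamp'' 0"
      and n: "B * (?E + 1 - card (matched_rows (s' ''mr''))) + 10 + K \<le> n"
      by (simp_all add: J_def)
    let ?c = "card (matched_rows (s' ''mr''))"
    have adj': "adjacency es s'"
      using adj fr by (simp add: frame_def adjacency_def input_def match_vars_def search_vars_def augment_vars_def)
    have "?E + 1 - ?c = Suc (?E - ?c)" using card_matched_rows_le[OF con] by simp
    then have n': "B + (B * (?E - ?c) + 10 + K) \<le> n" using n by simp
    have "wp match_round J s' (n - 5)"
    proof (rule wp_match_round[OF adj' con seen, of "B * (?E - ?c) + 10 + K"])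
      show "400 * ?E + 300 + (B * (?E - ?c) + 10 + K) \<le> n - 5" using n' by (simp add: B_def)
      fix s'' n''
      assume fr': "frame match_vars s' s''" and con': "consistent es (s'' ''mr'') (s'' ''mc'')"
        and seen': "\<And>r. s'' ''seen'' r \<le> s'' ''stamp'' 0"
        and res: "(s'' ''more'' 0 = s' ''more'' 0 \<and> card (matched_rows (s'' ''mr'')) = Suc ?c) \<or>
          (s'' ''more'' 0 = 0 \<and> failed es (s'' ''mr'') {r. s'' ''seen'' r = s'' ''stamp'' 0})"
        and n'': "B * (?E - ?c) + 10 + K \<le> n''"
      have "frame match_vars s s''" by (rule frame_trans[OF fr fr']) simp_all
      then show "J s'' n''" using res con' seen' n'' go by (auto simp: J_def)
    qed
    then show ?case using n' by (simp add: B_def del: One_nat_def)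
  next
    case (3 s' n)
    then show ?case by (auto simp: J_def intro!: Q)
  qed
  have "3 \<le> n" using n by simp
  then show ?thesis
    unfolding matching_phase_def using loop by (simp add: wp_Seq wp_Write del: One_nat_def)
qed

section \<open>Checking the entries of positive degree\<close>

text \<open>Later searches overwrite \<open>seen\<close>, so membership of a row in the last failed
  search is preserved as weight 0. Entries in such rows are harmless and are then skipped like
  constant ones.\<close>

definition mark :: com where
  "mark = for_edges ''e''
     (If (Less (Read ''seen'' (Read ''row'' (Var ''e''))) (Var ''stamp''))
        Skip (Write ''weight'' (Var ''e'') (Const 0)))"

lemma wp_mark:
  assumes adj: "adjacency es s" and seen: "\<And>r. s ''seen'' r \<le> s ''stamp'' 0"
    and weight: "\<And>e. e < length es \<Longrightarrow> s ''weight'' e = weight_of es e"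
    and n: "60 * length es + 20 + K \<le> n"
    and Q: "\<And>s' n'. frame {''e'', ''weight''} s s' \<Longrightarrow>
      (\<And>e. e < length es \<Longrightarrow> s' ''weight'' e = (if s ''seen'' (row_of es e) = s ''stamp'' 0 then 0 else weight_of es e)) \<Longrightarrow>
      K \<le> n' \<Longrightarrow> Q s' n'"
  shows "wp mark Q s n"
  unfolding mark_def
proof (rule wp_for_edges[where C = 40 and E = "length es" and K = K and
      J = "\<lambda>k s'. frame {''e'', ''weight''} s s' \<and> (\<forall>e<length es. s' ''weight'' e =
        (if e < k \<and> s ''seen'' (row_of es e) = s ''stamp'' 0 then 0 else weight_of es e))"], goal_cases)
  case 2
  then show ?case using weight by (simp add: frame_def)
next
  case (3 k s')
  then show ?case using adj by (simp add: frame_def input_def adjacency_def)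
next
  case (4 k s' n)
  have fr: "frame {''e'', ''weight''} s s'" using 4 by simp
  have s': "s' ''row'' k = row_of es k" "s' ''seen'' = s ''seen''" "s' ''stamp'' = s ''stamp''"
    using fr adj 4(1) by (simp_all add: frame_def input_def adjacency_def)
  obtain m where m: "n = m + 40" using 4(4) by (metis le_add_diff_inverse2)
  have w: "s' ''weight'' e = (if e < k \<and> s ''seen'' (row_of es e) = s ''stamp'' 0 then 0 else weight_of es e)"
    if "e < length es" for e using 4(2) that by blast
  show ?case
  proof (cases "s ''seen'' (row_of es k) < s ''stamp'' 0")
    case True
    then have "s ''seen'' (row_of es k) \<noteq> s ''stamp'' 0" by simp
    then have "s' ''weight'' e = (if e < Suc k \<and> s ''seen'' (row_of es e) = s ''stamp'' 0 then 0 else weight_of es e)"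
      if "e < length es" for e using w[OF that] by (auto simp: less_Suc_eq)
    then show ?thesis
      unfolding m using True s' 4(3) fr by (simp add: wp_simps frame_upd del: One_nat_def)
  next
    case False
    then have "s ''seen'' (row_of es k) = s ''stamp'' 0" using seen[of "row_of es k"] by simp
    then have "((s' ''weight'')(k := 0)) e = (if e < Suc k \<and> s ''seen'' (row_of es e) = s ''stamp'' 0 then 0 else weight_of es e)"
      if "e < length es" for e using w[OF that] by (auto simp: less_Suc_eq)
    then show ?thesis
      unfolding m using False s' 4(3) fr by (simp add: wp_simps frame_upd del: One_nat_def fun_upd_apply) simp
  qed
next
  case (6 s' n')
  then show ?case by (intro Q) simp_all
qed (use n in simp_all)

definition check_edge :: com where
  "check_edge =
     If (And (Less (Const 0) (Read ''weight'' (Var ''f''))) (Less (Const 0) (Read ''mc'' (Read ''column'' (Var ''f'')))))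
       (Seq (Assign ''stamp'' (Plus (Var ''stamp'') (Const 1)))
       (Seq (Assign ''r'' (Minus (Read ''mc'' (Read ''column'' (Var ''f''))) (Const 1)))
       (Seq (Write ''seen'' (Var ''r'') (Var ''stamp''))
       (Seq (Write ''q'' (Const 0) (Var ''r''))
       (Seq (Assign ''qt'' (Const 1))
       (Seq (Assign ''qh'' (Const 0))
       (Seq (Assign ''cur'' (Const 0))
       (Seq (Assign ''found'' (Const 0))
       (Seq search
         (If (And (Less (Var ''found'') (Const 1)) (Not (Less (Read ''seen'' (Read ''row'' (Var ''f''))) (Var ''stamp''))))
           (Assign ''bad'' (Const 1)) Skip))))))))))
       Skip"

definition harmful_edge :: "(nat \<times> nat \<times> nat) list \<Rightarrow> nat \<Rightarrow> nat \<Rightarrow> bool" where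
  "harmful_edge es c e \<longleftrightarrow> e < length es \<and> 0 < weight_of es e \<and> harmful_block (graph_of es) c (row_of es e, col_of es e)"

lemma harmless_if_row_reachable:
  assumes con: "consistent es mr mc" and "i0 \<notin> matched_rows mr" "(i0, i) \<in> (alt_step (graph_of es) (mates mr))\<^sup>*"
  shows "harmless (graph_of es) (card (mates mr)) (i, j)"
proof -
  have "i0 \<notin> fst ` mates mr" using assms(2) by (simp add: fst_mates)
  from exists_matching_avoiding[OF matching_mates[OF con] this assms(3)]
  show ?thesis unfolding harmless_def by (simp only: fst_conv) blast
qed

lemma harmless_if_free_column:
  assumes con: "consistent es mr mc" and "mc j = 0"
  shows "harmless (graph_of es) (card (mates mr)) (i, j)"
  using matching_mates[OF con] snd_mates[OF con, of j] assms(2) unfolding harmless_def by auto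

text \<open>If a free column is reached, a matching of the same size gives up column
  \<open>j\<close>. If neither a free column nor row \<open>i\<close> is reached, the reached rows
  separate \<open>(i, j)\<close> from all maximum matchings. If row \<open>i\<close> is reached but
  no free column, the reached rows outside \<open>V\<close> form the harmful block.\<close>

lemma searched_verdict:
  assumes sr: "searching es mr mc {r} seen st q fq qh qt cur found fj"
    and fin: "found = 0 \<longrightarrow> cur = 0 \<and> qh = qt"
    and V: "failed es mr V" and e: "(i, j) \<in> graph_of es" "mc j = Suc r" "i \<notin> V"
  shows "\<not> (found = 0 \<and> seen i = st) \<Longrightarrow> harmless (graph_of es) (card (mates mr)) (i, j)"
    and "found = 0 \<Longrightarrow> seen i = st \<Longrightarrow> harmful_block (graph_of es) (card (mates mr)) (i, j)"
proof -
  let ?G = "graph_of es" and ?m = "mates mr" and ?Z = "{r. seen r = st}"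
  have con: "consistent es mr mc" using sr by (simp add: searching_def)
  have m: "matching ?G ?m" by (rule matching_mates[OF con])
  have rj: "(r, j) \<in> ?m" using con e(2) by (simp add: consistent_def in_mates)
  have Vc: "closed_rows ?G ?m V" and Vf: "fst ` ?G - fst ` ?m \<subseteq> V"
    using V by (simp_all add: failed_def fst_mates)
  have reach: "(r, q k) \<in> (alt_step ?G ?m)\<^sup>*" if "k < qt" for k
    using searching_reachable[OF sr that] by simp
  have Z: "?Z = q ` {..<qt}" by (rule searching_seen[OF sr])
  have rZ: "r \<in> ?Z" unfolding Z using sr by (simp add: searching_def)
  show "harmless ?G (card ?m) (i, j)" if "\<not> (found = 0 \<and> seen i = st)"
  proof (cases "found = 0")
    case False
    then have f: "0 < qh" "qh \<le> qt" "(q (qh - 1), fj) \<in> ?G" "mc fj = 0"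
      using sr by (simp_all add: searching_def)
    have "fj \<notin> snd ` ?m" using snd_mates[OF con, of fj] f(4) by simp
    then have c: "fj \<notin> snd ` ?m - {j}" by simp
    have k: "qh - 1 < qt" using f(1,2) by linarith
    obtain m' where m': "matching ?G m'" "card m' = card ?m" "snd ` m' = insert fj (snd ` ?m - {j})"
      using exists_matching_through[OF m rj reach[OF k] f(3) c] by (elim exE conjE) (rule that)
    have "j \<noteq> fj" using e(2) f(4) by auto
    then have "snd (i, j) \<notin> snd ` m'" using m'(3) by simp
    then show ?thesis using m'(1,2) unfolding harmless_def by blast
  next
    case True
    then have iZ: "i \<notin> ?Z" using that by simp
    have "closed_rows ?G ?m ?Z" using searching_done_closed sr mp[OF fin True] True by blast
    then show ?thesis using harmless_separated[OF m Vc Vf _ rj rZ e(1) iZ e(3)] by blast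
  qed
  show "harmful_block ?G (card ?m) (i, j)" if found: "found = 0" and i: "seen i = st"
  proof (rule harmful_blockI[OF m Vc Vf, where A = "?Z - V"])
    have Zc: "closed_rows ?G ?m ?Z" using searching_done_closed sr mp[OF fin found] found by blast
    show "closed_rows ?G ?m (V \<union> (?Z - V))"
      using Zc Vc unfolding closed_rows_def by blast
    show "?Z - V \<subseteq> fst ` ?m"
      using Vf sr unfolding Z searching_def by blast
    show "(?Z - V) \<inter> V = {}" by blast
    show "(r, j) \<in> ?m" by (rule rj)
    show "i \<in> ?Z - V" using i e(3) by simp
    have "i \<in> q ` {..<qt}" using i Z by blast
    then show "(r, i) \<in> (alt_step ?G ?m)\<^sup>*" using reach by blast
    show "(i, j) \<in> ?G" by (rule e(1))
  qed
qed

definition check_vars :: "name set" where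
  "check_vars = search_vars \<union> {''stamp'', ''bad'', ''f''}"

lemma in_check_vars:
  "''stamp'' \<in> check_vars" "''r'' \<in> check_vars" "''seen'' \<in> check_vars" "''q'' \<in> check_vars" "''qt'' \<in> check_vars"
  "''qh'' \<in> check_vars" "''cur'' \<in> check_vars" "''found'' \<in> check_vars" "''bad'' \<in> check_vars" "''f'' \<in> check_vars"
  by (simp_all add: check_vars_def search_vars_def)

lemma wp_check_edge:
  assumes adj: "adjacency es s" and con: "consistent es (s ''mr'') (s ''mc'')"
    and seen: "\<And>r. s ''seen'' r \<le> s ''stamp'' 0" and V: "failed es (s ''mr'') V"
    and e: "e < length es" "s ''f'' 0 = e"
    and weight: "s ''weight'' e = (if row_of es e \<in> V then 0 else weight_of es e)"
    and n: "200 * length es + 200 + K \<le> n"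
    and Q: "\<And>s' n'. frame check_vars s s' \<Longrightarrow> s' ''f'' = s ''f'' \<Longrightarrow> (\<And>r. s' ''seen'' r \<le> s' ''stamp'' 0) \<Longrightarrow>
      (s' ''bad'' = s ''bad'' \<and> (weight_of es e = 0 \<or>
        harmless (graph_of es) (card (mates (s ''mr''))) (row_of es e, col_of es e))) \<or>
      (s' ''bad'' 0 = 1 \<and> harmful_edge es (card (mates (s ''mr''))) e) \<Longrightarrow> K \<le> n' \<Longrightarrow> Q s' n'"
  shows "wp check_edge Q s n"
proof -
  let ?E = "length es" and ?i = "row_of es e" and ?j = "col_of es e"
  have col: "s ''column'' e = ?j" "s ''row'' e = ?i" using adj e(1) by (simp_all add: adjacency_def input_def)
  have ij: "(?i, ?j) \<in> graph_of es" by (rule graph_ofI[OF e(1)])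
  obtain m where m: "n = m + 80" "200 * ?E + 120 + K \<le> m"
    using split_credits[of 80 "200 * ?E + 120 + K" n] n by auto
  show ?thesis
  proof (cases "0 < s ''weight'' e \<and> 0 < s ''mc'' ?j")
    case False
    have "weight_of es e = 0 \<or> harmless (graph_of es) (card (mates (s ''mr''))) (?i, ?j)"
    proof (cases "s ''mc'' ?j = 0")
      case True
      then show ?thesis using harmless_if_free_column[OF con] by blast
    next
      case mc: False
      then have "weight_of es e = 0 \<or> ?i \<in> V" using False weight by (auto split: if_splits)
      moreover have "harmless (graph_of es) (card (mates (s ''mr''))) (?i, ?j)" if "?i \<in> V"
        using V that harmless_if_row_reachable[OF con] unfolding failed_def by blast
      ultimately show ?thesis by blast
    qed
    then have "Q s (m + l)" for l using m(2) seen by (intro Q frame_refl) simp_all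
    then have "Q s (l + m)" for l by (simp add: add.commute)
    then show ?thesis
      unfolding check_edge_def m(1) using False col e(2)
      by (cases "s ''weight'' e = 0") (simp_all add: wp_If wp_Skip del: One_nat_def)
  next
    case True
    then obtain r where r: "s ''mc'' ?j = r + 1" by (metis Suc_eq_plus1 gr0_conv_Suc)
    have iV: "?i \<notin> V" and w: "0 < weight_of es e" using True weight by (auto split: if_splits)
    let ?st = "s ''stamp'' 0 + 1"
    define s1 where "s1 = s(''stamp'' := (s ''stamp'')(0 := ?st), ''r'' := (s ''r'')(0 := r),
      ''seen'' := (s ''seen'')(r := ?st), ''q'' := (s ''q'')(0 := r), ''qt'' := (s ''qt'')(0 := 1),
      ''qh'' := (s ''qh'')(0 := 0), ''cur'' := (s ''cur'')(0 := 0), ''found'' := (s ''found'')(0 := 0))"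
    have fr1: "frame check_vars s s1"
      unfolding s1_def by (intro frame_upd frame_refl in_check_vars)
    have s1: "s1 ''mr'' = s ''mr''" "s1 ''mc'' = s ''mc''" "s1 ''f'' = s ''f''" "s1 ''bad'' = s ''bad''" "s1 ''row'' = s ''row''"
      by (simp_all add: s1_def)
    have adj1: "adjacency es s1" using adj by (simp add: s1_def adjacency_def input_def)
    have img: "((s ''q'')(0 := r)) ` {..<1} = {r}" by auto
    have ne: "s ''seen'' x \<noteq> ?st" for x using seen[of x] by simp
    have "{x. ((s ''seen'')(r := ?st)) x = ?st} = {r}" using ne by auto
    moreover have "((s ''seen'')(r := ?st)) x \<le> ?st" for x using seen[of x] by simp
    ultimately have qd: "queued ((s ''q'')(0 := r)) 1 ((s ''seen'')(r := ?st)) ?st"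
      unfolding queued_def img by (simp add: lessThan_Suc)
    have "s ''mr'' r = Suc ?j" using con r by (simp add: consistent_def)
    then have "r \<in> matched_rows (s ''mr'')" by (simp add: matched_rows_def)
    then have "r \<in> fst ` graph_of es" using matched_rows_subset[OF con] by blast
    then have sr1: "searching_state es {r} s1"
      using searching_init[OF con qd, of "s ''fq''" "s ''fj'' 0"] unfolding img
      by (simp add: searching_state_def s1_def)
    let ?if = "If (And (Less (Var ''found'') (Const 1)) (Not (Less (Read ''seen'' (Read ''row'' (Var ''f''))) (Var ''stamp''))))
           (Assign ''bad'' (Const 1)) Skip"
    have main: "wp search (wp ?if Q) s1 l" if l: "200 * ?E + 100 + K \<le> l" for l
    proof (rule wp_search[OF adj1 sr1, of "50 + K"])
      show "200 * ?E + 50 + (50 + K) \<le> l" using l by simp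
      fix s2 n2
      assume fr2: "frame search_vars s1 s2" and sr2: "searching_state es {r} s2"
        and fin: "s2 ''found'' 0 = 0 \<Longrightarrow> s2 ''cur'' 0 = 0 \<and> s2 ''qh'' 0 = s2 ''qt'' 0" and n2: "50 + K \<le> n2"
      have s2: "s2 ''mr'' = s ''mr''" "s2 ''mc'' = s ''mc''" "s2 ''f'' = s ''f''" "s2 ''bad'' = s ''bad''" "s2 ''row'' = s ''row''"
        using fr2 s1 by (simp_all add: frame_def search_vars_def)
      have fr02: "frame check_vars s s2"
        by (rule frame_trans[OF fr1 fr2]) (simp_all only: check_vars_def order.refl Un_upper1)
      have seen2: "s2 ''seen'' x \<le> s2 ''stamp'' 0" for x
        by (rule searching_state_seen_le[OF sr2])
      have mc: "s ''mc'' ?j = Suc r" using r by simp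
      have fin': "s2 ''found'' 0 = 0 \<longrightarrow> s2 ''cur'' 0 = 0 \<and> s2 ''qh'' 0 = s2 ''qt'' 0"
        by (rule impI) (rule fin)
      note verdict = searched_verdict[OF sr2[unfolded searching_state_def s2] fin' V ij mc iV]
      obtain h where h: "n2 = h + 50" "K \<le> h"
        using split_credits[of 50 "K" n2] n2 by auto
      show "wp ?if Q s2 n2"
      proof (cases "s2 ''found'' 0 = 0 \<and> s2 ''seen'' ?i = s2 ''stamp'' 0")
        case True
        let ?s3 = "s2(''bad'' := (s2 ''bad'')(0 := 1))"
        have "Q ?s3 (x + h)" for x
        proof (rule Q)
          show "frame check_vars s ?s3" using fr02 by (intro frame_upd in_check_vars)
          show "?s3 ''f'' = s ''f''" by (simp add: s2)
          show "?s3 ''seen'' x \<le> ?s3 ''stamp'' 0" for x using seen2[of x] by simp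
          show "K \<le> x + h" using h(2) by simp
          have "harmful_edge es (card (mates (s ''mr''))) e"
            using verdict(2)[OF conjunct1[OF True] conjunct2[OF True]] e(1) w by (simp add: harmful_edge_def)
          then show "(?s3 ''bad'' = s ''bad'' \<and> (weight_of es e = 0 \<or>
              harmless (graph_of es) (card (mates (s ''mr''))) (?i, ?j))) \<or>
            (?s3 ''bad'' 0 = 1 \<and> harmful_edge es (card (mates (s ''mr''))) e)" by simp
        qed
        then show ?thesis
          unfolding h(1) using True e(2) col(2) by (simp add: s2 wp_If wp_Write del: One_nat_def)
      next
        case False
        have "Q s2 (x + h)" for x
        proof (rule Q[OF fr02 s2(3) seen2])
          show "K \<le> x + h" using h(2) by simp
          show "(s2 ''bad'' = s ''bad'' \<and> (weight_of es e = 0 \<or>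
              harmless (graph_of es) (card (mates (s ''mr''))) (?i, ?j))) \<or>
            (s2 ''bad'' 0 = 1 \<and> harmful_edge es (card (mates (s ''mr''))) e)"
            using verdict(1)[OF False] s2(4) by blast
        qed
        moreover have "\<not> (s2 ''found'' 0 < 1 \<and> \<not> s2 ''seen'' ?i < s2 ''stamp'' 0)"
          using False seen2[of ?i] by auto
        ultimately show ?thesis
          unfolding h(1) using e(2) col(2)
          by (cases "s2 ''found'' 0 < 1") (simp_all add: s2 wp_If wp_Skip del: One_nat_def less_one)
      qed
    qed
    have main': "wp search (wp ?if Q) s1 (x + m)" for x using main[of "x + m"] m(2) by simp
    then show ?thesis
      unfolding check_edge_def m(1) s1_def using True r col e(2)
      by (simp add: wp_If wp_Seq_fun wp_Write del: One_nat_def)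
  qed
qed

section \<open>The complete program\<close>

definition decide :: com where
  "decide = Seq build (Seq matching_phase (Seq mark (Seq (for_edges ''f'' check_edge)
     (Assign ''result'' (Minus (Const 1) (Var ''bad''))))))"

text \<open>Each answer comes with its certificate: a tight cover and harmlessness of all
  nonconstant entries, or one harmful entry. The matching is bound existentially, which separates
  the algebra from the way it was computed.\<close>

definition verdict :: "(nat \<times> nat \<times> nat) list \<Rightarrow> nat \<Rightarrow> bool" where
  "verdict es r \<longleftrightarrow> (\<exists>m. matching (graph_of es) m \<and>
     ((r = 1 \<and> (\<exists>R C. cover (graph_of es) R C \<and> card R + card C = card m) \<and>
        (\<forall>e<length es. weight_of es e = 0 \<or> harmless (graph_of es) (card m) (row_of es e, col_of es e))) \<or>
      (r = 0 \<and> (\<exists>e. harmful_edge es (card m) e))))"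

lemma wp_decide:
  assumes inp: "input es s" and weight: "\<And>e. e < length es \<Longrightarrow> s ''weight'' e = weight_of es e"
    and zero: "\<And>x. x \<notin> {''rows'', ''columns'', ''edges'', ''row'', ''column'', ''weight''} \<Longrightarrow> s x = (\<lambda>_. 0)"
    and n: "2000 * (length es + 1) * (length es + 1) \<le> n"
  shows "wp decide (\<lambda>s' n'. verdict es (s' ''result'' 0)) s n"
proof -
  let ?E = "length es"
  \<comment> \<open>\<open>K1\<close>, \<open>K2\<close> and \<open>K3\<close> are the credits still
    required after building the lists, after the matching phase and after the marking.\<close>
  define K3 where "K3 = (200 * ?E + 220) * ?E + 40"
  define K2 where "K2 = 60 * ?E + 20 + K3"
  define K1 where "K1 = (400 * ?E + 310) * (?E + 1) + 20 + K2"
  have "60 * ?E + 20 + K1 \<le> 2000 * (?E + 1) * (?E + 1)"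
    by (simp add: K1_def K2_def K3_def algebra_simps)
  then have n: "60 * ?E + 20 + K1 \<le> n" using n by simp
  show ?thesis
    unfolding decide_def wp_Seq_fun
  proof (rule wp_build[OF inp _ n])
    show "s ''head'' i = 0" for i using zero by simp
    fix s1 n1
    assume fr1: "frame {''e'', ''next'', ''head''} s s1" and adj1: "adjacency es s1" and n1: "K1 \<le> n1"
    have s1: "s1 ''mr'' = (\<lambda>_. 0)" "s1 ''mc'' = (\<lambda>_. 0)" "s1 ''seen'' = (\<lambda>_. 0)" "s1 ''stamp'' = (\<lambda>_. 0)"
      "s1 ''bad'' = (\<lambda>_. 0)"
      using fr1 zero by (simp_all add: frame_def)
    have w1: "s1 ''weight'' = s ''weight''" using fr1 by (simp add: frame_def)
    show "wp matching_phase (wp mark (wp (for_edges ''f'' check_edge)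
       (wp (Assign ''result'' (Minus (Const 1) (Var ''bad''))) (\<lambda>s' n'. verdict es (s' ''result'' 0))))) s1 n1"
    proof (rule wp_matching_phase[OF adj1 _ _ _ n1[unfolded K1_def]])
      show "s1 ''mr'' = (\<lambda>_. 0)" "s1 ''mc'' = (\<lambda>_. 0)" using s1 by simp_all
      show "s1 ''seen'' r \<le> s1 ''stamp'' 0" for r using s1 by simp
      fix s2 n2
      assume fr2: "frame match_vars s1 s2" and con2: "consistent es (s2 ''mr'') (s2 ''mc'')"
        and seen2: "\<And>r. s2 ''seen'' r \<le> s2 ''stamp'' 0"
        and V: "failed es (s2 ''mr'') {r. s2 ''seen'' r = s2 ''stamp'' 0}" and n2: "K2 \<le> n2"
      let ?V = "{r. s2 ''seen'' r = s2 ''stamp'' 0}" and ?m = "mates (s2 ''mr'')"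
      have s2: "s2 ''weight'' = s ''weight''" "s2 ''bad'' 0 = 0"
        using fr2 w1 s1 by (simp_all add: frame_def match_vars_def search_vars_def augment_vars_def)
      have adj2: "adjacency es s2"
        using adj1 fr2 by (simp add: frame_def adjacency_def input_def match_vars_def search_vars_def augment_vars_def)
      have m: "matching (graph_of es) ?m" by (rule matching_mates[OF con2])
      show "wp mark (wp (for_edges ''f'' check_edge)
         (wp (Assign ''result'' (Minus (Const 1) (Var ''bad''))) (\<lambda>s' n'. verdict es (s' ''result'' 0)))) s2 n2"
      proof (rule wp_mark[OF adj2 seen2 _ n2[unfolded K2_def]])
        show "s2 ''weight'' e = weight_of es e" if "e < ?E" for e using weight[OF that] s2 by simp
        fix s3 n3
        assume fr3: "frame {''e'', ''weight''} s2 s3"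
          and w3: "\<And>e. e < ?E \<Longrightarrow> s3 ''weight'' e = (if s2 ''seen'' (row_of es e) = s2 ''stamp'' 0 then 0 else weight_of es e)"
          and n3: "K3 \<le> n3"
        have s3: "s3 ''mr'' = s2 ''mr''" "s3 ''mc'' = s2 ''mc''" "s3 ''seen'' = s2 ''seen''" "s3 ''stamp'' = s2 ''stamp''"
          "s3 ''bad'' = s2 ''bad''"
          using fr3 by (simp_all add: frame_def)
        have adj3: "adjacency es s3" using adj2 fr3 by (simp add: frame_def adjacency_def input_def)
        define J where "J k s' \<longleftrightarrow> frame check_vars s3 s' \<and> (\<forall>r. s' ''seen'' r \<le> s' ''stamp'' 0) \<and>
           ((s' ''bad'' 0 = 0 \<and> (\<forall>e<k. weight_of es e = 0 \<or> harmless (graph_of es) (card ?m) (row_of es e, col_of es e))) \<or>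
            (s' ''bad'' 0 = 1 \<and> (\<exists>e. harmful_edge es (card ?m) e)))" for k s'
        have adjJ: "adjacency es s'" if "J k s'" for k s'
          using adj3 that by (simp add: J_def frame_def adjacency_def input_def check_vars_def search_vars_def)
        show "wp (for_edges ''f'' check_edge)
          (wp (Assign ''result'' (Minus (Const 1) (Var ''bad''))) (\<lambda>s' n'. verdict es (s' ''result'' 0))) s3 n3"
        proof (rule wp_for_edges[where J = J and E = ?E and C = "200 * ?E + 200" and K = 20], goal_cases)
          case 2
          have "frame check_vars s3 (s3(''f'' := (s3 ''f'')(0 := 0)))" by (intro frame_upd frame_refl in_check_vars)
          then show ?case using seen2 s2 by (simp add: J_def s3)
        next
          case (3 k s')
          then show ?case using adjJ[of k s'] by (simp add: adjacency_def input_def)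
        next
          case (4 k s' n)
          have fr: "frame check_vars s3 s'" and seen: "\<And>r. s' ''seen'' r \<le> s' ''stamp'' 0"
            using 4(2) by (simp_all add: J_def)
          have s': "s' ''mr'' = s2 ''mr''" "s' ''mc'' = s2 ''mc''" "s' ''weight'' = s3 ''weight''"
            using fr by (simp_all add: frame_def check_vars_def search_vars_def s3)
          have w: "s' ''weight'' k = (if row_of es k \<in> ?V then 0 else weight_of es k)"
            using w3[OF 4(1)] by (simp add: s')
          show ?case
          proof (rule wp_check_edge[OF adjJ[OF 4(2)] _ seen _ 4(1,3) w, of "n - (200 * ?E + 200)"])
            show "consistent es (s' ''mr'') (s' ''mc'')" using con2 by (simp add: s')
            show "failed es (s' ''mr'') ?V" using V by (simp add: s')
            show "200 * ?E + 200 + (n - (200 * ?E + 200)) \<le> n" using 4(4) by simp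
            fix s'' n''
            assume fr'': "frame check_vars s' s''" and f: "s'' ''f'' = s' ''f''"
              and seen'': "\<And>r. s'' ''seen'' r \<le> s'' ''stamp'' 0"
              and res: "(s'' ''bad'' = s' ''bad'' \<and> (weight_of es k = 0 \<or>
                harmless (graph_of es) (card (mates (s' ''mr''))) (row_of es k, col_of es k))) \<or>
                (s'' ''bad'' 0 = 1 \<and> harmful_edge es (card (mates (s' ''mr''))) k)"
              and n'': "n - (200 * ?E + 200) \<le> n''"
            let ?s = "s''(''f'' := (s'' ''f'')(0 := Suc k))"
            have "frame check_vars s3 s''" by (rule frame_trans[OF fr fr'']) simp_all
            then have "frame check_vars s3 ?s" by (intro frame_upd in_check_vars)
            moreover have "(?s ''bad'' 0 = 0 \<and> (\<forall>e<Suc k. weight_of es e = 0 \<or>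
                harmless (graph_of es) (card ?m) (row_of es e, col_of es e))) \<or>
              (?s ''bad'' 0 = 1 \<and> (\<exists>e. harmful_edge es (card ?m) e))"
              using res 4(2) unfolding J_def s' by (auto simp: less_Suc_eq)
            moreover have "?s ''seen'' r \<le> ?s ''stamp'' 0" for r using seen''[of r] by simp
            ultimately have "J (Suc k) ?s" unfolding J_def by blast
            then show "s'' ''f'' 0 = k \<and> J (Suc k) ?s \<and> n \<le> n'' + (200 * ?E + 200)"
              using f 4(3) n'' by auto
          qed
        next
          case 5
          then show ?case using n3 by (simp add: K3_def algebra_simps)
        next
          case (6 s' n)
          have cov: "\<exists>R C. cover (graph_of es) R C \<and> card R + card C = card ?m"
          proof -
            have "closed_rows (graph_of es) ?m ?V" "fst ` graph_of es - fst ` ?m \<subseteq> ?V"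
              using V by (simp_all add: failed_def fst_mates)
            from cover_closed_rows[OF m this] show ?thesis by blast
          qed
          have "verdict es (1 - s' ''bad'' 0)"
            using 6(1) cov m unfolding verdict_def J_def by (intro exI[of _ ?m]) auto
          then show ?case using 6(2) by (simp add: wp_Write)
        qed simp
      qed
    qed
  qed
qed

lemma edge_list_props:
  assumes "edge_list_of M es"
  shows "graph_of es = nonzero_positions M" "length es = card (nonzero_positions M)"
    "\<And>e. e < length es \<Longrightarrow> weight_of es e = degree (M $$ (row_of es e, col_of es e))"
proof -
  have es: "distinct es" "set es = (\<lambda>(i, j). (i, j, degree (M $$ (i, j)))) ` nonzero_positions M"
    using assms by (simp_all add: edge_list_of_def)
  have "graph_of es = (\<lambda>x. (fst x, fst (snd x))) ` set es"
    unfolding graph_of_def by (auto simp: set_conv_nth image_iff)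
  then show "graph_of es = nonzero_positions M"
    unfolding es(2) by (simp add: image_image case_prod_unfold)
  have "inj_on (\<lambda>(i, j). (i, j, degree (M $$ (i, j)))) (nonzero_positions M)"
    by (auto simp: inj_on_def)
  then have "card (set es) = card (nonzero_positions M)"
    unfolding es(2) by (rule card_image)
  then show "length es = card (nonzero_positions M)"
    by (simp add: distinct_card[OF es(1)])
  show "weight_of es e = degree (M $$ (row_of es e, col_of es e))" if "e < length es" for e
  proof -
    have "es ! e \<in> set es" using that by simp
    then show ?thesis unfolding es(2) by auto
  qed
qed

lemma structurally_controllable_verdict:
  assumes es: "edge_list_of M es" and v: "verdict es r"
  shows "r = (if structurally_controllable M then 1 else 0)"
proof -
  note props = edge_list_props[OF es]
  obtain m where m: "matching (nonzero_positions M) m"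
    and alt: "(r = 1 \<and> (\<exists>R C. cover (nonzero_positions M) R C \<and> card R + card C = card m) \<and>
        (\<forall>e<length es. weight_of es e = 0 \<or> harmless (nonzero_positions M) (card m) (row_of es e, col_of es e))) \<or>
      (r = 0 \<and> (\<exists>e. harmful_edge es (card m) e))"
    using v unfolding verdict_def props(1) by blast
  from alt show ?thesis
  proof (elim disjE conjE exE)
    fix R C
    assume r: "r = 1" and cov: "cover (nonzero_positions M) R C" "card R + card C = card m"
      and ok: "\<forall>e<length es. weight_of es e = 0 \<or> harmless (nonzero_positions M) (card m) (row_of es e, col_of es e)"
    have "harmless (nonzero_positions M) (card m) (i, j)"
      if ij: "(i, j) \<in> nonzero_positions M" "degree (M $$ (i, j)) > 0" for i j
    proof -
      obtain e where "e < length es" "i = row_of es e" "j = col_of es e"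
        using ij(1) unfolding props(1)[symmetric] graph_of_def by auto
      then show ?thesis using ok props(3)[of e] ij(2) by auto
    qed
    then have "structurally_controllable M"
      by (rule structurally_controllable_if_harmless[OF m refl cov])
    then show ?thesis using r by simp
  next
    fix e assume r: "r = 0" and e: "harmful_edge es (card m) e"
    then have "harmful_block (nonzero_positions M) (card m) (row_of es e, col_of es e)"
      "degree (M $$ (row_of es e, col_of es e)) > 0"
      using props(3)[of e] by (simp_all add: harmful_edge_def props(1))
    then have "\<not> structurally_controllable M"
      by (rule not_structurally_controllable_if_harmful[OF m])
    then show ?thesis using r by simp
  qed
qed

lemma input_input_state: "input es (input_state p v es)"
  by (simp add: input_def input_state_def scalar_def array_def case_prod_unfold)

theorem lemma6:
  shows "\<exists>(prog :: com) (C :: real). \<forall>(p :: nat) (v :: nat) (M :: real poly mat) es.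
    M \<in> carrier_mat p v \<longrightarrow> edge_list_of M es \<longrightarrow>
    (\<exists>t s'. exec prog (input_state p v es) t s' \<and>
       s' ''result'' 0 = (if structurally_controllable M then 1 else 0) \<and>
       real t \<le> C * max 1 (real (card (nonzero_positions M)) ^ 2 * sqrt (real (p + v))))"
proof (rule exI[of _ decide], rule exI[of _ 8000], intro allI impI)
  fix p v :: nat and M :: "real poly mat" and es
  assume M: "M \<in> carrier_mat p v" and es: "edge_list_of M es"
  let ?s = "input_state p v es" and ?E = "length es"
  have "wp decide (\<lambda>s' n'. verdict es (s' ''result'' 0)) ?s (2000 * (?E + 1) * (?E + 1))"
  proof (rule wp_decide[OF input_input_state])
    show "?s ''weight'' e = weight_of es e" if "e < ?E" for e
      using that by (simp add: input_state_def array_def case_prod_unfold)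
    show "?s x = (\<lambda>_. 0)" if "x \<notin> {''rows'', ''columns'', ''edges'', ''row'', ''column'', ''weight''}" for x
      using that by (simp add: input_state_def)
  qed simp
  then obtain t s' where t: "exec decide ?s t s'" "t \<le> 2000 * (?E + 1) * (?E + 1)" "verdict es (s' ''result'' 0)"
    by (auto simp: wp_def)
  \<comment> \<open>If there is an entry, then \<open>p + v\<close> is positive, so the square root
    is at least 1, and \<open>?E + 1 \<le> 2 * ?E\<close> gives the factor 4; without entries the
    maximum with 1 takes over. Together with the 2000 of the credit bound this is the origin of
    8000.\<close>
  have "real ((?E + 1) * (?E + 1)) \<le> 4 * max 1 (real ?E ^ 2 * sqrt (real (p + v)))"
  proof (cases "?E = 0")
    case False
    then have "nonzero_positions M \<noteq> {}" using edge_list_props(2)[OF es] by auto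
    then have "1 \<le> p + v" using M by (auto simp: nonzero_positions_def)
    then have "1 \<le> sqrt (real (p + v))" by simp
    then have "real ?E ^ 2 * 1 \<le> real ?E ^ 2 * sqrt (real (p + v))" by (intro mult_left_mono) auto
    moreover have "real ((?E + 1) * (?E + 1)) \<le> 4 * real ?E ^ 2"
    proof -
      have "?E + 1 \<le> 2 * ?E" using False by linarith
      then have "(?E + 1) * (?E + 1) \<le> (2 * ?E) * (2 * ?E)" by (intro mult_le_mono)
      then have "real ((?E + 1) * (?E + 1)) \<le> real ((2 * ?E) * (2 * ?E))" by (simp only: of_nat_le_iff)
      then show ?thesis by (simp add: power2_eq_square)
    qed
    ultimately show ?thesis by linarith
  qed simp
  moreover have "real t \<le> 2000 * real ((?E + 1) * (?E + 1))"
  proof -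
    have "real t \<le> real (2000 * ((?E + 1) * (?E + 1)))" using t(2) by (simp only: of_nat_le_iff mult.assoc)
    then show ?thesis by simp
  qed
  ultimately have "real t \<le> 8000 * max 1 (real (card (nonzero_positions M)) ^ 2 * sqrt (real (p + v)))"
    unfolding edge_list_props(2)[OF es] by linarith
  with t(1) structurally_controllable_verdict[OF es t(3)]
  show "\<exists>t s'. exec decide ?s t s' \<and> s' ''result'' 0 = (if structurally_controllable M then 1 else 0) \<and>
     real t \<le> 8000 * max 1 (real (card (nonzero_positions M)) ^ 2 * sqrt (real (p + v)))"
    by blast
qed

end
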